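(* Let $G=(V,E,\ell)$ be an undirected graph with $n$ vertices, $m$ edges and nonnegative edge weights $\ell$, and let $t\in V$. Then the values $s^{-uu'}_u$ for all edges $uu'\in E$ (for both orientations of each edge) can be computed in $O(m\log n)$ time and $O(n+m)$ (linear) space on a random access machine. Furthermore, these values can be stored in a data structure of size $O(n)$ from which each value can be retrieved.
   Context: For an edge $e\in E$ and a vertex $x\in V$, $s^{-e}_x=d_{G-e}(x,t)$ denotes the shortest-path distance from $x$ to $t$ in the graph $G-e$ obtained by deleting $e$ (infinite if no path exists). *)

theory Defs
  imports "Graph_Theory.Pair_Digraph" "Graph_Theory.Shortest_Path"
begin

section \<open>Weighted undirected graphs and distances\<close>

definition simple_graph :: "'a set \<Rightarrow> 'a set set \<Rightarrow> bool" where
  "simple_graph V E \<longleftrightarrow>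
     finite V \<and> (\<forall>e\<in>E. \<exists>u\<in>V. \<exists>v\<in>V. u \<noteq> v \<and> e = {u, v})"

text \<open>
  Walks in an undirected graph are walks in the digraph that has both orientations of every edge.
  \<open>\<mu>\<close> is the infimum of the costs of all walks between two vertices, hence \<open>\<infinity>\<close> if there are none;
  for nonnegative weights it is attained by a path whenever it is finite.
\<close>

definition bidirected :: "'a set \<Rightarrow> 'a set set \<Rightarrow> ('a, 'a \<times> 'a) pre_digraph" where
  "bidirected V E = with_proj \<lparr>pverts = V, parcs = {(u, v). {u, v} \<in> E}\<rparr>"

definition distance :: "'a set \<Rightarrow> 'a set set \<Rightarrow> ('a set \<Rightarrow> real) \<Rightarrow> 'a \<Rightarrow> 'a \<Rightarrow> ereal" where
  "distance V E l x y = wf_digraph.\<mu> (bidirected V E) (\<lambda>(u, v). l {u, v}) x y"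

definition repl_distance ::
  "'a set \<Rightarrow> 'a set set \<Rightarrow> ('a set \<Rightarrow> real) \<Rightarrow> 'a \<Rightarrow> 'a set \<Rightarrow> 'a \<Rightarrow> ereal" where
  "repl_distance V E l t e x = distance V (E - {e}) l x t"


section \<open>Random access machine\<close>

text \<open>
  A unit-cost random access machine with two sorts of data. Words are natural numbers;
  they serve as addresses and support the usual arithmetic. Lengths are real numbers or the
  sentinel \<open>\<infinity>\<close>; they can only be copied, added, subtracted and compared, and there is no
  conversion between the two sorts. Each sort has directly addressed registers, of which a
  program can mention only finitely many, and an indirectly addressed memory.
  Words are unbounded here, but \<open>fits\<close> below makes their magnitude part of the space
  requirement, so that no information can be packed into huge words: in space linear in the
  size of the input, all words have logarithmically many bits.
\<close>

datatype word_op = Plus | Minus | Times | Divide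

primrec apply_op :: "word_op \<Rightarrow> nat \<Rightarrow> nat \<Rightarrow> nat" where
  "apply_op Plus a b = a + b"
| "apply_op Minus a b = a - b"
| "apply_op Times a b = a * b"
| "apply_op Divide a b = a div b"

datatype instr =
    SetW nat nat
  | MoveW nat nat
  | OpW word_op nat nat nat
  | LoadW nat nat
  | StoreW nat nat
  | ZeroL nat
  | InfL nat
  | MoveL nat nat
  | AddL nat nat nat
  | SubL nat nat nat
  | LoadL nat nat
  | StoreL nat nat
  | Jump nat
  | JumpLessW nat nat nat
  | JumpLessL nat nat nat

type_synonym program = "instr list"

record ram =
  pc :: nat
  wreg :: "nat \<Rightarrow> nat"
  wmem :: "nat \<Rightarrow> nat"
  lreg :: "nat \<Rightarrow> ereal"
  lmem :: "nat \<Rightarrow> ereal"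

abbreviation advance :: "ram \<Rightarrow> ram" where
  "advance s \<equiv> s\<lparr>pc := Suc (pc s)\<rparr>"

primrec exec :: "instr \<Rightarrow> ram \<Rightarrow> ram" where
  "exec (SetW i c) s = advance (s\<lparr>wreg := (wreg s)(i := c)\<rparr>)"
| "exec (MoveW i j) s = advance (s\<lparr>wreg := (wreg s)(i := wreg s j)\<rparr>)"
| "exec (OpW f i j k) s = advance (s\<lparr>wreg := (wreg s)(i := apply_op f (wreg s j) (wreg s k))\<rparr>)"
| "exec (LoadW i j) s = advance (s\<lparr>wreg := (wreg s)(i := wmem s (wreg s j))\<rparr>)"
| "exec (StoreW i j) s = advance (s\<lparr>wmem := (wmem s)(wreg s i := wreg s j)\<rparr>)"
| "exec (ZeroL i) s = advance (s\<lparr>lreg := (lreg s)(i := 0)\<rparr>)"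
| "exec (InfL i) s = advance (s\<lparr>lreg := (lreg s)(i := \<infinity>)\<rparr>)"
| "exec (MoveL i j) s = advance (s\<lparr>lreg := (lreg s)(i := lreg s j)\<rparr>)"
| "exec (AddL i j k) s = advance (s\<lparr>lreg := (lreg s)(i := lreg s j + lreg s k)\<rparr>)"
| "exec (SubL i j k) s = advance (s\<lparr>lreg := (lreg s)(i := lreg s j - lreg s k)\<rparr>)"
| "exec (LoadL i j) s = advance (s\<lparr>lreg := (lreg s)(i := lmem s (wreg s j))\<rparr>)"
| "exec (StoreL i j) s = advance (s\<lparr>lmem := (lmem s)(wreg s i := lreg s j)\<rparr>)"
| "exec (Jump a) s = s\<lparr>pc := a\<rparr>"
| "exec (JumpLessW i j a) s = (if wreg s i < wreg s j then s\<lparr>pc := a\<rparr> else advance s)"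
| "exec (JumpLessL i j a) s = (if lreg s i < lreg s j then s\<lparr>pc := a\<rparr> else advance s)"

definition halted :: "program \<Rightarrow> ram \<Rightarrow> bool" where
  "halted P s \<longleftrightarrow> length P \<le> pc s"

definition step :: "program \<Rightarrow> ram \<Rightarrow> ram" where
  "step P s = (if halted P s then s else exec (P ! pc s) s)"

text \<open>
  Cells that hold zero are indistinguishable from unused ones. As addresses are words, a run whose
  configurations all fit into space \<open>S\<close> does not even read beyond address \<open>S\<close>.
\<close>

definition fits :: "nat \<Rightarrow> ram \<Rightarrow> bool" where
  "fits S s \<longleftrightarrow>
     (\<forall>a\<ge>S. wmem s a = 0 \<and> lmem s a = 0) \<and>
     (\<forall>a. wmem s a \<le> S) \<and> (\<forall>i. wreg s i \<le> S)"

definition runs :: "program \<Rightarrow> ram \<Rightarrow> real \<Rightarrow> nat \<Rightarrow> ram \<Rightarrow> bool" where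
  "runs P s T S s' \<longleftrightarrow>
     (\<exists>k. real k \<le> T \<and> (step P ^^ k) s = s' \<and> halted P s' \<and>
          (\<forall>j\<le>k. fits S ((step P ^^ j) s)))"

definition cells :: "'a::zero list \<Rightarrow> nat \<Rightarrow> 'a" where
  "cells xs a = (if a < length xs then xs ! a else 0)"

definition block :: "(nat \<Rightarrow> 'a) \<Rightarrow> nat \<Rightarrow> nat \<Rightarrow> 'a list" where
  "block mem a k = map mem [a..<a + k]"

definition start :: "nat list \<Rightarrow> nat list \<Rightarrow> ereal list \<Rightarrow> ram" where
  "start rs ws ls = \<lparr>pc = 0, wreg = cells rs, wmem = cells ws, lreg = (\<lambda>_. 0), lmem = cells ls\<rparr>"


section \<open>Input, output and the data structure\<close>

text \<open>
  A graph with vertices \<open>0, \<dots>, n - 1\<close> is given to the machine by its number of vertices, its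
  number of edges and an array that lists every edge once, in arbitrary order and orientation;
  the weights are in a parallel array.
\<close>

definition lists_edges :: "(nat \<times> nat) list \<Rightarrow> nat set set \<Rightarrow> bool" where
  "lists_edges es E \<longleftrightarrow>
     distinct (map (\<lambda>(u, v). {u, v}) es) \<and> set (map (\<lambda>(u, v). {u, v}) es) = E"

definition graph_input :: "nat \<Rightarrow> (nat \<times> nat) list \<Rightarrow> (nat set \<Rightarrow> real) \<Rightarrow> nat \<Rightarrow> ram" where
  "graph_input n es l t =
     start [n, length es, t]
       (concat (map (\<lambda>(u, v). [u, v]) es))
       (map (\<lambda>(u, v). ereal (l {u, v})) es)"

text \<open>
  Word register 0 points to the array of all values. Word registers 1 and 2 (3 and 4) contain
  the start and the length of the word part (length part) of the data structure.
\<close>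

definition outputs_values ::
  "nat set \<Rightarrow> nat set set \<Rightarrow> (nat \<times> nat) list \<Rightarrow> (nat set \<Rightarrow> real) \<Rightarrow> nat \<Rightarrow> ram \<Rightarrow> bool" where
  "outputs_values V E es l t s \<longleftrightarrow>
     (\<forall>i<length es. case es ! i of (u, v) \<Rightarrow>
        lmem s (wreg s 0 + 2 * i) = repl_distance V E l t {u, v} u \<and>
        lmem s (wreg s 0 + 2 * i + 1) = repl_distance V E l t {u, v} v)"

definition ds_words :: "ram \<Rightarrow> nat list" where
  "ds_words s = block (wmem s) (wreg s 1) (wreg s 2)"

definition ds_lengths :: "ram \<Rightarrow> ereal list" where
  "ds_lengths s = block (lmem s) (wreg s 3) (wreg s 4)"

text \<open>
  A query is answered from the data structure alone, relocated to address 0, in an otherwise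
  blank memory.
\<close>

definition query_input :: "nat list \<Rightarrow> ereal list \<Rightarrow> nat \<Rightarrow> nat \<Rightarrow> ram" where
  "query_input ws ls u u' = start [u, u'] ws ls"

end

theory Submission
  imports Defs
begin

text \<open>
  Dijkstra's algorithm yields a shortest path tree towards \<open>t\<close> with distances \<open>d\<close>. If \<open>u'\<close> is
  not the parent of \<open>u\<close>, then the tree path of \<open>u\<close> avoids the edge \<open>uu'\<close> and the value is \<open>d u\<close>.
  Otherwise a best detour leaves the subtree of \<open>u\<close> through a single non-tree edge \<open>xy\<close>, and
  the value is the minimum of \<open>d x + l(xy) + d y - d u\<close> over the non-tree edges with exactly one end in
  the subtree. So the non-tree edges are taken in order of \<open>d x + l(xy) + d y\<close>, and each one climbs from
  both of its ends to their common ancestor and settles the vertices on its way that have no value yet.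
  Settled vertices are merged with their parents by union-find, hence no vertex is visited twice.
  Only parent, distance and replacement value of every vertex need to be stored.

  The time bound leaves no room for initialising arrays of size \<open>n\<close> when there are few edges. Both priority
  queues are therefore tournament trees, which are empty in zero-initialised memory.

  The only fact about shortest paths that is needed is that the distance to \<open>t\<close> is the largest
  feasible potential that vanishes at \<open>t\<close>.
\<close>

section \<open>A structured language for the machine\<close>

text \<open>A budget of \<open>O(m log n)\<close> forbids even one pass over the vertices when most
  of them are isolated. So the data structure cannot be copied into place: the arrays are
  interleaved in records of nine cells per vertex, and parent, distance and replacement value
  already lie in one window of \<open>9 * n\<close> cells, which is returned as it is. Entries of a
  vertex are initialised only when it is settled, and rounds are counted by endpoints of edges
  instead of vertices.

  Weights may be zero, hence distances need not decrease strictly towards the root. The order of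
  settling serves as the measure on the tree; it also tells which of two climbs has to move, so that
  common ancestors are never computed.

  A detour over \<open>xy\<close> matters for \<open>u\<close> exactly when the tree path between
  \<open>x\<close> and \<open>y\<close> uses the edge from \<open>u\<close> to its parent. Searches
  by union by rank are logarithmic, which fits the budget.

  Correctness, memory safety, word size and time are proved together for a structured language; a
  verified compiler carries them over to the machine.\<close>

text \<open>
  \<open>clock\<close> is a ghost counter; every tick is paid for by at most six machine steps.
\<close>

record store =
  wvar :: "nat \<Rightarrow> nat"
  lvar :: "nat \<Rightarrow> ereal"
  warr :: "nat \<Rightarrow> nat \<Rightarrow> nat"
  larr :: "nat \<Rightarrow> nat \<Rightarrow> ereal"
  clock :: nat

datatype act =
    Const nat nat
  | Copy nat nat
  | Arith word_op nat nat nat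
  | Get nat nat nat
  | Put nat nat nat
  | LZero nat
  | LInf nat
  | LAdd nat nat nat
  | LSub nat nat nat
  | LGet nat nat nat
  | LPut nat nat nat

datatype test = LessT nat nat | LLessT nat nat | NeqT nat nat

datatype cmd =
    Act act
  | Seq cmd cmd (infixr ";;" 60)
  | Cond test cmd cmd
  | Loop test cmd
  | Nop

abbreviation tick :: "store \<Rightarrow> store" where
  "tick s \<equiv> s\<lparr>clock := Suc (clock s)\<rparr>"

primrec perform :: "act \<Rightarrow> store \<Rightarrow> store" where
  "perform (Const x c) s = tick (s\<lparr>wvar := (wvar s)(x := c)\<rparr>)"
| "perform (Copy x y) s = tick (s\<lparr>wvar := (wvar s)(x := wvar s y)\<rparr>)"
| "perform (Arith f x y z) s = tick (s\<lparr>wvar := (wvar s)(x := apply_op f (wvar s y) (wvar s z))\<rparr>)"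
| "perform (Get x j y) s = tick (s\<lparr>wvar := (wvar s)(x := warr s j (wvar s y))\<rparr>)"
| "perform (Put j y x) s = tick (s\<lparr>warr := (warr s)(j := (warr s j)(wvar s y := wvar s x))\<rparr>)"
| "perform (LZero x) s = tick (s\<lparr>lvar := (lvar s)(x := 0)\<rparr>)"
| "perform (LInf x) s = tick (s\<lparr>lvar := (lvar s)(x := \<infinity>)\<rparr>)"
| "perform (LAdd x y z) s = tick (s\<lparr>lvar := (lvar s)(x := lvar s y + lvar s z)\<rparr>)"
| "perform (LSub x y z) s = tick (s\<lparr>lvar := (lvar s)(x := lvar s y - lvar s z)\<rparr>)"
| "perform (LGet x j y) s = tick (s\<lparr>lvar := (lvar s)(x := larr s j (wvar s y))\<rparr>)"
| "perform (LPut j y x) s = tick (s\<lparr>larr := (larr s)(j := (larr s j)(wvar s y := lvar s x))\<rparr>)"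

primrec holds :: "test \<Rightarrow> store \<Rightarrow> bool" where
  "holds (LessT x y) s \<longleftrightarrow> wvar s x < wvar s y"
| "holds (LLessT x y) s \<longleftrightarrow> lvar s x < lvar s y"
| "holds (NeqT x y) s \<longleftrightarrow> wvar s x \<noteq> wvar s y"

text \<open>
  Arrays 0 to 8 are interleaved in memory from address \<open>9 * M\<close> on and may be used up to index \<open>L\<close>;
  array 9 is the memory below that address, where the input resides. Words are bounded by \<open>B\<close>.
\<close>

definition address :: "nat \<Rightarrow> nat \<Rightarrow> nat \<Rightarrow> nat" where
  "address M j i = (if j < 9 then 9 * (M + i) + j else i)"

definition cell_ok :: "nat \<Rightarrow> nat \<Rightarrow> nat \<Rightarrow> nat \<Rightarrow> bool" where
  "cell_ok M L j i \<longleftrightarrow> j < 9 \<and> i < L \<or> j = 9 \<and> i < 9 * M"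

section \<open>Total correctness calculus with a clock\<close>

locale machine =
  fixes M L B :: nat
begin

primrec safe :: "act \<Rightarrow> store \<Rightarrow> bool" where
  "safe (Const x c) s \<longleftrightarrow> c \<le> B"
| "safe (Copy x y) s \<longleftrightarrow> True"
| "safe (Arith f x y z) s \<longleftrightarrow> apply_op f (wvar s y) (wvar s z) \<le> B"
| "safe (Get x j y) s \<longleftrightarrow> cell_ok M L j (wvar s y)"
| "safe (Put j y x) s \<longleftrightarrow> cell_ok M L j (wvar s y)"
| "safe (LZero x) s \<longleftrightarrow> True"
| "safe (LInf x) s \<longleftrightarrow> True"
| "safe (LAdd x y z) s \<longleftrightarrow> True"
| "safe (LSub x y z) s \<longleftrightarrow> True"
| "safe (LGet x j y) s \<longleftrightarrow> cell_ok M L j (wvar s y)"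
| "safe (LPut j y x) s \<longleftrightarrow> cell_ok M L j (wvar s y)"

inductive big :: "cmd \<Rightarrow> store \<Rightarrow> store \<Rightarrow> bool" where
  Nop: "big Nop s s"
| Act: "safe a s \<Longrightarrow> big (Act a) s (perform a s)"
| Seq: "big c s s' \<Longrightarrow> big d s' s'' \<Longrightarrow> big (c ;; d) s s''"
| CondT: "holds b s \<Longrightarrow> big c (tick s) s' \<Longrightarrow> big (Cond b c d) s s'"
| CondF: "\<not> holds b s \<Longrightarrow> big d (tick s) s' \<Longrightarrow> big (Cond b c d) s s'"
| LoopF: "\<not> holds b s \<Longrightarrow> big (Loop b c) s (tick s)"
| LoopT: "holds b s \<Longrightarrow> big c (tick s) s' \<Longrightarrow> big (Loop b c) s' s'' \<Longrightarrow> big (Loop b c) s s''"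

text \<open>An unsafe action has no derivation, so a derivation certifies termination and memory
  safety as well. Evaluation is deterministic, hence asking for one good final store loses
  nothing.\<close>

definition wp :: "cmd \<Rightarrow> (store \<Rightarrow> bool) \<Rightarrow> store \<Rightarrow> bool" where
  "wp c Q s \<longleftrightarrow> (\<exists>s'. big c s s' \<and> Q s')"

inductive_cases NopE: "big Nop s s'"
inductive_cases ActE: "big (Act a) s s'"
inductive_cases SeqE: "big (c ;; d) s s'"
inductive_cases CondE: "big (Cond b c d) s s'"
inductive_cases LoopE: "big (Loop b c) s s'"

lemma wp_Nop: "wp Nop Q s = Q s"
  by (auto simp: wp_def intro: big.intros elim: NopE)

lemma wp_Act: "wp (Act a) Q s \<longleftrightarrow> safe a s \<and> Q (perform a s)"
  by (auto simp: wp_def intro: big.intros elim: ActE)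

lemma wp_Seq: "wp (c ;; d) Q s = wp c (wp d Q) s"
  unfolding wp_def by (blast intro: big.intros elim: SeqE)

lemma wp_Cond: "wp (Cond b c d) Q s = (if holds b s then wp c Q (tick s) else wp d Q (tick s))"
  by (auto simp: wp_def intro: big.intros elim: CondE)

lemmas wp_simps = wp_Nop wp_Act wp_Seq wp_Cond

lemma wp_mono: "wp c Q s \<Longrightarrow> (\<And>s'. Q s' \<Longrightarrow> Q' s') \<Longrightarrow> wp c Q' s"
  by (auto simp: wp_def)

lemma wp_Loop:
  fixes \<mu> :: "store \<Rightarrow> nat"
  assumes "I s"
    and body: "\<And>s. I s \<Longrightarrow> holds b s \<Longrightarrow> wp c (\<lambda>s'. I s' \<and> \<mu> s' < \<mu> s) (tick s)"
    and exit: "\<And>s. I s \<Longrightarrow> \<not> holds b s \<Longrightarrow> Q (tick s)"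
  shows "wp (Loop b c) Q s"
  using assms(1)
proof (induction "\<mu> s" arbitrary: s rule: less_induct)
  case less
  show ?case
  proof (cases "holds b s")
    case True
    obtain s' where s': "big c (tick s) s'" "I s'" "\<mu> s' < \<mu> s"
      using body[OF less.prems True] by (auto simp: wp_def)
    then obtain s'' where "big (Loop b c) s' s''" "Q s''"
      using less.hyps by (auto simp: wp_def)
    then show ?thesis
      using LoopT[OF True s'(1)] by (auto simp: wp_def)
  next
    case False
    then show ?thesis
      using LoopF exit[OF less.prems] by (auto simp: wp_def)
  qed
qed

text \<open>\<open>clock s + k * \<mu> s\<close> never grows, because a round costs at most
  \<open>k\<close> ticks and lowers the measure by at least one. Amortised bounds thus reduce to the
  choice of a measure that counts rounds.\<close>

lemma wp_Loop_timed:
  fixes \<mu> :: "store \<Rightarrow> nat"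
  assumes "I s"
    and body: "\<And>s. I s \<Longrightarrow> holds b s \<Longrightarrow>
      wp c (\<lambda>s'. I s' \<and> \<mu> s' < \<mu> s \<and> clock s' \<le> clock s + k) (tick s)"
    and exit: "\<And>s'. I s' \<Longrightarrow> \<not> holds b s' \<Longrightarrow> clock s' \<le> clock s + k * \<mu> s \<Longrightarrow> Q (tick s')"
  shows "wp (Loop b c) Q s"
proof (rule wp_Loop[where I = "\<lambda>s'. I s' \<and> clock s' + k * \<mu> s' \<le> clock s + k * \<mu> s" and \<mu> = \<mu>])
  fix s1 assume s1: "I s1 \<and> clock s1 + k * \<mu> s1 \<le> clock s + k * \<mu> s" "holds b s1"
  have "clock s2 + k * \<mu> s2 \<le> clock s + k * \<mu> s" if "\<mu> s2 < \<mu> s1" "clock s2 \<le> clock s1 + k" for s2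
  proof -
    have "clock s2 + k * \<mu> s2 \<le> clock s1 + k * Suc (\<mu> s2)" using that(2) by simp
    also have "\<dots> \<le> clock s1 + k * \<mu> s1" using that(1) by (intro add_left_mono mult_left_mono) auto
    finally show ?thesis using s1(1) by simp
  qed
  then show "wp c (\<lambda>s'. (I s' \<and> clock s' + k * \<mu> s' \<le> clock s + k * \<mu> s) \<and> \<mu> s' < \<mu> s1) (tick s1)"
    using body[of s1] s1 by (auto elim!: wp_mono)
qed (use assms in auto)

end

text \<open>
  Word variable \<open>x\<close> lives in register \<open>x + 3\<close>; register 0 holds \<open>M\<close>, registers 1 and 2 serve for
  address computations.
\<close>

definition locate :: "nat \<Rightarrow> nat \<Rightarrow> instr list" where
  "locate j y =
     (if j < 9 then [SetW 1 9, OpW Plus 2 0 (y + 3), OpW Times 2 1 2, SetW 1 j, OpW Plus 2 2 1]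
      else [MoveW 2 (y + 3)])"

primrec code :: "act \<Rightarrow> instr list" where
  "code (Const x c) = [SetW (x + 3) c]"
| "code (Copy x y) = [MoveW (x + 3) (y + 3)]"
| "code (Arith f x y z) = [OpW f (x + 3) (y + 3) (z + 3)]"
| "code (Get x j y) = locate j y @ [LoadW (x + 3) 2]"
| "code (Put j y x) = locate j y @ [StoreW 2 (x + 3)]"
| "code (LZero x) = [ZeroL x]"
| "code (LInf x) = [InfL x]"
| "code (LAdd x y z) = [AddL x y z]"
| "code (LSub x y z) = [SubL x y z]"
| "code (LGet x j y) = locate j y @ [LoadL x 2]"
| "code (LPut j y x) = locate j y @ [StoreL 2 x]"

primrec jump_if :: "test \<Rightarrow> nat \<Rightarrow> instr list" where
  "jump_if (LessT x y) a = [JumpLessW (x + 3) (y + 3) a]"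
| "jump_if (LLessT x y) a = [JumpLessL x y a]"
| "jump_if (NeqT x y) a = [JumpLessW (x + 3) (y + 3) a, JumpLessW (y + 3) (x + 3) a]"

text \<open>Jump targets are absolute, hence the start address \<open>p\<close>. The branch for a
  failed test comes first because the machine jumps when the test succeeds.
  \<open>jump_if b 0\<close> merely measures a length, which does not depend on the target.\<close>

primrec compile :: "nat \<Rightarrow> cmd \<Rightarrow> instr list" where
  "compile p Nop = []"
| "compile p (Act a) = code a"
| "compile p (c ;; d) = compile p c @ compile (p + length (compile p c)) d"
| "compile p (Cond b c d) =
     (let q = p + length (jump_if b 0); ds = compile q d; q' = Suc (q + length ds); cs = compile q' c
      in jump_if b q' @ ds @ [Jump (q' + length cs)] @ cs)"
| "compile p (Loop b c) =
     (let q = Suc (p + length (jump_if b 0)); cs = compile q c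
      in jump_if b q @ [Jump (Suc (q + length cs))] @ cs @ [Jump p])"

lemma length_jump_if: "length (jump_if b a) = length (jump_if b 0)"
  by (cases b) auto

section \<open>Correctness of the compiler\<close>

definition reach :: "program \<Rightarrow> nat \<Rightarrow> ram \<Rightarrow> nat \<Rightarrow> ram \<Rightarrow> bool" where
  "reach P S r k r' \<longleftrightarrow> (step P ^^ k) r = r' \<and> (\<forall>j\<le>k. fits S ((step P ^^ j) r))"

lemma reach_refl: "fits S r \<Longrightarrow> reach P S r 0 r"
  by (simp add: reach_def)

lemma reach_trans:
  assumes "reach P S r k r'" "reach P S r' k' r''"
  shows "reach P S r (k + k') r''"
  unfolding reach_def
proof (intro conjI allI impI)
  have *: "(step P ^^ (i + k)) r = (step P ^^ i) r'" for i
    using assms(1) by (simp add: reach_def funpow_add)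
  show "(step P ^^ (k + k')) r = r''"
    using *[of k'] assms(2) by (simp add: reach_def add.commute)
  fix j assume j: "j \<le> k + k'"
  show "fits S ((step P ^^ j) r)"
  proof (cases "j \<le> k")
    case True
    then show ?thesis using assms(1) by (simp add: reach_def)
  next
    case False
    then show ?thesis using *[of "j - k"] assms(2) j by (simp add: reach_def)
  qed
qed

lemma reach_step:
  assumes "pc r < length P" "exec (P ! pc r) r = r'" "fits S r" "fits S r'"
  shows "reach P S r 1 r'"
  using assms by (auto simp: reach_def step_def halted_def le_Suc_eq)

definition code_at :: "program \<Rightarrow> nat \<Rightarrow> instr list \<Rightarrow> bool" where
  "code_at P p is \<longleftrightarrow> p + length is \<le> length P \<and> (\<forall>i<length is. P ! (p + i) = is ! i)"

lemma code_at_append: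
  "code_at P p (is @ js) \<longleftrightarrow> code_at P p is \<and> code_at P (p + length is) js"
proof -
  have "(\<forall>i<length (is @ js). P ! (p + i) = (is @ js) ! i) \<longleftrightarrow>
      (\<forall>i<length is. P ! (p + i) = is ! i) \<and> (\<forall>i<length js. P ! (p + length is + i) = js ! i)"
    (is "?l \<longleftrightarrow> ?r")
  proof
    assume l: ?l
    show ?r
    proof (intro conjI allI impI)
      fix i assume "i < length is"
      then show "P ! (p + i) = is ! i" using l[rule_format, of i] by (simp add: nth_append)
    next
      fix i assume "i < length js"
      then show "P ! (p + length is + i) = js ! i"
        using l[rule_format, of "length is + i"] by (simp add: add.assoc)
    qed
  next
    assume r: ?r
    show ?l
    proof (intro allI impI)
      fix i assume "i < length (is @ js)"
      then show "P ! (p + i) = (is @ js) ! i"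
        using r[THEN conjunct1, rule_format, of i] r[THEN conjunct2, rule_format, of "i - length is"]
        by (cases "i < length is") (auto simp: nth_append)
    qed
  qed
  then show ?thesis
    by (auto simp: code_at_def)
qed

lemma code_at_Cons:
  "code_at P p (i # is) \<longleftrightarrow> p < length P \<and> P ! p = i \<and> code_at P (Suc p) is"
  using code_at_append[of P p "[i]" "is"] by (auto simp: code_at_def)

text \<open>Under this condition a block acts as \<open>fold exec\<close> wherever it stands in the
  program, so that address computations can be evaluated by simplification.\<close>

primrec straight :: "nat \<Rightarrow> instr list \<Rightarrow> ram \<Rightarrow> bool" where
  "straight S [] r \<longleftrightarrow> True"
| "straight S (i # is) r \<longleftrightarrow>
     pc (exec i r) = Suc (pc r) \<and> fits S (exec i r) \<and> straight S is (exec i r)"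

lemma straight_append: "straight S (is @ js) r \<longleftrightarrow> straight S is r \<and> straight S js (fold exec is r)"
  by (induction "is" arbitrary: r) auto

lemma reach_straight:
  assumes "code_at P (pc r) is" "fits S r" "straight S is r"
  shows "reach P S r (length is) (fold exec is r) \<and> pc (fold exec is r) = pc r + length is
    \<and> fits S (fold exec is r)"
  using assms
proof (induction "is" arbitrary: r)
  case Nil
  then show ?case by (simp add: reach_refl)
next
  case (Cons i "is")
  let ?r = "exec i r"
  have "reach P S r 1 ?r"
    using Cons.prems by (intro reach_step) (auto simp: code_at_Cons)
  moreover have "reach P S ?r (length is) (fold exec is ?r) \<and> pc (fold exec is ?r) = pc ?r + length is
      \<and> fits S (fold exec is ?r)"
    using Cons.prems by (intro Cons.IH) (auto simp: code_at_Cons)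
  ultimately show ?case
    using reach_trans[of P S r 1 ?r "length is"] Cons.prems by auto
qed


lemma reach_jump:
  assumes "code_at P (pc r) (Jump a # is)" "fits S r"
  shows "reach P S r 1 (r\<lparr>pc := a\<rparr>)"
  using assms by (intro reach_step) (auto simp: code_at_Cons fits_def)

text \<open>\<open>9 * (M + L)\<close> covers the low memory together with the interleaved arrays up
  to index \<open>L\<close>; \<open>9 \<le> S\<close> is there because \<open>locate\<close> loads
  the constants 9 and \<open>j\<close> into a register.\<close>

locale bounded_machine = machine +
  fixes S :: nat
  assumes space: "9 * (M + L) \<le> S" "B \<le> S" "9 \<le> S"
begin

text \<open>The program counter and the ghost clock are left out, so the relation survives jumps and
  ticks. Cells correspond at all indices, even beyond \<open>L\<close>, so that statements about
  whole arrays, such as being blank, make sense; \<open>L\<close> only restricts accesses.\<close>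

definition rel :: "store \<Rightarrow> ram \<Rightarrow> bool" where
  "rel s r \<longleftrightarrow> wreg r 0 = M \<and> (\<forall>x. wreg r (x + 3) = wvar s x) \<and> lreg r = lvar s \<and>
     (\<forall>j i. j < 9 \<or> j = 9 \<and> i < 9 * M \<longrightarrow>
        wmem r (address M j i) = warr s j i \<and> lmem r (address M j i) = larr s j i) \<and>
     fits S r"

text \<open>In the interleaved region \<open>j\<close> is the remainder modulo 9 and
  \<open>M + i\<close> the quotient; array 9 ends below \<open>9 * M\<close>, where that region
  begins.\<close>

lemma address_inj:
  assumes "j < 9 \<or> j = 9 \<and> i < 9 * M" "j' < 9 \<or> j' = 9 \<and> i' < 9 * M"
  shows "address M j i = address M j' i' \<longleftrightarrow> j = j' \<and> i = i'"
  using assms by (auto simp: address_def split: if_splits) presburger+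

lemma rel_tick: "rel (tick s) r = rel s r"
  by (simp add: rel_def)

lemma rel_pc: "rel s (r\<lparr>pc := p\<rparr>) = rel s r"
  by (simp add: rel_def fits_def)

lemma locate_correct:
  assumes "rel s r" "cell_ok M L j (wvar s y)"
  shows "straight S (locate j y) r \<and> rel s (fold exec (locate j y) r) \<and>
    wreg (fold exec (locate j y) r) 2 = address M j (wvar s y)"
proof -
  have w: "wreg r (y + 3) = wvar s y" "wreg r 0 = M" "wreg r (Suc (Suc (Suc y))) = wvar s y"
    using assms(1) by (auto simp: rel_def numeral_eq_Suc)
  have f: "fits S r"
    using assms(1) by (simp add: rel_def)
  show ?thesis
  proof (cases "j < 9")
    case True
    then have "wvar s y < L" using assms(2) by (auto simp: cell_ok_def)
    then have le: "M + wvar s y \<le> S" "9 * (M + wvar s y) \<le> S" "9 * (M + wvar s y) + j \<le> S" "j \<le> S"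
      using space True by auto
    show ?thesis
      using True assms(1) le space f
      by (simp add: locate_def address_def rel_def fits_def w)
  next
    case False
    then have "j = 9" using assms(2) by (auto simp: cell_ok_def)
    moreover have "wvar s y \<le> S"
      using f w(1) by (metis fits_def)
    ultimately show ?thesis
      using assms(1) f by (simp add: locate_def address_def rel_def fits_def w)
  qed
qed

lemma address_bound: "cell_ok M L j i \<Longrightarrow> address M j i < S"
  using space by (auto simp: cell_ok_def address_def)

lemma code_correct:
  assumes "rel s r" "safe a s"
  shows "straight S (code a) r \<and> rel (perform a s) (fold exec (code a) r)"
proof -
  have f: "fits S r" using assms(1) by (simp add: rel_def)
  have bnd: "wvar s x \<le> S" for x
    using assms(1) f by (metis fits_def rel_def)
  show ?thesis
  proof (cases a)
    case (Get x j y)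
    let ?r = "fold exec (locate j y) r"
    note l = locate_correct[OF assms(1), of j y]
    have ok: "cell_ok M L j (wvar s y)" using assms(2) Get by simp
    then have v: "wmem ?r (address M j (wvar s y)) = warr s j (wvar s y)" "wmem ?r (wreg ?r 2) \<le> S"
      using l by (auto simp: rel_def cell_ok_def fits_def)
    show ?thesis
      using l[OF ok] v by (auto simp: Get straight_append rel_def fits_def)
  next
    case (LGet x j y)
    let ?r = "fold exec (locate j y) r"
    note l = locate_correct[OF assms(1), of j y]
    have ok: "cell_ok M L j (wvar s y)" using assms(2) LGet by simp
    then have v: "lmem ?r (address M j (wvar s y)) = larr s j (wvar s y)"
      using l by (auto simp: rel_def cell_ok_def fits_def)
    show ?thesis
      using l[OF ok] v by (auto simp: LGet straight_append rel_def fits_def fun_eq_iff)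
  next
    case (Put j y x)
    define r' where "r' = fold exec (locate j y) r"
    have ok: "cell_ok M L j (wvar s y)" using assms(2) Put by simp
    have l: "straight S (locate j y) r" "rel s r'" "wreg r' 2 = address M j (wvar s y)"
      using locate_correct[OF assms(1) ok] by (auto simp: r'_def)
    have e: "exec (StoreW 2 (x + 3)) r' =
        advance (r'\<lparr>wmem := (wmem r')(address M j (wvar s y) := wvar s x)\<rparr>)"
      using l by (auto simp: rel_def numeral_eq_Suc)
    have inj: "address M j' i = address M j (wvar s y) \<longleftrightarrow> j' = j \<and> i = wvar s y"
      if "j' < 9 \<or> j' = 9 \<and> i < 9 * M" for j' i
      using ok that by (intro address_inj) (auto simp: cell_ok_def)
    have f: "fits S (exec (StoreW 2 (x + 3)) r')"
      unfolding e using l(2) address_bound[OF ok] bnd[of x] by (auto simp: rel_def fits_def)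
    have "rel (perform a s) (exec (StoreW 2 (x + 3)) r')"
      using f l(2) unfolding e rel_def by (simp add: Put inj)
    moreover have "pc (exec (StoreW 2 (x + 3)) r') = Suc (pc r')"
      by simp
    ultimately show ?thesis
      using l(1) f by (simp add: Put straight_append r'_def[symmetric] del: exec.simps)
  next
  case (LPut j y x)
    define r' where "r' = fold exec (locate j y) r"
    have ok: "cell_ok M L j (wvar s y)" using assms(2) LPut by simp
    have l: "straight S (locate j y) r" "rel s r'" "wreg r' 2 = address M j (wvar s y)"
      using locate_correct[OF assms(1) ok] by (auto simp: r'_def)
    have e: "exec (StoreL 2 x) r' =
        advance (r'\<lparr>lmem := (lmem r')(address M j (wvar s y) := lvar s x)\<rparr>)"
      using l by (auto simp: rel_def numeral_eq_Suc)
    have inj: "address M j' i = address M j (wvar s y) \<longleftrightarrow> j' = j \<and> i = wvar s y"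
      if "j' < 9 \<or> j' = 9 \<and> i < 9 * M" for j' i
      using ok that by (intro address_inj) (auto simp: cell_ok_def)
    have f: "fits S (exec (StoreL 2 x) r')"
      unfolding e using l(2) address_bound[OF ok] bnd[of x] by (auto simp: rel_def fits_def)
    have "rel (perform a s) (exec (StoreL 2 x) r')"
      using f l(2) unfolding e rel_def by (simp add: LPut inj)
    moreover have "pc (exec (StoreL 2 x) r') = Suc (pc r')"
      by simp
    ultimately show ?thesis
      using l(1) f by (simp add: LPut straight_append r'_def[symmetric] del: exec.simps)
  next
  case (Arith g x y z)
    have "apply_op g (wvar s y) (wvar s z) \<le> S"
      using assms(2) space by (simp add: Arith)
    moreover have "wreg r (Suc (Suc (Suc x))) = wvar s x" for x
      using assms(1) by (auto simp: rel_def numeral_eq_Suc)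
    ultimately show ?thesis
      using assms by (auto simp: Arith rel_def fits_def)
  next
    case (Copy x y)
    moreover have "wreg r (Suc (Suc (Suc x))) = wvar s x" for x
      using assms(1) by (auto simp: rel_def numeral_eq_Suc)
    ultimately show ?thesis
      using assms bnd by (auto simp: rel_def fits_def)
  qed (use assms space in \<open>auto simp: rel_def fits_def fun_eq_iff\<close>)
qed

lemma length_code: "length (code a) \<le> 6"
  by (cases a) (auto simp: locate_def)

lemma jump_if_correct:
  assumes "rel s r" "code_at P (pc r) (jump_if b q)"
  shows "\<exists>k\<le>2. reach P S r k (r\<lparr>pc := if holds b s then q else pc r + length (jump_if b q)\<rparr>)"
proof -
  have f: "fits S (r\<lparr>pc := p\<rparr>)" for p using assms(1) by (simp add: rel_def fits_def)
  have f0: "fits S r" using assms(1) by (simp add: rel_def)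
  have w: "wreg r (x + 3) = wvar s x" "lreg r x = lvar s x" for x
    using assms(1) by (auto simp: rel_def)
  note w' = w(1)[unfolded numeral_3_eq_3 add_Suc_right add_0_right]
  show ?thesis
  proof (cases b)
    case (LessT x y)
    then show ?thesis
      using assms f w w' by (intro exI[of _ 1] conjI reach_step) (auto simp: code_at_Cons f0)
  next
    case (LLessT x y)
    then show ?thesis
      using assms f w by (intro exI[of _ 1] conjI reach_step) (auto simp: code_at_Cons f0)
  next
    case (NeqT x y)
    let ?r = "exec (JumpLessW (x + 3) (y + 3) q) r"
    have one: "reach P S r 1 ?r"
      using assms f NeqT by (intro reach_step) (auto simp: code_at_Cons f0)
    show ?thesis
    proof (cases "wvar s x < wvar s y")
      case True
      then show ?thesis using one NeqT w w' by (intro exI[of _ 1]) auto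
    next
      case False
      then have r: "?r = advance r" using w w' by auto
      have "reach P S ?r 1 (r\<lparr>pc := if holds b s then q else pc r + length (jump_if b q)\<rparr>)"
        using assms f NeqT False w w' by (intro reach_step) (auto simp: code_at_Cons f0 r)
      from reach_trans[OF one this] show ?thesis by (intro exI[of _ "1 + 1"]) auto
    qed
  qed
qed

lemma rel_fits: "rel s r \<Longrightarrow> fits S r"
  by (simp add: rel_def)

text \<open>A tick pays for six steps: an action needs at most five to compute an address and one to
  act, a test at most two and one more for a jump that closes a branch or a round.\<close>

lemma compile_correct:
  assumes "big c s s'" "rel s r" "code_at P (pc r) (compile (pc r) c)"
  shows "\<exists>k r'. reach P S r k r' \<and> k + 6 * clock s \<le> 6 * clock s' \<and>
    pc r' = pc r + length (compile (pc r) c) \<and> rel s' r'"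
  using assms
proof (induction arbitrary: r rule: big.induct)
  case (Nop s)
  then show ?case using reach_refl rel_fits by fastforce
next
  case (Act a s)
  from code_correct[OF Act.prems(1) Act.hyps] reach_straight[of P r "code a" S]
  have "reach P S r (length (code a)) (fold exec (code a) r) \<and>
      pc (fold exec (code a) r) = pc r + length (code a) \<and> rel (perform a s) (fold exec (code a) r)"
    using Act.prems rel_fits by auto
  moreover have "clock (perform a s) = Suc (clock s)"
    by (cases a) auto
  ultimately show ?case
    using length_code[of a] by (intro exI[of _ "length (code a)"] exI[of _ "fold exec (code a) r"]) auto
next
  case (Seq c s s' d s'')
  obtain k r' where 1: "reach P S r k r'" "k + 6 * clock s \<le> 6 * clock s'"
    "pc r' = pc r + length (compile (pc r) c)" "rel s' r'"
    using Seq.IH(1)[OF Seq.prems(1)] Seq.prems(2) by (auto simp: code_at_append)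
  then obtain k' r'' where 2: "reach P S r' k' r''" "k' + 6 * clock s' \<le> 6 * clock s''"
    "pc r'' = pc r' + length (compile (pc r') d)" "rel s'' r''"
    using Seq.IH(2)[of r'] Seq.prems(2) by (auto simp: code_at_append)
  have "reach P S r (k + k') r''"
    using reach_trans[OF 1(1) 2(1)] .
  then show ?case
    using 1 2 by (intro exI[of _ "k + k'"] exI[of _ r'']) auto
next
  case (CondT b s c s' d)
  let ?q = "pc r + length (jump_if b 0)"
  let ?ds = "compile ?q d"
  let ?q' = "Suc (?q + length ?ds)"
  have c: "code_at P (pc r) (jump_if b ?q')" "code_at P ?q' (compile ?q' c)"
    using CondT.prems(2) by (auto simp: code_at_append code_at_Cons Let_def length_jump_if[of b ?q'])
  obtain k where k: "k \<le> 2" "reach P S r k (r\<lparr>pc := ?q'\<rparr>)"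
    using jump_if_correct[OF CondT.prems(1) c(1)] CondT.hyps(1) by auto
  obtain k' r' where r': "reach P S (r\<lparr>pc := ?q'\<rparr>) k' r'" "k' + 6 * clock (tick s) \<le> 6 * clock s'"
    "pc r' = ?q' + length (compile ?q' c)" "rel s' r'"
    using CondT.IH[of "r\<lparr>pc := ?q'\<rparr>"] c(2) CondT.prems(1) by (auto simp: rel_pc rel_tick)
  show ?case
    using reach_trans[OF k(2) r'(1)] r' k(1)
    by (intro exI[of _ "k + k'"] exI[of _ r'])
      (auto simp: Let_def length_jump_if[of b ?q'])
next
  case (CondF b s d s' c)
  let ?q = "pc r + length (jump_if b 0)"
  let ?ds = "compile ?q d"
  let ?q' = "Suc (?q + length ?ds)"
  have c: "code_at P (pc r) (jump_if b ?q')" "code_at P ?q (compile ?q d)"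
    "code_at P (?q + length ?ds) (Jump (?q' + length (compile ?q' c)) # compile ?q' c)"
    using CondF.prems(2) by (auto simp: code_at_append code_at_Cons Let_def length_jump_if[of b ?q'])
  obtain k where k: "k \<le> 2" "reach P S r k (r\<lparr>pc := ?q\<rparr>)"
    using jump_if_correct[OF CondF.prems(1) c(1)] CondF.hyps(1) by (auto simp: length_jump_if[of b ?q'])
  obtain k' r' where r': "reach P S (r\<lparr>pc := ?q\<rparr>) k' r'" "k' + 6 * clock (tick s) \<le> 6 * clock s'"
    "pc r' = ?q + length ?ds" "rel s' r'"
    using CondF.IH[of "r\<lparr>pc := ?q\<rparr>"] c(2) CondF.prems(1) by (auto simp: rel_pc rel_tick)
  have j: "reach P S r' 1 (r'\<lparr>pc := ?q' + length (compile ?q' c)\<rparr>)"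
    using c(3) r' rel_fits by (intro reach_jump) auto
  show ?case
    using reach_trans[OF reach_trans[OF k(2) r'(1)] j] r' k(1)
    by (intro exI[of _ "k + k' + 1"] exI[of _ "r'\<lparr>pc := ?q' + length (compile ?q' c)\<rparr>"])
      (auto simp: Let_def length_jump_if[of b ?q'] rel_pc)
next
  case (LoopF b s c)
  let ?q = "Suc (pc r + length (jump_if b 0))"
  let ?e = "Suc (?q + length (compile ?q c))"
  have c: "code_at P (pc r) (jump_if b ?q)" "code_at P (pc r + length (jump_if b 0)) (Jump ?e # compile ?q c @ [Jump (pc r)])"
    using LoopF.prems(2) by (auto simp: code_at_append code_at_Cons Let_def length_jump_if[of b ?q])
  obtain k where k: "k \<le> 2" "reach P S r k (r\<lparr>pc := pc r + length (jump_if b 0)\<rparr>)"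
    using jump_if_correct[OF LoopF.prems(1) c(1)] LoopF.hyps(1) by (auto simp: length_jump_if[of b ?q])
  have j: "reach P S (r\<lparr>pc := pc r + length (jump_if b 0)\<rparr>) 1 (r\<lparr>pc := ?e\<rparr>)"
    using reach_jump[of P "r\<lparr>pc := pc r + length (jump_if b 0)\<rparr>"] c(2) LoopF.prems(1) rel_fits rel_pc
    by fastforce
  show ?case
    using reach_trans[OF k(2) j] k(1) LoopF.prems(1)
    by (intro exI[of _ "k + 1"] exI[of _ "r\<lparr>pc := ?e\<rparr>"])
      (auto simp: Let_def length_jump_if[of b ?q] rel_pc rel_tick)
next
  case (LoopT b s c s' s'')
  let ?q = "Suc (pc r + length (jump_if b 0))"
  let ?e = "Suc (?q + length (compile ?q c))"
  have c: "code_at P (pc r) (jump_if b ?q)" "code_at P ?q (compile ?q c)"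
    "code_at P (?q + length (compile ?q c)) [Jump (pc r)]"
    using LoopT.prems(2) by (auto simp: code_at_append code_at_Cons Let_def length_jump_if[of b ?q])
  obtain k where k: "k \<le> 2" "reach P S r k (r\<lparr>pc := ?q\<rparr>)"
    using jump_if_correct[OF LoopT.prems(1) c(1)] LoopT.hyps(1) by auto
  obtain k' r' where r': "reach P S (r\<lparr>pc := ?q\<rparr>) k' r'" "k' + 6 * clock (tick s) \<le> 6 * clock s'"
    "pc r' = ?q + length (compile ?q c)" "rel s' r'"
    using LoopT.IH(1)[of "r\<lparr>pc := ?q\<rparr>"] c(2) LoopT.prems(1) by (auto simp: rel_pc rel_tick)
  have j: "reach P S r' 1 (r'\<lparr>pc := pc r\<rparr>)"
    using c(3) r' rel_fits by (intro reach_jump) auto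
  obtain k'' r'' where r'': "reach P S (r'\<lparr>pc := pc r\<rparr>) k'' r''" "k'' + 6 * clock s' \<le> 6 * clock s''"
    "pc r'' = pc r + length (compile (pc r) (Loop b c))" "rel s'' r''"
    using LoopT.IH(2)[of "r'\<lparr>pc := pc r\<rparr>"] LoopT.prems(2) r'(4) by (auto simp: rel_pc simp del: compile.simps)
  show ?case
    using reach_trans[OF reach_trans[OF reach_trans[OF k(2) r'(1)] j] r''(1)] r'(2) r'' k(1)
    by (intro exI[of _ "k + k' + 1 + k''"] exI[of _ r'']) (auto simp del: compile.simps)
qed

end

section \<open>Shortest path trees and replacement distances\<close>

lemma simple_graph_mono: "simple_graph V E \<Longrightarrow> E' \<subseteq> E \<Longrightarrow> simple_graph V E'"
  by (auto simp: simple_graph_def)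

lemma simple_graph_edgeD:
  assumes "simple_graph V E" "{u, v} \<in> E"
  shows "u \<in> V" "v \<in> V" "u \<noteq> v"
proof -
  obtain a b where "a \<in> V" "b \<in> V" "a \<noteq> b" "{u, v} = {a, b}"
    using assms by (auto simp: simple_graph_def)
  then show "u \<in> V" "v \<in> V" "u \<noteq> v"
    by (auto simp: doubleton_eq_iff)
qed

lemma bidirected_simps:
  "verts (bidirected V E) = V" "arcs (bidirected V E) = {(u, v). {u, v} \<in> E}"
  "tail (bidirected V E) = fst" "head (bidirected V E) = snd"
  by (simp_all add: bidirected_def)

lemma wf_bidirected: "simple_graph V E \<Longrightarrow> wf_digraph (bidirected V E)"
  by (auto simp: wf_digraph_def bidirected_simps dest: simple_graph_edgeD)

lemma distance_refl:
  assumes "simple_graph V E" "t \<in> V"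
  shows "distance V E l t t \<le> 0"
proof -
  interpret wf_digraph "bidirected V E" using wf_bidirected[OF assms(1)] .
  have "awalk t [] t" using assms(2) by (simp add: awalk_Nil_iff bidirected_simps)
  from min_cost_le_walk_cost[OF this, of "\<lambda>(u, v). l {u, v}"] show ?thesis
    by (simp add: distance_def zero_ereal_def)
qed

lemma distance_step:
  assumes "simple_graph V E" "{x, y} \<in> E"
  shows "distance V E l x t \<le> ereal (l {x, y}) + distance V E l y t"
proof -
  interpret wf_digraph "bidirected V E" using wf_bidirected[OF assms(1)] .
  let ?c = "\<lambda>(u, v). l {u, v}"
  \<comment> \<open>Subtracting the edge weight leaves the infimum alone on the right, so that it
    can be bounded walk by walk.\<close>
  have "distance V E l x t - ereal (l {x, y}) \<le> \<mu> ?c y t"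
    unfolding \<mu>_def
  proof (rule INF_greatest)
    fix p assume "p \<in> {p. awalk y p t}"
    then have "awalk x ((x, y) # p) t"
      using assms(2) by (simp add: awalk_Cons_iff bidirected_simps)
    from min_cost_le_walk_cost[OF this, of ?c]
    show "distance V E l x t - ereal (l {x, y}) \<le> ereal (awalk_cost ?c p)"
      by (simp add: distance_def ereal_minus_le add.commute)
  qed
  then show ?thesis
    by (simp add: distance_def ereal_minus_le add.commute)
qed

text \<open>The inequalities for \<open>f\<close> telescope along any walk to \<open>t\<close>.
  Lower bounds on distances are later obtained by exhibiting such an \<open>f\<close>.\<close>

lemma potential_le_distance:
  fixes f :: "'a \<Rightarrow> ereal"
  assumes "simple_graph V E" "f t \<le> 0"
    and "\<And>x y. {x, y} \<in> E \<Longrightarrow> f x \<le> ereal (l {x, y}) + f y"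
  shows "f x \<le> distance V E l x t"
proof -
  interpret wf_digraph "bidirected V E" using wf_bidirected[OF assms(1)] .
  let ?c = "\<lambda>(u, v). l {u, v}"
  have "f x \<le> ereal (awalk_cost ?c p)" if "awalk x p t" for p
    using that
  proof (induction p arbitrary: x)
    case Nil
    then show ?case using assms(2) by (simp add: awalk_Nil_iff zero_ereal_def)
  next
    case (Cons e p)
    obtain y where e: "e = (x, y)" "{x, y} \<in> E" "awalk y p t"
      using Cons.prems by (cases e) (auto simp: awalk_Cons_iff bidirected_simps)
    have "f x \<le> ereal (l {x, y}) + f y" using assms(3) e(2) .
    also have "\<dots> \<le> ereal (l {x, y}) + ereal (awalk_cost ?c p)"
      using Cons.IH[OF e(3)] by (rule add_left_mono)
    finally show ?case by (simp add: e(1))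
  qed
  then show ?thesis
    unfolding distance_def \<mu>_def by (intro INF_greatest) auto
qed

lemma funpow_in_trans:
  assumes "(p ^^ i) x = y" "(p ^^ j) y = z"
  shows "(p ^^ (j + i)) x = z"
  using assms by (simp add: funpow_add)

text \<open>\<open>R\<close> is the component of \<open>t\<close>. Since
  \<open>D x = D (par x)\<close> is possible across an edge of weight zero, \<open>ord\<close>
  supplies the measure for inductions along the tree.\<close>

locale shortest_path_tree =
  fixes V :: "'a set" and E :: "'a set set" and l :: "'a set \<Rightarrow> real" and t :: 'a
    and R :: "'a set" and D :: "'a \<Rightarrow> real" and par :: "'a \<Rightarrow> 'a" and ord :: "'a \<Rightarrow> nat"
  assumes graph: "simple_graph V E"
    and root_V: "t \<in> V"
    and root_R: "t \<in> R"
    and root: "par t = t" "D t = 0"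
    and closed: "\<And>x y. x \<in> R \<Longrightarrow> {x, y} \<in> E \<Longrightarrow> y \<in> R"
    and parent: "\<And>x. x \<in> R \<Longrightarrow> x \<noteq> t \<Longrightarrow>
      par x \<in> R \<and> {x, par x} \<in> E \<and> ord (par x) < ord x \<and> D x = l {x, par x} + D (par x)"
    and feasible: "\<And>x y. x \<in> R \<Longrightarrow> {x, y} \<in> E \<Longrightarrow> D x \<le> l {x, y} + D y"
begin

definition subtree :: "'a \<Rightarrow> 'a set" where
  "subtree v = {x \<in> R. \<exists>k. (par ^^ k) x = v}"

text \<open>For \<open>x\<close> and \<open>y\<close> in \<open>R\<close>, this says that the tree
  path between them uses the edge from \<open>v\<close> to \<open>par v\<close>.\<close>

definition crosses :: "'a \<Rightarrow> 'a \<Rightarrow> 'a \<Rightarrow> bool" where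
  "crosses v x y \<longleftrightarrow> (x \<in> subtree v) \<noteq> (y \<in> subtree v)"

lemma crosses_commute: "crosses v x y = crosses v y x"
  by (auto simp: crosses_def)

lemma par_R: "x \<in> R \<Longrightarrow> par x \<in> R"
  using parent root(1) by (cases "x = t") auto

lemma subtree_self: "v \<in> R \<Longrightarrow> v \<in> subtree v"
  by (auto simp: subtree_def intro: exI[of _ 0])

lemma subtree_parent: "x \<in> subtree v \<Longrightarrow> x \<noteq> v \<Longrightarrow> par x \<in> subtree v"
proof -
  assume x: "x \<in> subtree v" "x \<noteq> v"
  then obtain k where k: "(par ^^ k) x = v" by (auto simp: subtree_def)
  with x(2) obtain j where "k = Suc j" by (cases k) auto
  with k have "(par ^^ j) (par x) = v" by (simp add: funpow_swap1)
  then show ?thesis using x par_R by (auto simp: subtree_def)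
qed

lemma subtree_child: "x \<in> R \<Longrightarrow> par x \<in> subtree v \<Longrightarrow> x \<in> subtree v"
proof -
  assume x: "x \<in> R" "par x \<in> subtree v"
  then obtain k where "(par ^^ k) (par x) = v" by (auto simp: subtree_def)
  then have "(par ^^ Suc k) x = v" by (simp add: funpow_swap1)
  then show ?thesis using x unfolding subtree_def by blast
qed

lemma subtree_R: "x \<in> subtree v \<Longrightarrow> x \<in> R"
  by (simp add: subtree_def)

lemma ord_funpow: "x \<in> R \<Longrightarrow> ord ((par ^^ k) x) \<le> ord x \<and> (par ^^ k) x \<in> R"
proof (induction k)
  case (Suc k)
  then show ?case
    using parent[of "(par ^^ k) x"] root(1) root_R by (cases "(par ^^ k) x = t") auto
qed simp

lemma subtree_ord: "x \<in> subtree v \<Longrightarrow> ord v \<le> ord x"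
  using ord_funpow by (auto simp: subtree_def)

lemma subtree_root_R: "x \<in> subtree v \<Longrightarrow> v \<in> R"
  using ord_funpow by (auto simp: subtree_def)

lemma subtree_trans: "x \<in> subtree y \<Longrightarrow> y \<in> subtree z \<Longrightarrow> x \<in> subtree z"
  using funpow_in_trans by (fastforce simp: subtree_def)

lemma root_subtree: "t \<in> subtree v \<Longrightarrow> v = t"
proof -
  have "(par ^^ k) t = t" for k by (induction k) (auto simp: root)
  then show "t \<in> subtree v \<Longrightarrow> v = t" by (auto simp: subtree_def)
qed

lemma subtree_ord_eq: "x \<in> subtree v \<Longrightarrow> ord x \<le> ord v \<Longrightarrow> x = v"
proof (rule ccontr)
  assume a: "x \<in> subtree v" "ord x \<le> ord v" "x \<noteq> v"
  then have "par x \<in> subtree v" "x \<noteq> t"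
    using subtree_parent root_subtree by auto
  then show False
    using subtree_ord[of "par x" v] parent[of x] a subtree_R[OF a(1)] by auto
qed

lemma feasible_sym: "x \<in> R \<Longrightarrow> {x, y} \<in> E \<Longrightarrow> D y \<le> l {x, y} + D x"
  using feasible[of y x] closed by (simp add: insert_commute)

abbreviation "dist_without e x \<equiv> repl_distance V E l t e x"

lemma dist_step: "{x, y} \<in> E \<Longrightarrow> {x, y} \<noteq> e \<Longrightarrow>
    dist_without e x \<le> ereal (l {x, y}) + dist_without e y"
  unfolding repl_distance_def
  by (rule distance_step) (auto intro: simple_graph_mono[OF graph])

lemma dist_root: "dist_without e t \<le> 0"
  unfolding repl_distance_def
  by (rule distance_refl) (auto intro: simple_graph_mono[OF graph] root_V)

lemma dist_lower:
  assumes "f t \<le> 0" "\<And>x y. {x, y} \<in> E \<Longrightarrow> {x, y} \<noteq> e \<Longrightarrow> f x \<le> ereal (l {x, y}) + f y"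
  shows "f x \<le> dist_without e x"
  unfolding repl_distance_def
  using assms by (intro potential_le_distance) (auto intro: simple_graph_mono[OF graph])

text \<open>No edge joins \<open>R\<close> to its complement, so \<open>D\<close> extended by
  infinity is a feasible potential of the whole graph; deleting \<open>e\<close> only removes
  constraints.\<close>

lemma D_extended_le_dist: "(if x \<in> R then ereal (D x) else \<infinity>) \<le> dist_without e x"
proof (rule dist_lower)
  show "(if t \<in> R then ereal (D t) else \<infinity>) \<le> 0"
    using root_R root(2) by (simp add: zero_ereal_def)
  fix x y assume e: "{x, y} \<in> E"
  then have e': "{y, x} \<in> E" by (simp add: insert_commute)
  show "(if x \<in> R then ereal (D x) else \<infinity>) \<le> ereal (l {x, y}) + (if y \<in> R then ereal (D y) else \<infinity>)"
    using closed[OF _ e'] closed[OF _ e] feasible[OF _ e] by auto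
qed

lemma D_le_dist: "x \<in> R \<Longrightarrow> ereal (D x) \<le> dist_without e x"
  using D_extended_le_dist[of x e] by simp

lemma unreached: "x \<notin> R \<Longrightarrow> dist_without e x = \<infinity>"
  using D_extended_le_dist[of x e] by simp

text \<open>If \<open>par\<close> does not lead out of \<open>A\<close> and no tree edge that starts
  in \<open>A\<close> is \<open>e\<close>, the tree path of \<open>x\<close> survives the deletion.
  Below, \<open>A\<close> is a set of early settled vertices or the complement of a subtree.\<close>

lemma tree_path_le:
  assumes "x \<in> R" "x \<in> A"
    and "\<And>x. x \<in> R \<Longrightarrow> x \<in> A \<Longrightarrow> x \<noteq> t \<Longrightarrow> par x \<in> A \<and> {x, par x} \<noteq> e"
  shows "dist_without e x \<le> ereal (D x)"
  using assms(1,2)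
proof (induction "ord x" arbitrary: x rule: less_induct)
  case less
  show ?case
  proof (cases "x = t")
    case True
    then show ?thesis using dist_root root(2) by (simp add: zero_ereal_def)
  next
    case False
    note p = parent[OF less.prems(1) False] assms(3)[OF less.prems False]
    have "dist_without e x \<le> ereal (l {x, par x}) + dist_without e (par x)"
      using p by (intro dist_step) auto
    also have "\<dots> \<le> ereal (l {x, par x}) + ereal (D (par x))"
      using less.hyps p by (intro add_left_mono) auto
    finally show ?thesis using p by simp
  qed
qed

lemma dist_without_nonparent:
  assumes "u \<in> R" "par u \<noteq> v" "u \<noteq> v"
  shows "dist_without {u, v} u = ereal (D u)"
proof (rule antisym)
  show "dist_without {u, v} u \<le> ereal (D u)"
  \<comment> \<open>Among vertices settled no later than \<open>u\<close>, the edge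
    \<open>uv\<close> could only be the parent edge of \<open>v\<close>; but then
    \<open>par v = u\<close> would be settled before \<open>v\<close>.\<close>
  proof (rule tree_path_le[where A = "{x. ord x \<le> ord u}"])
    fix x assume x: "x \<in> R" "x \<in> {x. ord x \<le> ord u}" "x \<noteq> t"
    then show "par x \<in> {x. ord x \<le> ord u} \<and> {x, par x} \<noteq> {u, v}"
      using parent[OF x(1,3)] assms by (auto simp: doubleton_eq_iff)
  qed (use assms in auto)
qed (use D_le_dist assms in auto)

text \<open>The tree path from \<open>u\<close> down to \<open>x\<close> has length
  \<open>D x - D u\<close> and stays in the subtree, so it avoids the deleted edge. The induction
  extends it by one tree edge at a time.\<close>

lemma dist_from_subtree_root:
  assumes "x \<in> subtree u"
  shows "dist_without {u, par u} u \<le> ereal (D x - D u) + dist_without {u, par u} x"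
  using assms
proof (induction "ord x" arbitrary: x rule: less_induct)
  case less
  let ?d = "dist_without {u, par u}"
  show ?case
  proof (cases "x = u")
    case True
    then show ?thesis by (simp add: zero_ereal_def[symmetric])
  next
    case False
    then have xt: "x \<noteq> t" using less.prems root_subtree by auto
    note p = parent[OF subtree_R[OF less.prems] xt]
    have ps: "par x \<in> subtree u" using subtree_parent less.prems False by auto
    then have ne: "{par x, x} \<noteq> {u, par u}"
      using False subtree_ord[OF ps] parent[of u] subtree_root_R[OF ps] p
      by (cases "u = t") (auto simp: doubleton_eq_iff root)
    have "?d u \<le> ereal (D (par x) - D u) + ?d (par x)"
      using less.hyps p ps by auto
    also have "\<dots> \<le> ereal (D (par x) - D u) + (ereal (l {par x, x}) + ?d x)"
      using ne p by (intro add_left_mono dist_step) (auto simp: insert_commute)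
    also have "\<dots> = ereal (D x - D u) + ?d x"
      using p by (cases "?d x") (auto simp: insert_commute)
    finally show ?thesis .
  qed
qed

text \<open>The detour runs down the tree from \<open>u\<close> to \<open>x\<close>, across
  \<open>xy\<close>, and along the tree path of \<open>y\<close>. The last part never enters the
  subtree, because a vertex whose parent lies in the subtree lies in it too.\<close>

lemma replacement_upper:
  assumes "{x, y} \<in> E" "x \<in> subtree u" "y \<notin> subtree u" "{x, y} \<noteq> {u, par u}" "u \<noteq> t"
  shows "dist_without {u, par u} u \<le> ereal (D x + l {x, y} + D y - D u)"
proof -
  let ?d = "dist_without {u, par u}"
  have uR: "u \<in> R" and xR: "x \<in> R" using subtree_root_R subtree_R assms(2) by auto
  have "y \<in> R" using closed xR assms(1) by auto
  then have y: "?d y \<le> ereal (D y)"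
  proof (rule tree_path_le[where A = "- subtree u"])
    fix z assume z: "z \<in> R" "z \<in> - subtree u" "z \<noteq> t"
    show "par z \<in> - subtree u \<and> {z, par z} \<noteq> {u, par u}"
      using z subtree_child subtree_self[OF uR] by (auto simp: doubleton_eq_iff)
  qed (use assms in auto)
  have "?d u \<le> ereal (D x - D u) + ?d x"
    using assms by (intro dist_from_subtree_root)
  also have "\<dots> \<le> ereal (D x - D u) + (ereal (l {x, y}) + ?d y)"
    using assms by (intro add_left_mono dist_step) auto
  also have "\<dots> \<le> ereal (D x - D u) + (ereal (l {x, y}) + ereal (D y))"
    using y by (intro add_left_mono)
  finally show ?thesis by (simp add: algebra_simps)
qed

text \<open>
  The potential that proves optimality is \<open>D\<close> outside the subtree and, inside, the maximum of
  \<open>D\<close> and the length of a detour through the cheapest crossing edge.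
\<close>

lemma replacement_lower:
  assumes u: "u \<in> R" "u \<noteq> t"
    and w: "\<And>x y. {x, y} \<in> E \<Longrightarrow> x \<in> subtree u \<Longrightarrow> y \<notin> subtree u \<Longrightarrow> {x, y} \<noteq> {u, par u} \<Longrightarrow>
      w \<le> ereal (D x + l {x, y} + D y)"
  shows "w - ereal (D u) \<le> dist_without {u, par u} u"
proof -
  define f where "f x = (if x \<in> subtree u then max (ereal (D x)) (w - ereal (D x))
    else if x \<in> R then ereal (D x) else \<infinity>)" for x
  have "f u \<le> dist_without {u, par u} u"
  proof (rule dist_lower)
    show "f t \<le> 0"
      using root_subtree[of u] u root_R root(2) by (auto simp: f_def zero_ereal_def)
    fix x y assume e: "{x, y} \<in> E" "{x, y} \<noteq> {u, par u}"
    then have e': "{y, x} \<in> E" by (simp add: insert_commute)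
    show "f x \<le> ereal (l {x, y}) + f y"
    proof (cases "x \<in> R")
      case False
      then have "y \<notin> R" "y \<notin> subtree u" using closed[OF _ e'] subtree_R by auto
      then show ?thesis by (simp add: f_def)
    next
      case True
      then have y: "y \<in> R" using closed e by auto
      note f1 = feasible[OF True e(1)] feasible_sym[OF True e(1)]
      have Dy: "ereal (D x) \<le> ereal (l {x, y}) + f y"
      proof -
        have "ereal (D x) \<le> ereal (l {x, y}) + ereal (D y)" using f1(1) by simp
        also have "\<dots> \<le> ereal (l {x, y}) + f y"
          using y by (intro add_left_mono) (simp add: f_def)
        finally show ?thesis .
      qed
      have "w - ereal (D x) \<le> ereal (l {x, y}) + f y" if xs: "x \<in> subtree u"
      proof (cases "y \<in> subtree u")
        \<comment> \<open>Edges are undirected, so \<open>D\<close> changes by at most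
          \<open>l {x, y}\<close> in either direction, and inside the subtree \<open>w - D\<close>
          is as feasible as \<open>D\<close>.\<close>
        case True
        have "w - ereal (D x) \<le> ereal (l {x, y}) + (w - ereal (D y))"
          using f1(2) by (cases w) auto
        also have "\<dots> \<le> ereal (l {x, y}) + f y"
          using True by (intro add_left_mono) (simp add: f_def)
        finally show ?thesis .
      next
        case False
        then have "w \<le> ereal (D x + l {x, y} + D y)" using w xs e by auto
        then show ?thesis using False y by (cases w) (auto simp: f_def)
      qed
      then show ?thesis using Dy True by (auto simp: f_def)
    qed
  qed
  moreover have "w - ereal (D u) \<le> f u"
    using subtree_self[OF u(1)] by (simp add: f_def)
  ultimately show ?thesis by (rule order_trans[rotated])
qed

end

section \<open>Tournament trees\<close>

text \<open>Nodes are numbered as in a binary heap: halving leads to the parent, the root is 1, and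
  0 lies above everything. \<open>descends\<close> admits \<open>p\<close> itself,
  \<open>below\<close> starts at its parent.\<close>

definition descends :: "nat \<Rightarrow> nat \<Rightarrow> bool" where
  "descends p j \<longleftrightarrow> (\<exists>k. p div 2 ^ k = j)"

definition below :: "nat \<Rightarrow> nat \<Rightarrow> bool" where
  "below p j \<longleftrightarrow> descends (p div 2) j"

lemma descends_refl: "descends p p"
  by (auto simp: descends_def intro: exI[of _ 0])

lemma descends_parent: "descends p i \<Longrightarrow> descends p (i div 2)"
  unfolding descends_def by (metis div_mult2_eq power_Suc2)

lemma descends_iff_below: "descends p j \<longleftrightarrow> j = p \<or> below p j"
proof
  assume "descends p j"
  then obtain k where k: "p div 2 ^ k = j" by (auto simp: descends_def)
  show "j = p \<or> below p j"
  proof (cases k)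
    case (Suc i)
    with k have "p div 2 div 2 ^ i = j" by (simp add: div_mult2_eq)
    then show ?thesis by (auto simp: below_def descends_def)
  qed (use k in simp)
next
  assume "j = p \<or> below p j"
  then show "descends p j"
  proof
    assume "below p j"
    then obtain i where "p div 2 div 2 ^ i = j" by (auto simp: below_def descends_def)
    then have "p div 2 ^ Suc i = j" by (simp add: div_mult2_eq)
    then show ?thesis unfolding descends_def by blast
  qed (simp add: descends_refl)
qed

lemma descends_imp_below: "descends p i \<Longrightarrow> j = i div 2 \<Longrightarrow> i \<noteq> 0 \<Longrightarrow> below p j"
proof -
  assume a: "descends p i" "j = i div 2" "i \<noteq> 0"
  then obtain k where "p div 2 ^ k = i" by (auto simp: descends_def)
  then have "p div 2 ^ Suc k = j" using a by (metis div_mult2_eq power_Suc2)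
  then have "p div 2 div 2 ^ k = j" by (simp add: div_mult2_eq)
  then show ?thesis by (auto simp: below_def descends_def)
qed

text \<open>
  A tournament over the items below \<open>N\<close>: item \<open>x\<close> is entered at leaf \<open>N + x\<close>, an inner node \<open>i\<close>
  holds the better of its children \<open>2 * i\<close> and \<open>2 * i + 1\<close>. Item 0 is reserved for an empty cell
  and has key \<open>\<infinity>\<close>, so that zero-initialised memory is an empty tournament.
\<close>

definition winner :: "(nat \<Rightarrow> ereal) \<Rightarrow> nat \<Rightarrow> nat \<Rightarrow> nat" where
  "winner \<kappa> x y = (if \<kappa> y < \<kappa> x then y else x)"

text \<open>An item occurs only on the way from its own leaf to the root. Hence a change of its key
  or of its leaf can affect no other nodes, which makes local repair possible.\<close>

definition placed :: "nat \<Rightarrow> (nat \<Rightarrow> nat) \<Rightarrow> bool" where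
  "placed N W \<longleftrightarrow> (\<forall>i<2 * N. W i < N \<and> (W i \<noteq> 0 \<longrightarrow> descends (N + W i) i)) \<and>
     (\<forall>x<N. W (N + x) \<in> {0, x})"

definition node_ok :: "(nat \<Rightarrow> nat) \<Rightarrow> (nat \<Rightarrow> ereal) \<Rightarrow> nat \<Rightarrow> bool" where
  "node_ok W \<kappa> i \<longleftrightarrow> W i = winner \<kappa> (W (2 * i)) (W (2 * i + 1))"

definition tournament :: "nat \<Rightarrow> (nat \<Rightarrow> nat) \<Rightarrow> (nat \<Rightarrow> ereal) \<Rightarrow> bool" where
  "tournament N W \<kappa> \<longleftrightarrow> placed N W \<and> (\<forall>i. 1 \<le> i \<and> i < N \<longrightarrow> node_ok W \<kappa> i)"

lemma tournament_empty: "0 < N \<Longrightarrow> tournament N (\<lambda>_. 0) \<kappa>"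
  by (auto simp: tournament_def placed_def node_ok_def winner_def)

text \<open>Keys never increase on the way up, since a winner is no worse than either child.\<close>

lemma tournament_min:
  assumes "tournament N W \<kappa>" "1 \<le> p" "p < 2 * N"
  shows "\<kappa> (W 1) \<le> \<kappa> (W p)"
  using assms(2,3)
proof (induction p rule: less_induct)
  case (less p)
  show ?case
  proof (cases "p = 1")
    case False
    define i where "i = p div 2"
    have i: "1 \<le> i" "i < N" "i < p" "p = 2 * i \<or> p = 2 * i + 1"
      using False less.prems by (auto simp: i_def)
    then have "\<kappa> (W i) \<le> \<kappa> (W p)"
      using assms(1) by (auto simp: tournament_def node_ok_def winner_def)
    moreover have "\<kappa> (W 1) \<le> \<kappa> (W i)" using less.IH[of i] i by auto
    ultimately show ?thesis by (rule order_trans[rotated])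
  qed simp
qed

text \<open>An inner entry agrees with that of a child; following it down ends at a leaf, and
  \<open>placed\<close> says which leaf that is.\<close>

lemma tournament_leaf:
  assumes "tournament N W \<kappa>" "1 \<le> i" "i < 2 * N" "W i \<noteq> 0"
  shows "W i < N \<and> W (N + W i) = W i"
proof -
  have "\<exists>p. N \<le> p \<and> p < 2 * N \<and> W p = W i"
    using assms(2-4)
  proof (induction "2 * N - i" arbitrary: i rule: less_induct)
    case less
    show ?case
    proof (cases "N \<le> i")
      case True
      then show ?thesis using less.prems by blast
    next
      case False
      then have "W i = W (2 * i) \<or> W i = W (2 * i + 1)"
        using assms(1) less.prems by (auto simp: tournament_def node_ok_def winner_def)
      then obtain j where j: "W i = W j" "j = 2 * i \<or> j = 2 * i + 1" by auto
      then show ?thesis using less.hyps[of j] less.prems False by auto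
    qed
  qed
  then obtain p where p: "N \<le> p" "p < 2 * N" "W p = W i" by blast
  then obtain y where y: "p = N + y" "y < N" by (metis add_less_cancel_left le_Suc_ex mult_2)
  then have "W (N + y) \<in> {0, y}"
    using assms(1) by (simp add: tournament_def placed_def)
  then show ?thesis using assms(4) p y by auto
qed

text \<open>Invariant of the repair that moves up from a leaf: node \<open>i\<close> and everything
  off its path to the root are in order, only proper ancestors of \<open>i\<close> may be
  stale.\<close>

definition almost :: "nat \<Rightarrow> (nat \<Rightarrow> nat) \<Rightarrow> (nat \<Rightarrow> ereal) \<Rightarrow> nat \<Rightarrow> bool" where
  "almost N W \<kappa> i \<longleftrightarrow> placed N W \<and> (\<forall>j. 1 \<le> j \<and> j < N \<and> \<not> below i j \<longrightarrow> node_ok W \<kappa> j)"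

lemma almost_root: "almost N W \<kappa> i \<Longrightarrow> i \<le> 1 \<Longrightarrow> tournament N W \<kappa>"
  by (auto simp: almost_def tournament_def below_def descends_def)

text \<open>Insertion, removal and change of key in one: the key of \<open>x\<close> may change
  arbitrarily, and its leaf is set to \<open>x\<close> or emptied. By \<open>placed\<close>,
  \<open>x\<close> is invisible to all nodes that are not above its leaf.\<close>

lemma almost_leaf:
  assumes "tournament N W \<kappa>" "\<And>y. y \<noteq> x \<Longrightarrow> \<kappa>' y = \<kappa> y" "0 < x" "x < N" "v = 0 \<or> v = x"
  shows "almost N (W(N + x := v)) \<kappa>' (N + x)"
  unfolding almost_def
proof (intro conjI allI impI)
  show "placed N (W(N + x := v))"
    using assms unfolding tournament_def placed_def by (auto simp: descends_refl)
next
  fix j assume j: "1 \<le> j \<and> j < N \<and> \<not> below (N + x) j"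
  have ok: "node_ok W \<kappa> j" using assms(1) j by (auto simp: tournament_def)
  have child: "c \<noteq> N + x \<and> W c \<noteq> x" if c: "c = 2 * j \<or> c = 2 * j + 1" for c
  proof -
    have *: "\<not> descends (N + x) c"
      using descends_imp_below[of "N + x" c j] j c by auto
    then have "c \<noteq> N + x" using descends_refl by auto
    moreover have "W c \<noteq> x"
      using assms(1,3) * j c unfolding tournament_def placed_def
      by (metis (no_types, lifting) Suc_eq_plus1 Suc_double_not_eq_double add_lessD1 bot_nat_0.not_eq_extremum
        leD linorder_not_less mult_less_mono2 nat_less_le not_less_eq pos2)
    ultimately show ?thesis ..
  qed
  show "node_ok (W(N + x := v)) \<kappa>' j"
    using ok child[of "2 * j"] child[of "2 * j + 1"] j assms(2)
    by (auto simp: node_ok_def winner_def)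
qed

lemma almost_parent:
  assumes "almost N W \<kappa> i" "1 < i" "i < 2 * N"
  shows "almost N (W(i div 2 := winner \<kappa> (W (2 * (i div 2))) (W (2 * (i div 2) + 1)))) \<kappa> (i div 2)"
    (is "almost N ?W \<kappa> ?j")
proof -
  let ?l = "2 * ?j" and ?r = "2 * ?j + 1"
  have j: "1 \<le> ?j" "?j < N" using assms by auto
  have w: "winner \<kappa> (W ?l) (W ?r) \<in> {W ?l, W ?r}" by (simp add: winner_def)
  have pl: "placed N W" using assms by (simp add: almost_def)
  have d: "W c < N \<and> (W c \<noteq> 0 \<longrightarrow> descends (N + W c) ?j)" if "c = ?l \<or> c = ?r" for c
  proof -
    have "c < 2 * N" "c div 2 = ?j" using that j by auto
    then show ?thesis using pl descends_parent[of "N + W c" c] by (auto simp: placed_def)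
  qed
  have "placed N ?W"
    using pl w d[of ?l] d[of ?r] j unfolding placed_def by auto
  moreover have "node_ok ?W \<kappa> k" if k: "1 \<le> k" "k < N" "\<not> below ?j k" for k
  proof (cases "k = ?j")
    case True
    then show ?thesis using j by (auto simp: node_ok_def)
  next
    case False
    then have "\<not> below i k" using k descends_iff_below[of "i div 2" k] by (auto simp: below_def)
    then have "node_ok W \<kappa> k" using assms(1) k by (auto simp: almost_def)
    moreover have "2 * k \<noteq> ?j" "2 * k + 1 \<noteq> ?j"
      using k(3) descends_refl[of "?j div 2"] by (auto simp: below_def)
        (metis div_mult_self1_is_m nonzero_mult_div_cancel_left zero_neq_numeral even_Suc_div_two dvd_triv_left)+
    ultimately show ?thesis using False by (simp add: node_ok_def)
  qed
  ultimately show ?thesis by (simp add: almost_def)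
qed

text \<open>\<open>vn\<close> is the variable that holds \<open>N\<close>, \<open>vx\<close> the one
  with the item and \<open>vv\<close> the one with the new content of its leaf, which is the item or
  0. One routine thus serves for inserting, lowering a key and deleting.\<close>

definition update_tournament :: "nat \<Rightarrow> nat \<Rightarrow> nat \<Rightarrow> nat \<Rightarrow> nat \<Rightarrow> cmd" where
  "update_tournament A K vn vx vv =
     Act (Arith Plus 20 vn vx) ;; Act (Put A 20 vv) ;;
     Loop (LessT 5 20)
      (Act (Arith Divide 20 20 6) ;;
       Act (Arith Plus 21 20 20) ;; Act (Get 22 A 21) ;;
       Act (Arith Plus 21 21 5) ;; Act (Get 23 A 21) ;;
       Act (LGet 10 K 22) ;; Act (LGet 11 K 23) ;;
       Cond (LLessT 11 10) (Act (Put A 20 23)) (Act (Put A 20 22)))"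

context machine
begin

lemma wp_update_tournament:
  assumes t: "tournament N (warr s A) \<kappa>"
    and \<kappa>: "\<And>y. y \<noteq> x \<Longrightarrow> y < N \<Longrightarrow> \<kappa> y = larr s K y"
    and x: "wvar s vx = x" "0 < x" "x < N" and v: "wvar s vv = 0 \<or> wvar s vv = x"
    and n: "wvar s vn = N" and c: "wvar s 5 = 1" "wvar s 6 = 2"
    and A: "A < 9" "K < 9" and bounds: "2 * N \<le> L" "2 * N \<le> B" and h: "2 * N \<le> 2 ^ h"
    and vv: "vv \<notin> {20, 21, 22, 23}"
    and Q: "\<And>s' W. \<lbrakk>\<And>y. y \<notin> {20, 21, 22, 23} \<Longrightarrow> wvar s' y = wvar s y;
        \<And>y. y \<notin> {10, 11} \<Longrightarrow> lvar s' y = lvar s y; larr s' = larr s; warr s' = (warr s)(A := W);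
        clock s' \<le> clock s + 10 * h + 3; tournament N W (larr s K);
        \<And>y. y < N \<Longrightarrow> W (N + y) = (if y = x then wvar s vv else warr s A (N + y))\<rbrakk> \<Longrightarrow> Q s'"
  shows "wp (update_tournament A K vn vx vv) Q s"
proof -
  let ?\<kappa> = "larr s K"
  \<comment> \<open>The last conjunct is the time account: a node below \<open>2 ^ i\<close> is at
    most \<open>i\<close> halvings from the root, and each round takes ten ticks, including its
    test. The summand 2 stands for the two actions before the loop.\<close>
  define I where "I s' \<longleftrightarrow> (\<forall>y. y \<notin> {20, 21, 22, 23} \<longrightarrow> wvar s' y = wvar s y) \<and>
    (\<forall>y. y \<notin> {10, 11} \<longrightarrow> lvar s' y = lvar s y) \<and> larr s' = larr s \<and>
    (\<exists>W. warr s' = (warr s)(A := W) \<and> almost N W ?\<kappa> (wvar s' 20) \<and>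
       (\<forall>y<N. W (N + y) = (if y = x then wvar s vv else warr s A (N + y)))) \<and>
    wvar s' 20 < 2 * N \<and>
    (\<exists>i. wvar s' 20 < 2 ^ i \<and> clock s' + 10 * i \<le> clock s + 10 * h + 2)" for s' :: store
  have al: "almost N ((warr s A)(N + x := wvar s vv)) ?\<kappa> (N + x)"
  \<comment> \<open>The old keys are patched with the current ones from \<open>N\<close> on, since
    \<open>almost_leaf\<close> wants agreement everywhere off \<open>x\<close>, whereas entries of
    the tree are always below \<open>N\<close>.\<close>
  proof (rule almost_leaf[where \<kappa> = "\<lambda>y. if y < N then \<kappa> y else ?\<kappa> y"])
    have "W i < N" if "placed N W" "i < 2 * N" for W i using that by (auto simp: placed_def)
    then show "tournament N (warr s A) (\<lambda>y. if y < N then \<kappa> y else larr s K y)"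
      using t by (auto simp: tournament_def node_ok_def winner_def)
  qed (use \<kappa> x v in auto)
  have loop: "wp (Loop (LessT 5 20)
      (Act (Arith Divide 20 20 6) ;;
       Act (Arith Plus 21 20 20) ;; Act (Get 22 A 21) ;;
       Act (Arith Plus 21 21 5) ;; Act (Get 23 A 21) ;;
       Act (LGet 10 K 22) ;; Act (LGet 11 K 23) ;;
       Cond (LLessT 11 10) (Act (Put A 20 23)) (Act (Put A 20 22)))) Q s0" if "I s0" for s0
    using that
  proof (rule wp_Loop[where I = I and \<mu> = "\<lambda>s. wvar s 20"])
    fix s' assume I: "I s'" and b: "holds (LessT 5 20) s'"
    obtain W i where W: "warr s' = (warr s)(A := W)" "almost N W ?\<kappa> (wvar s' 20)"
      "\<And>y. y < N \<Longrightarrow> W (N + y) = (if y = x then wvar s vv else warr s A (N + y))"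
      "wvar s' 20 < 2 ^ i" "clock s' + 10 * i \<le> clock s + 10 * h + 2"
      using I by (auto simp: I_def)
    have r: "\<And>y. y \<notin> {20, 21, 22, 23} \<Longrightarrow> wvar s' y = wvar s y" "\<And>y. y \<notin> {10, 11} \<Longrightarrow> lvar s' y = lvar s y"
       "larr s' = larr s" "wvar s' 20 < 2 * N"
      using I by (auto simp: I_def)
    define p where "p = wvar s' 20"
    define j where "j = p div 2"
    have p: "1 < p" "p < 2 * N" using b r c by (auto simp: p_def)
    then have "1 \<le> j" "j < N" by (auto simp: j_def)
    then have j: "1 \<le> j" "j < N" "2 * j + 1 < 2 * N" by auto
    obtain i' where i': "i = Suc i'" "j < 2 ^ i'"
      using W(4) p by (cases i) (auto simp: p_def j_def)
    have pl: "placed N W" using W(2) by (simp add: almost_def)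
    have keys: "W (2 * j) < N" "W (Suc (2 * j)) < N" using pl j by (auto simp: placed_def)
    note step = almost_parent[OF W(2)[folded p_def] p, folded j_def]
    have leaf: "\<And>y. j \<noteq> N + y" using j by auto
    have jB: "2 * j + 1 \<le> B" "2 * j + 1 < L" using j bounds by auto
    then have jB': "j \<le> B" "2 * j \<le> B" "j < L" "2 * j < L" "Suc (2 * j) < L" "Suc (2 * j) \<le> B" by auto
    have kB: "W (2 * j) < L" "W (Suc (2 * j)) < L" using keys bounds by auto
    have w5: "wvar s' 5 = 1" "wvar s' 6 = 2" using r(1)[of 5] r(1)[of 6] c by auto
    have jj: "wvar s' 20 div 2 = j" by (simp add: j_def p_def)
    have jp: "j < wvar s' 20" using p by (simp add: j_def p_def)
    have jm: "j + j = 2 * j" by simp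
    have time: "\<exists>i. j < 2 ^ i \<and> Suc (Suc (Suc (Suc (Suc (Suc (Suc (Suc (clock s' + 10 * i)))))))) \<le> clock s + 10 * h"
      using i' W(5) by (intro exI[of _ i']) auto
    have j2: "j < 2 * N" using j by auto
    show "wp (Act (Arith Divide 20 20 6) ;;
       Act (Arith Plus 21 20 20) ;; Act (Get 22 A 21) ;;
       Act (Arith Plus 21 21 5) ;; Act (Get 23 A 21) ;;
       Act (LGet 10 K 22) ;; Act (LGet 11 K 23) ;;
       Cond (LLessT 11 10) (Act (Put A 20 23)) (Act (Put A 20 22))) (\<lambda>t. I t \<and> wvar t 20 < wvar s' 20) (tick s')"
      using step jB' kB A r j2 time
      by (auto simp: wp_simps w5 W(1) jj jp jm cell_ok_def I_def winner_def r(3) W(3) leaf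
          intro!: exI[of _ "W(j := _)"])
  next
    fix s' assume I: "I s'" and b: "\<not> holds (LessT 5 20) s'"
    have w5: "wvar s' 5 = 1" using I c by (auto simp: I_def)
    then obtain W i where W: "warr s' = (warr s)(A := W)" "tournament N W ?\<kappa>"
      "\<And>y. y < N \<Longrightarrow> W (N + y) = (if y = x then wvar s vv else warr s A (N + y))"
      "clock s' + 10 * i \<le> clock s + 10 * h + 2"
      using I b almost_root by (fastforce simp: I_def)
    show "Q (tick s')"
      by (rule Q[of _ W]) (use I W in \<open>auto simp: I_def\<close>)
  qed
  have "N + x < 2 ^ h" "N + x < 2 * N" using x h by auto
  then show ?thesis
    unfolding update_tournament_def using x n bounds A al vv c
    by (auto simp: wp_simps cell_ok_def I_def intro!: loop exI[of _ "(warr s A)(N + x := wvar s vv)"] exI[of _ h])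
qed

end

section \<open>Invariants of Dijkstra's algorithm\<close>

text \<open>Exchanges \<open>2 * i\<close> and \<open>2 * i + 1\<close>, whose sum is
  \<open>4 * i + 1\<close>; the formula uses only operations that the machine has.\<close>

definition opp :: "nat \<Rightarrow> nat" where
  "opp j = 4 * (j div 2) + 1 - j"

lemma opp_even: "opp (2 * i) = 2 * i + 1"
  and opp_odd: "opp (2 * i + 1) = 2 * i"
  by (simp_all add: opp_def)

lemma opp_cases: obtains i where "j = 2 * i" "opp j = 2 * i + 1" | i where "j = 2 * i + 1" "opp j = 2 * i"
  by (metis opp_even opp_odd oddE evenE)

lemma opp_opp [simp]: "opp (opp j) = j"
  by (rule opp_cases[of j]) (auto simp: opp_even opp_odd[simplified])

lemma opp_div [simp]: "opp j div 2 = j div 2"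
  by (rule opp_cases[of j]) auto

lemma opp_less [simp]: "opp j < 2 * m \<longleftrightarrow> j < 2 * m"
  by (rule opp_cases[of j]) auto

text \<open>
  The vertices are \<open>1, \<dots>, n\<close>, and the two orientations of the \<open>i\<close>-th edge are the arcs \<open>2 * i\<close>
  and \<open>2 * i + 1\<close>; \<open>e j\<close> is the tail of arc \<open>j\<close>.
\<close>

locale graph_arcs =
  fixes n m r :: nat and E :: "nat set set" and l :: "nat set \<Rightarrow> real" and e :: "nat \<Rightarrow> nat"
  assumes graph: "simple_graph {1..n} E"
    and nonneg: "\<And>a. a \<in> E \<Longrightarrow> 0 \<le> l a"
    and root: "1 \<le> r" "r \<le> n"
    and arc_edge: "\<And>j. j < 2 * m \<Longrightarrow> {e j, e (opp j)} \<in> E"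
    and edge_arc: "\<And>x y. {x, y} \<in> E \<Longrightarrow> \<exists>j<2 * m. e j = x \<and> e (opp j) = y"
begin

lemma edge_bounds: "{x, y} \<in> E \<Longrightarrow> 1 \<le> x \<and> x \<le> n \<and> 1 \<le> y \<and> y \<le> n \<and> x \<noteq> y"
  using simple_graph_edgeD[OF graph] by fastforce

lemma e_bounds: "j < 2 * m \<Longrightarrow> 1 \<le> e j \<and> e j \<le> n"
  using edge_bounds[OF arc_edge] by auto

text \<open>\<open>a - 1\<close> is the largest index below \<open>b\<close> of an arc with tail
  \<open>v\<close>; the shift leaves 0 to say that there is none.\<close>

definition last_arc :: "nat \<Rightarrow> nat \<Rightarrow> nat \<Rightarrow> bool" where
  "last_arc v b a \<longleftrightarrow> a \<le> b \<and> (a \<noteq> 0 \<longrightarrow> e (a - 1) = v) \<and> (\<forall>k. a \<le> k \<and> k < b \<longrightarrow> e k \<noteq> v)"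

lemma last_arc_Suc: "last_arc v b a \<Longrightarrow> last_arc v (Suc b) (if e b = v then Suc b else a)"
  by (auto simp: last_arc_def less_Suc_eq)

text \<open>
  The arcs of a vertex are linked by decreasing index, \<open>a\<close> being one more than the index of the first
  arc of the list. Hence the arcs that remain to be scanned are those of index below \<open>a\<close>.
\<close>

definition pending :: "nat \<Rightarrow> nat \<Rightarrow> nat \<Rightarrow> bool" where
  "pending c a y \<longleftrightarrow> (\<exists>j<a. e j = c \<and> e (opp j) = y)"

text \<open>Settled vertices have \<open>ord x \<noteq> 0\<close>, discovered ones that still wait
  are in \<open>Q\<close>, \<open>k\<close> is the last order number given, and the arcs of
  \<open>c\<close> below \<open>a\<close> remain to be scanned. The last conjunct is the usual
  relaxation property of settled vertices, suspended for those arcs. All vertices involved are the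
  root or endpoints of arcs, so their number is bounded in terms of \<open>m\<close> alone.\<close>

definition dijkstra ::
  "(nat \<Rightarrow> nat) \<Rightarrow> (nat \<Rightarrow> ereal) \<Rightarrow> (nat \<Rightarrow> nat) \<Rightarrow> nat set \<Rightarrow> nat \<Rightarrow> nat \<Rightarrow> nat \<Rightarrow> bool" where
  "dijkstra P D ord Q c k a \<longleftrightarrow>
     (\<forall>x. ord x \<noteq> 0 \<or> x \<in> Q \<longrightarrow> 1 \<le> x \<and> x \<le> n \<and> x \<in> insert r (e ` {..<2 * m}) \<and> 0 \<le> D x \<and> D x \<noteq> \<infinity>) \<and>
     (\<forall>x\<in>Q. ord x = 0) \<and>
     (\<forall>x. P x \<noteq> 0 \<longleftrightarrow> ord x \<noteq> 0 \<or> x \<in> Q) \<and>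
     (ord r \<noteq> 0 \<or> r \<in> Q) \<and> P r = r \<and> D r = 0 \<and>
     (\<forall>x. ord x \<le> k) \<and>
     (\<forall>x. (ord x \<noteq> 0 \<or> x \<in> Q) \<and> x \<noteq> r \<longrightarrow>
        ord (P x) \<noteq> 0 \<and> {x, P x} \<in> E \<and> D x = ereal (l {x, P x}) + D (P x) \<and>
        (ord x \<noteq> 0 \<longrightarrow> ord (P x) < ord x)) \<and>
     (\<forall>x y. ord x \<noteq> 0 \<and> y \<in> Q \<longrightarrow> D x \<le> D y) \<and>
     (a \<noteq> 0 \<longrightarrow> ord c \<noteq> 0 \<and> e (a - 1) = c \<and> (\<forall>x. ord x \<noteq> 0 \<longrightarrow> D x \<le> D c)) \<and> a \<le> 2 * m \<and>
     (\<forall>x y. ord x \<noteq> 0 \<and> {x, y} \<in> E \<longrightarrow>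
        (ord y \<noteq> 0 \<or> y \<in> Q) \<and> D y \<le> ereal (l {x, y}) + D x \<or> x = c \<and> pending c a y)"

lemma dijkstraD:
  assumes "dijkstra P D ord Q c k a"
  shows dijkstra_bounds: "\<And>x. ord x \<noteq> 0 \<or> x \<in> Q \<Longrightarrow>
      1 \<le> x \<and> x \<le> n \<and> x \<in> insert r (e ` {..<2 * m}) \<and> 0 \<le> D x \<and> D x \<noteq> \<infinity>"
    and dijkstra_queue: "\<And>x. x \<in> Q \<Longrightarrow> ord x = 0"
    and dijkstra_reached: "\<And>x. P x \<noteq> 0 \<longleftrightarrow> ord x \<noteq> 0 \<or> x \<in> Q"
    and dijkstra_root: "ord r \<noteq> 0 \<or> r \<in> Q" "P r = r" "D r = 0"
    and dijkstra_count: "\<And>x. ord x \<le> k"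
    and dijkstra_parent: "\<And>x. ord x \<noteq> 0 \<or> x \<in> Q \<Longrightarrow> x \<noteq> r \<Longrightarrow>
        ord (P x) \<noteq> 0 \<and> {x, P x} \<in> E \<and> D x = ereal (l {x, P x}) + D (P x) \<and>
        (ord x \<noteq> 0 \<longrightarrow> ord (P x) < ord x)"
    and dijkstra_le: "\<And>x y. ord x \<noteq> 0 \<Longrightarrow> y \<in> Q \<Longrightarrow> D x \<le> D y"
    and dijkstra_current: "a \<noteq> 0 \<Longrightarrow> ord c \<noteq> 0 \<and> e (a - 1) = c \<and> (\<forall>x. ord x \<noteq> 0 \<longrightarrow> D x \<le> D c)"
      "a \<le> 2 * m"
    and dijkstra_edge: "\<And>x y. ord x \<noteq> 0 \<Longrightarrow> {x, y} \<in> E \<Longrightarrow>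
        (ord y \<noteq> 0 \<or> y \<in> Q) \<and> D y \<le> ereal (l {x, y}) + D x \<or> x = c \<and> pending c a y"
proof goal_cases
  case 1
  then show ?case using assms[unfolded dijkstra_def, THEN conjunct1] by blast
next
  case 2
  then show ?case using assms[unfolded dijkstra_def, THEN conjunct2, THEN conjunct1] by blast
next
  case 3
  then show ?case using assms[unfolded dijkstra_def, THEN conjunct2, THEN conjunct2, THEN conjunct1] by blast
next
  case 4
  then show ?case using assms[unfolded dijkstra_def, THEN conjunct2, THEN conjunct2, THEN conjunct2, THEN conjunct1] by blast
next
  case 5
  then show ?case using assms[unfolded dijkstra_def, THEN conjunct2, THEN conjunct2, THEN conjunct2, THEN conjunct2, THEN conjunct1] by blast
next
  case 6
  then show ?case using assms[unfolded dijkstra_def, THEN conjunct2, THEN conjunct2, THEN conjunct2, THEN conjunct2, THEN conjunct2, THEN conjunct1] by blast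
next
  case 7
  then show ?case using assms[unfolded dijkstra_def, THEN conjunct2, THEN conjunct2, THEN conjunct2, THEN conjunct2, THEN conjunct2, THEN conjunct2, THEN conjunct1] by blast
next
  case 8
  then show ?case using assms[unfolded dijkstra_def, THEN conjunct2, THEN conjunct2, THEN conjunct2, THEN conjunct2, THEN conjunct2, THEN conjunct2, THEN conjunct2, THEN conjunct1] by blast
next
  case 9
  then show ?case using assms[unfolded dijkstra_def, THEN conjunct2, THEN conjunct2, THEN conjunct2, THEN conjunct2, THEN conjunct2, THEN conjunct2, THEN conjunct2, THEN conjunct2, THEN conjunct1] by blast
next
  case 10
  then show ?case using assms[unfolded dijkstra_def, THEN conjunct2, THEN conjunct2, THEN conjunct2, THEN conjunct2, THEN conjunct2, THEN conjunct2, THEN conjunct2, THEN conjunct2, THEN conjunct2, THEN conjunct1] by blast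
next
  case 11
  then show ?case using assms[unfolded dijkstra_def, THEN conjunct2, THEN conjunct2, THEN conjunct2, THEN conjunct2, THEN conjunct2, THEN conjunct2, THEN conjunct2, THEN conjunct2, THEN conjunct2, THEN conjunct2, THEN conjunct1] by blast
next
  case 12
  then show ?case using assms[unfolded dijkstra_def, THEN conjunct2, THEN conjunct2, THEN conjunct2, THEN conjunct2, THEN conjunct2, THEN conjunct2, THEN conjunct2, THEN conjunct2, THEN conjunct2, THEN conjunct2, THEN conjunct2] by blast
qed

lemma dijkstra_init:
  assumes "P = (\<lambda>_. 0)(r := r)" "D r = 0"
  shows "dijkstra P D (\<lambda>_. 0) {r} c 0 0"
  using assms root by (auto simp: dijkstra_def)

lemma dijkstra_settle:
  assumes "dijkstra P D ord Q c k 0" "x \<in> Q" "\<And>y. y \<in> Q \<Longrightarrow> D x \<le> D y" "last_arc x (2 * m) a"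
  shows "dijkstra P D (ord(x := Suc k)) (Q - {x}) x (Suc k) a"
proof -
  note dj = dijkstraD[OF assms(1)]
  have ox: "ord x = 0"
    using dj(2) assms(2) by auto
  \<comment> \<open>Nothing is pending when \<open>a = 0\<close>, so all arcs of settled vertices
    are relaxed; those of \<open>x\<close> become pending all at once.\<close>
  have old: "(ord z \<noteq> 0 \<or> z \<in> Q) \<and> D z \<le> ereal (l {y, z}) + D y" if "ord y \<noteq> 0" "{y, z} \<in> E" for y z
    using dj(12) that by (auto simp: pending_def)
  have new: "pending x a z" if xz: "{x, z} \<in> E" for z
  proof -
    obtain j where "j < 2 * m" "e j = x" "e (opp j) = z" using edge_arc[OF xz] by auto
    then show ?thesis using assms(4) unfolding pending_def last_arc_def by (metis linorder_not_le)
  qed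
  have le: "ord y \<noteq> 0 \<Longrightarrow> D y \<le> D x" for y
    using dj(9) assms(2) by auto
  have la: "a \<noteq> 0 \<Longrightarrow> e (a - 1) = x" "a \<le> 2 * m" using assms(4) by (auto simp: last_arc_def)
  show ?thesis
    unfolding dijkstra_def
  proof (intro conjI)
    show "\<forall>y. (ord(x := Suc k)) y \<noteq> 0 \<or> y \<in> Q - {x} \<longrightarrow>
        1 \<le> y \<and> y \<le> n \<and> y \<in> insert r (e ` {..<2 * m}) \<and> 0 \<le> D y \<and> D y \<noteq> \<infinity>"
      using dj(1) assms(2) by auto
    show "\<forall>y\<in>Q - {x}. (ord(x := Suc k)) y = 0"
      using dj(2) by auto
    show "\<forall>y. (P y \<noteq> 0) = ((ord(x := Suc k)) y \<noteq> 0 \<or> y \<in> Q - {x})"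
      using dj(3) assms(2) by auto
    show "\<forall>y. (ord(x := Suc k)) y \<le> Suc k"
      using dj(7) by (auto simp: le_Suc_eq)
    show "(ord(x := Suc k)) r \<noteq> 0 \<or> r \<in> Q - {x}" "P r = r" "D r = 0"
      using dj(4-6) by auto
    show "\<forall>y. ((ord(x := Suc k)) y \<noteq> 0 \<or> y \<in> Q - {x}) \<and> y \<noteq> r \<longrightarrow>
        (ord(x := Suc k)) (P y) \<noteq> 0 \<and> {y, P y} \<in> E \<and> D y = ereal (l {y, P y}) + D (P y) \<and>
        ((ord(x := Suc k)) y \<noteq> 0 \<longrightarrow> (ord(x := Suc k)) (P y) < (ord(x := Suc k)) y)"
    proof (intro allI impI)
      fix y assume y: "((ord(x := Suc k)) y \<noteq> 0 \<or> y \<in> Q - {x}) \<and> y \<noteq> r"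
      then have "ord y \<noteq> 0 \<or> y \<in> Q" "y \<noteq> r" using assms(2) by (auto split: if_splits)
      then have *: "ord (P y) \<noteq> 0" "{y, P y} \<in> E" "D y = ereal (l {y, P y}) + D (P y)"
        "ord y \<noteq> 0 \<longrightarrow> ord (P y) < ord y" "ord (P y) \<le> k"
        using dj(7,8) by auto
      then show "(ord(x := Suc k)) (P y) \<noteq> 0 \<and> {y, P y} \<in> E \<and> D y = ereal (l {y, P y}) + D (P y) \<and>
        ((ord(x := Suc k)) y \<noteq> 0 \<longrightarrow> (ord(x := Suc k)) (P y) < (ord(x := Suc k)) y)"
        using ox by auto
    qed
    show "\<forall>y z. (ord(x := Suc k)) y \<noteq> 0 \<and> z \<in> Q - {x} \<longrightarrow> D y \<le> D z"
      using dj(9) assms(3) by auto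
    show "a \<noteq> 0 \<longrightarrow> (ord(x := Suc k)) x \<noteq> 0 \<and> e (a - 1) = x \<and> (\<forall>y. (ord(x := Suc k)) y \<noteq> 0 \<longrightarrow> D y \<le> D x)"
      using la le by auto
    show "a \<le> 2 * m" using la by auto
    show "\<forall>y z. (ord(x := Suc k)) y \<noteq> 0 \<and> {y, z} \<in> E \<longrightarrow>
       ((ord(x := Suc k)) z \<noteq> 0 \<or> z \<in> Q - {x}) \<and> D z \<le> ereal (l {y, z}) + D y \<or> y = x \<and> pending x a z"
      using old new by auto
  qed
qed

lemma pending_next:
  assumes "last_arc (e j) j b" "pending (e j) (Suc j) y" "y \<noteq> e (opp j)"
  shows "pending (e j) b y"
  using assms unfolding pending_def last_arc_def by (metis less_Suc_eq linorder_not_le)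

lemma dijkstra_skip:
  assumes "dijkstra P D ord Q c k (Suc j)" "last_arc (e j) j b"
    and "ord (e (opp j)) \<noteq> 0 \<or>
      e (opp j) \<in> Q \<and> D (e (opp j)) \<le> D c + ereal (l {c, e (opp j)})"
  shows "dijkstra P D ord Q c k b"
proof -
  note dj = dijkstraD[OF assms(1)]
  have c: "e j = c" "ord c \<noteq> 0" "j < 2 * m" "\<And>x. ord x \<noteq> 0 \<Longrightarrow> D x \<le> D c"
    using dj(10,11) by auto
  have E: "{c, e (opp j)} \<in> E" using arc_edge c by auto
  let ?w = "e (opp j)"
  \<comment> \<open>A settled target is no farther away than \<open>c\<close>, and nonnegativity of
    the weight gives the rest.\<close>
  have w: "(ord ?w \<noteq> 0 \<or> ?w \<in> Q) \<and> D ?w \<le> ereal (l {c, ?w}) + D c"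
    using assms(3) c(4)[of ?w] nonneg[OF E] add_mono[of 0 "ereal (l {c, ?w})" "D ?w" "D c"]
    by (auto simp: add.commute)
  have edge: "(ord y \<noteq> 0 \<or> y \<in> Q) \<and> D y \<le> ereal (l {x, y}) + D x \<or> x = c \<and> pending c b y"
    if xy: "ord x \<noteq> 0" "{x, y} \<in> E" for x y
  proof (cases "x = c \<and> y = ?w")
    case False
    then show ?thesis using dj(12)[OF xy] pending_next[OF assms(2), of y] c(1) by auto
  qed (use w in auto)
  have b: "b \<noteq> 0 \<Longrightarrow> e (b - 1) = c" "b \<le> 2 * m"
    using assms(2) c by (auto simp: last_arc_def)
  show ?thesis
    unfolding dijkstra_def
  proof (intro conjI)
    show "\<forall>x. ord x \<noteq> 0 \<or> x \<in> Q \<longrightarrow>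
        1 \<le> x \<and> x \<le> n \<and> x \<in> insert r (e ` {..<2 * m}) \<and> 0 \<le> D x \<and> D x \<noteq> \<infinity>"
      using dj(1) by blast
    show "\<forall>x. (P x \<noteq> 0) = (ord x \<noteq> 0 \<or> x \<in> Q)"
      using dj(3) by blast
    show "\<forall>x. (ord x \<noteq> 0 \<or> x \<in> Q) \<and> x \<noteq> r \<longrightarrow> ord (P x) \<noteq> 0 \<and> {x, P x} \<in> E \<and>
        D x = ereal (l {x, P x}) + D (P x) \<and> (ord x \<noteq> 0 \<longrightarrow> ord (P x) < ord x)"
      using dj(8) by blast
    show "\<forall>x y. ord x \<noteq> 0 \<and> {x, y} \<in> E \<longrightarrow> (ord y \<noteq> 0 \<or> y \<in> Q) \<and>
        D y \<le> ereal (l {x, y}) + D x \<or> x = c \<and> pending c b y"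
      using edge by blast
  qed (use dj(2,4-7,9) b c in auto)
qed

lemma dijkstra_relax:
  assumes "dijkstra P D ord Q c k (Suc j)" "last_arc (e j) j b"
    and w: "w = e (opp j)" "ord w = 0"
    and d: "d = D c + ereal (l {c, w})" "w \<in> Q \<Longrightarrow> d < D w"
  shows "dijkstra (P(w := c)) (D(w := d)) ord (insert w Q) c k b"
proof -
  note dj = dijkstraD[OF assms(1)]
  have c: "e j = c" "ord c \<noteq> 0" "j < 2 * m" "\<And>x. ord x \<noteq> 0 \<Longrightarrow> D x \<le> D c"
    using dj(10,11) by auto
  then have cD: "0 \<le> D c" "D c \<noteq> \<infinity>" "1 \<le> c"
    using dj(1)[of c] by auto
  have E: "{c, w} \<in> E" using arc_edge c w by auto
  have wc: "w \<noteq> c" "1 \<le> w" "w \<le> n" using edge_bounds[OF E] by auto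
  have we: "w \<in> e ` {..<2 * m}" using c(3) w(1) by auto
  have dd: "0 \<le> d" "d \<noteq> \<infinity>" "D c \<le> d"
    using d(1) cD nonneg[OF E] add_mono[of 0 "ereal (l {c, w})" "D c" "D c"] by (auto simp: add.commute)
  \<comment> \<open>An unsettled root would be in the queue with distance 0, which \<open>d\<close>
    cannot undercut.\<close>
  have wr: "w \<noteq> r"
  proof
    assume "w = r"
    then have "w \<in> Q" "D w = 0" using dj(4,6) w(2) by auto
    then show False using d dd by auto
  qed
  have b: "b \<noteq> 0 \<longrightarrow> e (b - 1) = c" "b \<le> 2 * m"
    using assms(2) c by (auto simp: last_arc_def)
  have old: "(ord y \<noteq> 0 \<or> y \<in> Q) \<and> D y \<le> ereal (l {x, y}) + D x \<or> x = c \<and> pending c (Suc j) y"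
    if "ord x \<noteq> 0" "{x, y} \<in> E" for x y
    using dj(12) that by blast
  show ?thesis
    unfolding dijkstra_def
  proof (intro conjI)
    show "\<forall>x. ord x \<noteq> 0 \<or> x \<in> insert w Q \<longrightarrow>
        1 \<le> x \<and> x \<le> n \<and> x \<in> insert r (e ` {..<2 * m}) \<and> 0 \<le> (D(w := d)) x \<and> (D(w := d)) x \<noteq> \<infinity>"
      using dj(1) wc dd we by auto
    show "\<forall>x\<in>insert w Q. ord x = 0" using dj(2) w by auto
    show "\<forall>x. ((P(w := c)) x \<noteq> 0) = (ord x \<noteq> 0 \<or> x \<in> insert w Q)"
      using dj(3) cD(3) by auto
    show "ord r \<noteq> 0 \<or> r \<in> insert w Q" "(P(w := c)) r = r" "(D(w := d)) r = 0" "\<forall>x. ord x \<le> k"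
      using dj(4-7) wr by auto
    show "\<forall>x. (ord x \<noteq> 0 \<or> x \<in> insert w Q) \<and> x \<noteq> r \<longrightarrow>
        ord ((P(w := c)) x) \<noteq> 0 \<and> {x, (P(w := c)) x} \<in> E \<and>
        (D(w := d)) x = ereal (l {x, (P(w := c)) x}) + (D(w := d)) ((P(w := c)) x) \<and>
        (ord x \<noteq> 0 \<longrightarrow> ord ((P(w := c)) x) < ord x)"
    proof (intro allI impI)
      fix x assume x: "(ord x \<noteq> 0 \<or> x \<in> insert w Q) \<and> x \<noteq> r"
      show "ord ((P(w := c)) x) \<noteq> 0 \<and> {x, (P(w := c)) x} \<in> E \<and>
        (D(w := d)) x = ereal (l {x, (P(w := c)) x}) + (D(w := d)) ((P(w := c)) x) \<and>
        (ord x \<noteq> 0 \<longrightarrow> ord ((P(w := c)) x) < ord x)"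
      proof (cases "x = w")
        case True
        then show ?thesis using c E wc w d by (auto simp: insert_commute add.commute)
      next
        case False
        then have *: "ord (P x) \<noteq> 0" "{x, P x} \<in> E" "D x = ereal (l {x, P x}) + D (P x)"
          "ord x \<noteq> 0 \<longrightarrow> ord (P x) < ord x"
          using x dj(8)[of x] by auto
        \<comment> \<open>Parents are settled and \<open>w\<close> is not, so lowering
          \<open>D w\<close> disturbs no other parent equation.\<close>
        then have "P x \<noteq> w" using w(2) by auto
        then show ?thesis using * False by auto
      qed
    qed
    show "\<forall>x y. ord x \<noteq> 0 \<and> y \<in> insert w Q \<longrightarrow> (D(w := d)) x \<le> (D(w := d)) y"
    proof (intro allI impI)
      fix x y assume xy: "ord x \<noteq> 0 \<and> y \<in> insert w Q"
      then have "D x \<le> d" "x \<noteq> w" using c(4)[of x] dd w by auto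
      then show "(D(w := d)) x \<le> (D(w := d)) y"
        using xy dj(9) by auto
    qed
    show "b \<noteq> 0 \<longrightarrow> ord c \<noteq> 0 \<and> e (b - 1) = c \<and> (\<forall>x. ord x \<noteq> 0 \<longrightarrow> (D(w := d)) x \<le> (D(w := d)) c)"
      using b c w wc by auto
    show "b \<le> 2 * m" by fact
    show "\<forall>x y. ord x \<noteq> 0 \<and> {x, y} \<in> E \<longrightarrow> (ord y \<noteq> 0 \<or> y \<in> insert w Q) \<and>
        (D(w := d)) y \<le> ereal (l {x, y}) + (D(w := d)) x \<or> x = c \<and> pending c b y"
    proof (intro allI impI)
      fix x y assume xy: "ord x \<noteq> 0 \<and> {x, y} \<in> E"
      then have xw: "x \<noteq> w" using w(2) by auto
      show "(ord y \<noteq> 0 \<or> y \<in> insert w Q) \<and>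
        (D(w := d)) y \<le> ereal (l {x, y}) + (D(w := d)) x \<or> x = c \<and> pending c b y"
      proof (cases "y = w")
        case True
        show ?thesis
        proof (cases "x = c")
          case True
          then show ?thesis using \<open>y = w\<close> d wc by (auto simp: add.commute)
        next
          case False
          then have "w \<in> Q" "D w \<le> ereal (l {x, w}) + D x" using old[of x w] xy w(2) True by auto
          then have "d \<le> ereal (l {x, w}) + D x" using d(2) by auto
          then show ?thesis using True xw by auto
        qed
      next
        case False
        then show ?thesis
          using old[of x y] xy xw pending_next[OF assms(2), of y] c(1) w(1) by auto
      qed
    qed
  qed
qed

lemma dijkstra_final:
  assumes "dijkstra P D ord {} c k 0"
  shows "shortest_path_tree {1..n} E l r {x. ord x \<noteq> 0} (\<lambda>x. real_of_ereal (D x)) P ord"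
    and "ord x \<noteq> 0 \<Longrightarrow> D x = ereal (real_of_ereal (D x))"
proof -
  have fin: "D x = ereal (real_of_ereal (D x))" if "ord x \<noteq> 0" for x
    using assms that by (cases "D x") (auto simp: dijkstra_def)
  then show "ord x \<noteq> 0 \<Longrightarrow> D x = ereal (real_of_ereal (D x))" .
  have edge: "ord y \<noteq> 0 \<and> D y \<le> ereal (l {x, y}) + D x" if "ord x \<noteq> 0" "{x, y} \<in> E" for x y
    using assms that by (auto simp: dijkstra_def pending_def)
  show "shortest_path_tree {1..n} E l r {x. ord x \<noteq> 0} (\<lambda>x. real_of_ereal (D x)) P ord"
  proof
    show "simple_graph {1..n} E" "r \<in> {1..n}" using graph root by auto
    show "r \<in> {x. ord x \<noteq> 0}" "P r = r" "real_of_ereal (D r) = 0"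
      using assms by (auto simp: dijkstra_def)
    fix x y assume x: "x \<in> {x. ord x \<noteq> 0}"
    {
      assume xr: "x \<noteq> r"
      then have *: "ord (P x) \<noteq> 0" "{x, P x} \<in> E" "ord (P x) < ord x" "D x = ereal (l {x, P x}) + D (P x)"
        using assms x by (auto simp: dijkstra_def)
      then show "P x \<in> {x. ord x \<noteq> 0} \<and> {x, P x} \<in> E \<and> ord (P x) < ord x \<and>
          real_of_ereal (D x) = l {x, P x} + real_of_ereal (D (P x))"
        using fin[of "P x"] by (cases "D (P x)") auto
    }
    assume xy: "{x, y} \<in> E"
    show "y \<in> {x. ord x \<noteq> 0}" using edge[OF _ xy] x by auto
    then have "D x \<le> ereal (l {x, y}) + D y"
      using edge[of y x] xy by (auto simp: insert_commute)
    then have "ereal (real_of_ereal (D x)) \<le> ereal (l {x, y}) + ereal (real_of_ereal (D y))"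
      using fin x \<open>y \<in> {x. ord x \<noteq> 0}\<close> by auto
    then show "real_of_ereal (D x) \<le> l {x, y} + real_of_ereal (D y)" by simp
  qed
qed

end

section \<open>Sweeping over the non-tree edges\<close>

context shortest_path_tree
begin

lemma subtree_of_root: "x \<in> R \<Longrightarrow> x \<in> subtree t"
proof (induction "ord x" arbitrary: x rule: less_induct)
  case less
  show ?case
  proof (cases "x = t")
    case True
    then show ?thesis using subtree_self less.prems by auto
  next
    case False
    then show ?thesis using less.hyps parent[OF less.prems False] subtree_child less.prems by auto
  qed
qed

text \<open>With \<open>X\<close> as the set of vertices that have a value, \<open>z\<close> is the
  lowest vertex without one on the tree path from \<open>v\<close> to the root: any other such
  vertex \<open>y\<close> has \<open>z\<close> in its subtree.\<close>

definition is_top :: "'a set \<Rightarrow> 'a \<Rightarrow> 'a \<Rightarrow> bool" where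
  "is_top X v z \<longleftrightarrow> z \<notin> X \<and> v \<in> subtree z \<and> (\<forall>y. y \<notin> X \<and> v \<in> subtree y \<longrightarrow> z \<in> subtree y)"

lemma top_self: "is_top X x z \<Longrightarrow> x \<notin> X \<Longrightarrow> z = x"
  using subtree_self[of x] subtree_R[of x] subtree_ord[of x z] subtree_ord_eq[of z x]
  by (auto simp: is_top_def)

text \<open>A crossed vertex outside \<open>X\<close> would lie above one end, hence above the
  common top, hence above the other end as well. So an edge whose ends share a top has nothing left
  to settle.\<close>

lemma same_top_not_crossed: "is_top X p z \<Longrightarrow> is_top X q z \<Longrightarrow> crosses v p q \<Longrightarrow> v \<in> X"
  unfolding is_top_def crosses_def using subtree_trans by blast

text \<open>An ancestor is settled before its descendants, so the later of two tops cannot lie above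
  the other and is still below the common ancestor of the two ends.\<close>

lemma later_top_crossed:
  assumes "is_top X p x" "is_top X q y" "x \<noteq> y" "ord y \<le> ord x"
  shows "crosses x p q" "x \<noteq> t"
proof -
  have "q \<notin> subtree x"
  proof
    assume "q \<in> subtree x"
    then have "y \<in> subtree x" using assms by (auto simp: is_top_def)
    then show False using subtree_ord_eq[of y x] assms by auto
  qed
  then show "crosses x p q" using assms(1) by (auto simp: crosses_def is_top_def)
  have "q \<in> R" using assms(2) subtree_R by (auto simp: is_top_def)
  then show "x \<noteq> t" using \<open>q \<notin> subtree x\<close> subtree_of_root by auto
qed

text \<open>
  The disjoint sets are the classes of reached vertices with the same top; \<open>rt v\<close> is the
  representative of the class of \<open>v\<close> that is found by following the pointers \<open>up\<close>.
\<close>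

definition union_find ::
  "'a set \<Rightarrow> ('a \<Rightarrow> 'a) \<Rightarrow> ('a \<Rightarrow> nat) \<Rightarrow> ('a \<Rightarrow> 'a) \<Rightarrow> ('a \<Rightarrow> 'a) \<Rightarrow> bool" where
  "union_find X up rank tip rt \<longleftrightarrow>
     (\<forall>v\<in>R. rt v \<in> R \<and> up v \<in> R \<and> rt (rt v) = rt v \<and> rt (up v) = rt v \<and> (up v = v \<longleftrightarrow> rt v = v) \<and>
        (up v \<noteq> v \<longrightarrow> rank v < rank (up v)) \<and> rank v \<le> rank (rt v) \<and>
        is_top X v (tip (rt v)) \<and> 2 ^ rank (rt v) \<le> card {w \<in> R. rt w = rt v}) \<and>
     (\<forall>v\<in>R. \<forall>w\<in>R. tip (rt v) = tip (rt w) \<longrightarrow> rt v = rt w)"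

lemma union_findD:
  assumes "union_find X up rank tip rt" "v \<in> R"
  shows "rt v \<in> R" "up v \<in> R" "rt (rt v) = rt v" "rt (up v) = rt v" "up v = v \<longleftrightarrow> rt v = v"
    "up v \<noteq> v \<Longrightarrow> rank v < rank (up v)" "rank v \<le> rank (rt v)" "is_top X v (tip (rt v))"
    "2 ^ rank (rt v) \<le> card {w \<in> R. rt w = rt v}"
    "w \<in> R \<Longrightarrow> tip (rt v) = tip (rt w) \<Longrightarrow> rt v = rt w"
  using assms unfolding union_find_def by blast+

lemma union_find_init:
  assumes "\<And>v. v \<in> R \<Longrightarrow> up v = v \<and> rank v = 0 \<and> tip v = v"
  shows "union_find {} up rank tip (\<lambda>v. v)"
  unfolding union_find_def
proof (intro conjI ballI impI)
  fix v assume v: "v \<in> R"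
  show "is_top {} v (tip v)"
    using assms[OF v] subtree_self[OF v] by (auto simp: is_top_def)
  have "{w \<in> R. w = v} = {v}" using v by auto
  then show "2 ^ rank v \<le> card {w \<in> R. w = v}" using assms[OF v] by simp
qed (use assms in auto)

text \<open>A representative of rank \<open>i\<close> has a class of at least \<open>2 ^ i\<close>
  members, so ranks, and with them pointer chains, are logarithmic even without path
  compression.\<close>

lemma union_find_rank:
  assumes "union_find X up rank tip rt" "v \<in> R" "finite R"
  shows "2 ^ rank v \<le> card R"
proof -
  have "(2::nat) ^ rank v \<le> 2 ^ rank (rt v)"
    using union_findD(7)[OF assms(1,2)] by (intro power_increasing) auto
  also have "\<dots> \<le> card {w \<in> R. rt w = rt v}" using union_findD(9)[OF assms(1,2)] .
  also have "\<dots> \<le> card R" using assms(3) by (intro card_mono) auto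
  finally show ?thesis .
qed

text \<open>Once \<open>x\<close> gets a value, exactly the vertices whose top was \<open>x\<close>
  pass to the top of \<open>par x\<close>. The rank decides which representative survives, hence
  \<open>lo\<close> and \<open>hi\<close> may be either one and the top is recorded separately in
  \<open>tip\<close>.\<close>

lemma union_find_union:
  assumes uf: "union_find X up rank tip rt" and fin: "finite R"
    and x: "x \<in> R" "x \<notin> X" "x \<noteq> t"
    and lohi: "lo = rt x \<and> hi = rt (par x) \<or> lo = rt (par x) \<and> hi = rt x" "rank lo \<le> rank hi"
    and rank': "rank' = (if rank lo = rank hi then rank(hi := Suc (rank hi)) else rank)"
  shows "union_find (insert x X) (up(lo := hi)) rank' (tip(hi := tip (rt (par x))))
    (\<lambda>v. if rt v = lo then hi else rt v)"
    (is "union_find ?X ?up rank' ?tip ?rt")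
proof -
  note D = union_findD[OF uf]
  let ?p = "par x"
  have p: "?p \<in> R" "ord ?p < ord x" using parent[OF x(1,3)] by auto
  define tp where "tp = tip (rt ?p)"
  have tx: "tip (rt x) = x" using top_self[OF D(8)[OF x(1)] x(2)] .
  have tpt: "is_top X ?p tp" using D(8)[OF p(1)] by (simp add: tp_def)
  then have "ord tp \<le> ord ?p" using subtree_ord by (auto simp: is_top_def)
  \<comment> \<open>The top of \<open>par x\<close> is settled no later than \<open>par x\<close>,
    hence before \<open>x\<close>. So the two classes differ and linking creates no cycle.\<close>
  then have tpx: "tp \<noteq> x" using p by auto
  then have ne: "rt x \<noteq> rt ?p" using tx by (auto simp: tp_def)
  have lh: "lo \<noteq> hi" "rt lo = lo" "rt hi = hi" "lo \<in> R" "hi \<in> R"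
    using lohi(1) ne D(1,3) x(1) p(1) by auto
  have cls: "rt v = lo \<or> rt v = hi \<longleftrightarrow> rt v = rt x \<or> rt v = rt ?p" for v
    using lohi(1) by auto
  have tip: "is_top ?X v (?tip (?rt v))" if v: "v \<in> R" for v
  proof (cases "rt v = lo \<or> rt v = hi")
    case True
    then have e: "?tip (?rt v) = tp" by (auto simp: tp_def)
    have "rt v = rt ?p \<or> rt v = rt x" using True cls by auto
    then have "is_top ?X v tp"
    proof
      assume "rt v = rt ?p"
      then have "is_top X v tp" using D(8)[OF v] by (simp add: tp_def)
      then show ?thesis using tpx by (auto simp: is_top_def)
    next
      assume "rt v = rt x"
      then have vx: "is_top X v x" using D(8)[OF v] tx by simp
      have "x \<in> subtree ?p" using subtree_child[OF x(1)] subtree_self[OF p(1)] by auto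
      then have "v \<in> subtree tp"
        using vx tpt subtree_trans unfolding is_top_def by blast
      moreover have "tp \<in> subtree y" if y: "y \<notin> ?X" "v \<in> subtree y" for y
      proof -
        have "x \<in> subtree y" "x \<noteq> y" using vx y by (auto simp: is_top_def)
        then have "?p \<in> subtree y" using subtree_parent by auto
        then show ?thesis using tpt y by (auto simp: is_top_def)
      qed
      ultimately show ?thesis using tpx tpt by (auto simp: is_top_def)
    qed
    then show ?thesis using e by simp
  next
    case False
    then have "rt v \<noteq> rt x" using cls by auto
    then have "tip (rt v) \<noteq> x" using D(10)[OF v x(1)] tx by auto
    then show ?thesis using False D(8)[OF v] by (auto simp: is_top_def)
  qed
  have size: "2 ^ rank' (?rt v) \<le> card {w \<in> R. ?rt w = ?rt v}" if v: "v \<in> R" for v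
  proof (cases "rt v = lo \<or> rt v = hi")
    case True
    then have e: "?rt v = hi" by auto
    have "{w \<in> R. ?rt w = ?rt v} = {w \<in> R. rt w = lo} \<union> {w \<in> R. rt w = hi}"
      using e by auto
    moreover have "{w \<in> R. rt w = lo} \<inter> {w \<in> R. rt w = hi} = {}" using lh by auto
    ultimately have c: "card {w \<in> R. ?rt w = ?rt v} = card {w \<in> R. rt w = lo} + card {w \<in> R. rt w = hi}"
      using fin by (simp add: card_Un_disjoint)
    have "2 ^ rank lo \<le> card {w \<in> R. rt w = lo}" "2 ^ rank hi \<le> card {w \<in> R. rt w = hi}"
      using D(9)[OF lh(4)] D(9)[OF lh(5)] lh by auto
    then show ?thesis using c e rank' by auto
  next
    case False
    then have "{w \<in> R. ?rt w = ?rt v} = {w \<in> R. rt w = rt v}" by auto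
    then show ?thesis using D(9)[OF v] False rank' by auto
  qed
  show ?thesis
    unfolding union_find_def
  proof (intro conjI ballI impI)
    fix v assume v: "v \<in> R"
    show "?rt v \<in> R" "?up v \<in> R" "?rt (?rt v) = ?rt v" using D(1,2,3)[OF v] lh by auto
    show "?rt (?up v) = ?rt v" using D(4)[OF v] lh by auto
    show "(?up v = v) = (?rt v = v)" using D(3,5)[OF v] lh D(5)[OF lh(4)] by auto
    show "rank' v < rank' (?up v)" if "?up v \<noteq> v"
    proof (cases "v = lo")
      case False
      then have u: "up v \<noteq> v" "?up v = up v" using that by auto
      then have "v \<noteq> hi" using D(5)[OF v] lh by auto
      then show ?thesis using D(6)[OF v u(1)] u(2) rank' by auto
    qed (use rank' lohi(2) lh in auto)
    show "rank' v \<le> rank' (?rt v)"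
      using D(7)[OF v] rank' lohi(2) lh by auto
    show "is_top ?X v (?tip (?rt v))" by (rule tip[OF v])
    show "2 ^ rank' (?rt v) \<le> card {w \<in> R. ?rt w = ?rt v}" by (rule size[OF v])
    fix w assume w: "w \<in> R" "?tip (?rt v) = ?tip (?rt w)"
    have tp: "rt u = lo \<or> rt u = hi" if "u \<in> R" "tip (rt u) = tp" for u
      using D(10)[OF that(1) p(1)] that(2) cls by (auto simp: tp_def)
    show "?rt v = ?rt w"
      using w D(10)[OF v w(1)] tp[OF v] tp[OF w(1)] by (auto simp: tp_def split: if_splits)
  qed
qed

end

section \<open>Optimality of the values that the sweep assigns\<close>

locale replacement_sweep = shortest_path_tree +
  fixes K :: "nat set" and a b :: "nat \<Rightarrow> 'a"
  assumes finite_R: "finite R"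
    and cand_edge: "\<And>k. k \<in> K \<Longrightarrow> {a k, b k} \<in> E \<and> a k \<in> R \<and> par (a k) \<noteq> b k \<and> par (b k) \<noteq> a k"
    and edge_cand: "\<And>x y. {x, y} \<in> E \<Longrightarrow> x \<in> R \<Longrightarrow> par x \<noteq> y \<Longrightarrow> par y \<noteq> x \<Longrightarrow> \<exists>k\<in>K. {a k, b k} = {x, y}"
begin

definition weight :: "nat \<Rightarrow> real" where
  "weight k = D (a k) + l {a k, b k} + D (b k)"

definition assigned :: "'a set \<Rightarrow> ('a \<Rightarrow> ereal) \<Rightarrow> bool" where
  "assigned X f \<longleftrightarrow> X \<subseteq> R - {t} \<and> (\<forall>v\<in>R - X. f v = \<infinity>) \<and>
     (\<forall>v\<in>X. \<exists>k\<in>K. crosses v (a k) (b k) \<and> f v = ereal (weight k) - ereal (D v) \<and>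
        (\<forall>j\<in>K. crosses v (a j) (b j) \<longrightarrow> weight k \<le> weight j))"

text \<open>
  While edge \<open>c\<close> is processed, \<open>x\<close> and \<open>y\<close> are the vertices that its two climbs have reached; \<open>x = y\<close>
  means that no edge is being processed. \<open>Q\<close> contains the edges that are still to come.
\<close>

definition climbing :: "'a set \<Rightarrow> nat set \<Rightarrow> 'a \<Rightarrow> 'a \<Rightarrow> ereal \<Rightarrow> nat \<Rightarrow> 'a \<Rightarrow> 'a \<Rightarrow> bool" where
  "climbing X Q x y w c p q \<longleftrightarrow> c \<in> K - Q \<and> (\<forall>v. crosses v p q = crosses v (a c) (b c)) \<and>
     is_top X p x \<and> is_top X q y \<and> w = ereal (weight c) \<and> (\<forall>j\<in>Q. weight c \<le> weight j) \<and>
     (\<forall>k\<in>K - Q. k \<noteq> c \<longrightarrow> (\<forall>v. crosses v (a k) (b k) \<longrightarrow> v \<in> X))"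

definition sweep :: "'a set \<Rightarrow> ('a \<Rightarrow> ereal) \<Rightarrow> nat set \<Rightarrow> 'a \<Rightarrow> 'a \<Rightarrow> ereal \<Rightarrow> bool" where
  "sweep X f Q x y w \<longleftrightarrow> assigned X f \<and> Q \<subseteq> K \<and>
     (if x = y then \<forall>k\<in>K - Q. \<forall>v. crosses v (a k) (b k) \<longrightarrow> v \<in> X
      else \<exists>c p q. climbing X Q x y w c p q)"

lemma sweep_init: "(\<And>v. v \<in> R \<Longrightarrow> f v = \<infinity>) \<Longrightarrow> sweep {} f K x x w"
  by (auto simp: sweep_def assigned_def)

lemma sweep_pop:
  assumes "sweep X f Q x x w" "c \<in> Q" "\<And>j. j \<in> Q \<Longrightarrow> weight c \<le> weight j"
    "is_top X (a c) y" "is_top X (b c) z"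
  shows "sweep X f (Q - {c}) y z (ereal (weight c))"
proof -
  have o: "assigned X f" "Q \<subseteq> K" and d: "\<And>k v. k \<in> K - Q \<Longrightarrow> crosses v (a k) (b k) \<Longrightarrow> v \<in> X"
    using assms(1) by (auto simp: sweep_def)
  show ?thesis
  proof (cases "y = z")
    case True
    \<comment> \<open>Both ends already share a top, so the edge is finished without any
      climb.\<close>
    then have "crosses v (a c) (b c) \<Longrightarrow> v \<in> X" for v
      using same_top_not_crossed assms(4,5) by blast
    then show ?thesis using True o d by (auto simp: sweep_def)
  next
    case False
    have "climbing X (Q - {c}) y z (ereal (weight c)) c (a c) (b c)"
      using assms(2-5) d o unfolding climbing_def by blast
    then show ?thesis
      using False o unfolding sweep_def by auto
  qed
qed

text \<open>\<open>climbing\<close> ties \<open>p\<close> and \<open>q\<close> to the ends of edge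
  \<open>c\<close> only through what they cross, so the two climbs may be exchanged while
  \<open>a c\<close> and \<open>b c\<close> stay.\<close>

lemma sweep_commute: "sweep X f Q x y w \<Longrightarrow> sweep X f Q y x w"
proof -
  have "climbing X Q x y w c p q \<Longrightarrow> climbing X Q y x w c q p" for c p q
    unfolding climbing_def using crosses_commute by blast
  then show "sweep X f Q x y w \<Longrightarrow> sweep X f Q y x w"
    unfolding sweep_def by (metis (no_types, lifting))
qed

text \<open>Edges processed before do not cross \<open>x\<close>, which has no value, and those
  still to come are no cheaper. So the current edge is a cheapest one across the subtree of
  \<open>x\<close>, and the value given to \<open>x\<close> is final.\<close>

lemma sweep_climb:
  assumes s: "sweep X f Q x y w" and xy: "x \<noteq> y" "ord y \<le> ord x"
    and z: "is_top (insert x X) (par x) z"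
  shows "sweep (insert x X) (f(x := w - ereal (D x))) Q z y w" "x \<in> R" "x \<notin> X" "x \<noteq> t"
proof -
  obtain c p q where cl: "climbing X Q x y w c p q"
    using s xy(1) unfolding sweep_def by auto
  then have c: "c \<in> K - Q" and cr: "\<And>v. crosses v p q = crosses v (a c) (b c)"
    and tops: "is_top X p x" "is_top X q y" and w: "w = ereal (weight c)" "\<And>j. j \<in> Q \<Longrightarrow> weight c \<le> weight j"
    and processed: "\<And>k v. k \<in> K - Q \<Longrightarrow> k \<noteq> c \<Longrightarrow> crosses v (a k) (b k) \<Longrightarrow> v \<in> X"
    unfolding climbing_def by blast+
  note x = later_top_crossed[OF tops xy]
  show xX: "x \<notin> X" and xR: "x \<in> R" using tops(1) subtree_root_R by (auto simp: is_top_def)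
  show "x \<noteq> t" by (fact x(2))
  have as: "assigned X f" "Q \<subseteq> K" using s by (auto simp: sweep_def)
  have "weight c \<le> weight j" if "j \<in> K" "crosses x (a j) (b j)" for j
    using processed[of j x] that xX w(2)[of j] by (cases "j \<in> Q") auto
  then have "assigned (insert x X) (f(x := w - ereal (D x)))"
    using as(1) xX xR x c cr w(1) unfolding assigned_def by auto
  \<comment> \<open>\<open>x\<close> was the top of \<open>p\<close>; once \<open>x\<close> has a
    value, the search for the next vertex without one continues at \<open>par x\<close>.\<close>
  moreover have p: "is_top (insert x X) p z"
  proof -
    have "x \<in> subtree z"
      using z subtree_child[OF xR] by (auto simp: is_top_def)
    then have "p \<in> subtree z" using tops(1) subtree_trans by (auto simp: is_top_def)
    moreover have "z \<in> subtree v" if v: "v \<notin> insert x X" "p \<in> subtree v" for v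
    proof -
      have "x \<in> subtree v" using tops(1) v by (auto simp: is_top_def)
      then have "par x \<in> subtree v" using subtree_parent v by auto
      then show ?thesis using z v by (auto simp: is_top_def)
    qed
    ultimately show ?thesis using z by (auto simp: is_top_def)
  qed
  moreover have q: "is_top (insert x X) q y" using tops(2) xy(1) by (auto simp: is_top_def)
  moreover have "v \<in> insert x X" if "z = y" "crosses v (a c) (b c)" for v
    using same_top_not_crossed[OF p q[folded that(1)]] that cr by auto
  then have "if z = y then \<forall>k\<in>K - Q. \<forall>v. crosses v (a k) (b k) \<longrightarrow> v \<in> insert x X
      else climbing (insert x X) Q z y w c p q"
    using c cr w processed p q unfolding climbing_def by (auto simp del: Diff_iff) blast+
  ultimately show "sweep (insert x X) (f(x := w - ereal (D x))) Q z y w"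
    using as(2) unfolding sweep_def by (auto split: if_splits)
qed

lemma sweep_final:
  assumes "sweep X f {} x x w" "{u, v} \<in> E" "u \<in> R" "par u = v"
  shows "dist_without {u, v} u = f u"
proof -
  have as: "assigned X f" and d: "\<And>k v. k \<in> K \<Longrightarrow> crosses v (a k) (b k) \<Longrightarrow> v \<in> X"
    using assms(1) by (auto simp: sweep_def)
  have ut: "u \<noteq> t"
    using simple_graph_edgeD[OF graph assms(2)] assms(4) root(1) by auto
  \<comment> \<open>The only tree edge that leaves the subtree of \<open>u\<close> is the one to
    \<open>par u\<close>, so any other edge that leaves it is indexed by \<open>K\<close>.\<close>
  have cand: "\<exists>k\<in>K. crosses u (a k) (b k) \<and> weight k = D x + l {x, y} + D y"
    if xy: "{x, y} \<in> E" "x \<in> subtree u" "y \<notin> subtree u" "{x, y} \<noteq> {u, par u}" for x y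
  proof -
    have xR: "x \<in> R" "y \<in> R" using subtree_R[OF xy(2)] closed xy(1) by auto
    have "par x \<noteq> y" using subtree_parent[OF xy(2)] xy(3,4) by auto
    moreover have "par y \<noteq> x" using subtree_child[OF xR(2), of u] xy by auto
    ultimately obtain k where k: "k \<in> K" "{a k, b k} = {x, y}" using edge_cand xy(1) xR by blast
    have "a k = x \<and> b k = y \<or> a k = y \<and> b k = x" using k(2) by (auto simp: doubleton_eq_iff)
    then show ?thesis using k xy by (auto simp: crosses_def weight_def insert_commute)
  qed
  have upper: "dist_without {u, par u} u \<le> ereal (weight k) - ereal (D u)"
    if k: "k \<in> K" "crosses u (a k) (b k)" for k
  proof -
    note ce = cand_edge[OF k(1)]
    have ne: "{a k, b k} \<noteq> {u, par u}" using ce by (auto simp: doubleton_eq_iff)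
    consider "a k \<in> subtree u" "b k \<notin> subtree u" | "b k \<in> subtree u" "a k \<notin> subtree u"
      using k(2) by (auto simp: crosses_def)
    then show ?thesis
    proof cases
      case 1
      then show ?thesis using replacement_upper[of "a k" "b k" u] ce ne ut by (auto simp: weight_def)
    next
      case 2
      then show ?thesis using replacement_upper[of "b k" "a k" u] ce ne ut
        by (auto simp: weight_def insert_commute add_ac)
    qed
  qed
  show ?thesis
  proof (cases "u \<in> X")
    case True
    then obtain k where k: "k \<in> K" "crosses u (a k) (b k)" "f u = ereal (weight k) - ereal (D u)"
      and min: "\<And>j. j \<in> K \<Longrightarrow> crosses u (a j) (b j) \<Longrightarrow> weight k \<le> weight j"
      using as by (auto simp: assigned_def)
    have "ereal (weight k) - ereal (D u) \<le> dist_without {u, par u} u"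
      using cand min by (intro replacement_lower[OF assms(3) ut]) (metis ereal_less_eq(3))
    then show ?thesis using upper[OF k(1,2)] k(3) assms(4) by auto
  next
    case False
    \<comment> \<open>No candidate crosses the subtree of \<open>u\<close>: the edge is a bridge,
      the hypothesis of \<open>replacement_lower\<close> on \<open>w\<close> is vacuous, and
      \<open>w = \<infinity>\<close> is allowed.\<close>
    have "\<infinity> - ereal (D u) \<le> dist_without {u, par u} u"
      using cand d False by (intro replacement_lower[OF assms(3) ut]) blast
    then show ?thesis using False as assms(3,4) by (auto simp: assigned_def)
  qed
qed

end

section \<open>The program\<close>

text \<open>
  Vertices and edges are numbered from 1, and 0 stands for none. Word variables 0, 2, 3 hold \<open>n\<close>, \<open>t\<close>
  and \<open>m\<close>, and variables 4 to 9 the constants 0, 1, 2, \<open>n + 1\<close>, \<open>m + 1\<close> and \<open>2 * m\<close>. The word arrays are: 0 parent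
  (the root is its own parent), 1 tournament of the edges, 2 and 3 head and links of the arc lists, 4 order
  of settling in Dijkstra's algorithm, 5 and 6 union-find pointers and ranks, 7 top of a class,
  8 tournament of the vertices. The length arrays are: 0 distance, 2 replacement value, 3 key of a non-tree edge.
\<close>

locale instance_run = graph_arcs n m r E l e + machine M L B
  for n m r E l e M L B +
  fixes H :: nat
  assumes H: "2 * (n + 1) \<le> 2 ^ H" "2 * (m + 1) \<le> 2 ^ H"
    and sizes: "2 * m \<le> M" "2 * n + 2 * m + 2 \<le> L" "8 * n + 8 * m + 8 \<le> B"
begin

text \<open>Array 9 keeps the raw input with vertices counted from 0, hence the \<open>Suc\<close>.
  Only the first \<open>m\<close> length cells are fixed, because the output is later stored behind
  them.\<close>

definition constants :: "store \<Rightarrow> bool" where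
  "constants s \<longleftrightarrow> wvar s 0 = n \<and> wvar s 2 = r \<and> wvar s 3 = m \<and> wvar s 4 = 0 \<and> wvar s 5 = 1 \<and> wvar s 6 = 2 \<and>
     wvar s 7 = n + 1 \<and> wvar s 8 = m + 1 \<and> wvar s 9 = 2 * m \<and>
     (\<forall>j<2 * m. Suc (warr s 9 j) = e j) \<and> (\<forall>i<m. larr s 9 i = ereal (l {e (2 * i), e (2 * i + 1)}))"

definition initial :: "store \<Rightarrow> bool" where
  "initial s \<longleftrightarrow> wvar s 0 = n \<and> Suc (wvar s 2) = r \<and> wvar s 3 = m \<and>
     (\<forall>j<2 * m. Suc (warr s 9 j) = e j) \<and> (\<forall>i<m. larr s 9 i = ereal (l {e (2 * i), e (2 * i + 1)})) \<and>
     (\<forall>j<9. warr s j = (\<lambda>_. 0) \<and> larr s j = (\<lambda>_. 0))"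

definition adjacency :: "store \<Rightarrow> bool" where
  "adjacency s \<longleftrightarrow> (\<forall>v. last_arc v (2 * m) (warr s 2 v)) \<and> (\<forall>k<2 * m. last_arc (e k) k (warr s 3 k))"

end

text \<open>Arcs are put in front of the lists by increasing index, which yields the decreasing
  order behind \<open>last_arc\<close>; blank memory already contains empty lists.\<close>

definition link_arcs :: cmd where
  "link_arcs =
     Act (Const 4 0) ;; Act (Const 5 1) ;; Act (Const 6 2) ;;
     Act (Arith Plus 7 0 5) ;; Act (Arith Plus 8 3 5) ;; Act (Arith Plus 9 3 3) ;; Act (Arith Plus 2 2 5) ;;
     Act (Const 10 0) ;;
     Loop (LessT 10 9)
      (Act (Get 13 9 10) ;; Act (Arith Plus 13 13 5) ;; Act (Get 14 2 13) ;; Act (Put 3 10 14) ;;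
       Act (Arith Plus 10 10 5) ;; Act (Put 2 13 10))"

context instance_run
begin

lemma wp_link_arcs:
  assumes init: "initial s"
    and Q: "\<And>s'. \<lbrakk>constants s'; adjacency s'; \<forall>j\<in>{0, 1, 4, 5, 6, 7, 8}. warr s' j = (\<lambda>_. 0);
      \<forall>j<9. larr s' j = (\<lambda>_. 0); clock s' \<le> clock s + 14 * m + 9\<rbrakk> \<Longrightarrow> Q s'"
  shows "wp link_arcs Q s"
proof -
  define I where "I s' \<longleftrightarrow> constants s' \<and> wvar s' 10 \<le> 2 * m \<and>
    (\<forall>v. last_arc v (wvar s' 10) (warr s' 2 v)) \<and> (\<forall>k<wvar s' 10. last_arc (e k) k (warr s' 3 k)) \<and>
    (\<forall>j\<in>{0, 1, 4, 5, 6, 7, 8}. warr s' j = (\<lambda>_. 0)) \<and> (\<forall>j<9. larr s' j = (\<lambda>_. 0))" for s' :: store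
  have loop: "wp (Loop (LessT 10 9)
      (Act (Get 13 9 10) ;; Act (Arith Plus 13 13 5) ;; Act (Get 14 2 13) ;; Act (Put 3 10 14) ;;
       Act (Arith Plus 10 10 5) ;; Act (Put 2 13 10))) Q s0"
    if "I s0" "wvar s0 10 = 0" "clock s0 = clock s + 8" for s0
    using that(1)
  proof (rule wp_Loop_timed[where I = I and \<mu> = "\<lambda>s. 2 * m - wvar s 10" and k = 7])
    fix s' assume I: "I s'" and b: "holds (LessT 10 9) s'"
    define j where "j = wvar s' 10"
    have w: "wvar s' 10 = j" by (simp add: j_def)
    have c: "constants s'" using I by (simp add: I_def)
    note cc = c[unfolded constants_def]
    have j: "j < 2 * m" using b cc by (simp add: w)
    have h: "\<And>v. last_arc v j (warr s' 2 v)" "\<And>k. k < j \<Longrightarrow> last_arc (e k) k (warr s' 3 k)"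
      "\<forall>j\<in>{0, 1, 4, 5, 6, 7, 8}. warr s' j = (\<lambda>_. 0)" "\<forall>j<9. larr s' j = (\<lambda>_. 0)"
      using I by (auto simp: I_def w)
    have ej: "Suc (warr s' 9 j) = e j" "1 \<le> e j" "e j \<le> n" using cc j e_bounds by auto
    have la: "last_arc v (Suc j) (if v = e j then Suc j else warr s' 2 v)" for v
      using last_arc_Suc[OF h(1), of v] by auto
    have lk: "k < Suc j \<Longrightarrow> last_arc (e k) k (if k = j then warr s' 2 (e j) else warr s' 3 k)" for k
      using h(1)[of "e j"] h(2)[of k] by auto
    show "wp (Act (Get 13 9 10) ;; Act (Arith Plus 13 13 5) ;; Act (Get 14 2 13) ;; Act (Put 3 10 14) ;;
       Act (Arith Plus 10 10 5) ;; Act (Put 2 13 10)) (\<lambda>t. I t \<and> 2 * m - wvar t 10 < 2 * m - wvar s' 10 \<and> clock t \<le> clock s' + 7) (tick s')"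
      using j h(3,4) ej la lk sizes by (auto simp: wp_simps w cc cell_ok_def I_def constants_def)
  next
    fix s' assume I: "I s'" and b: "\<not> holds (LessT 10 9) s'" and k: "clock s' \<le> clock s0 + 7 * (2 * m - wvar s0 10)"
    then have "wvar s' 10 = 2 * m" by (auto simp: I_def constants_def)
    then show "Q (tick s')"
      using I k that(2,3) by (intro Q) (auto simp: I_def constants_def adjacency_def)
  qed
  have "last_arc v 0 0" for v by (simp add: last_arc_def)
  then show ?thesis
    unfolding link_arcs_def using root sizes
    by (auto simp: wp_simps init[unfolded initial_def] I_def constants_def intro!: loop)
qed

end

section \<open>Dijkstra's algorithm as a program\<close>

definition fetch_arc :: cmd where
  "fetch_arc =
     Act (Arith Minus 14 11 5) ;; Act (Arith Divide 15 14 6) ;;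
     Act (Arith Plus 16 15 15) ;; Act (Arith Plus 16 16 16) ;; Act (Arith Plus 16 16 5) ;;
     Act (Arith Minus 16 16 14) ;; Act (Get 16 9 16) ;; Act (Arith Plus 16 16 5) ;;
     Act (Get 11 3 14) ;; Act (Get 17 4 16)"

text \<open>The leaf of the target in the queue contains the target or 0, and reading the distance
  at that number gives the tentative distance or the sentinel infinity at index 0. So an
  undiscovered vertex compares as infinite although its distance cell was never initialised.\<close>

definition relax_arc :: cmd where
  "relax_arc =
     Act (LGet 3 0 10) ;; Act (LGet 4 9 15) ;; Act (LAdd 3 3 4) ;;
     Act (Arith Plus 17 7 16) ;; Act (Get 17 8 17) ;; Act (LGet 4 0 17) ;;
     Cond (LLessT 3 4)
      (Act (LPut 0 16 3) ;; Act (Put 0 16 10) ;; update_tournament 8 0 7 16 16)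
      Nop"

definition scan_arc :: cmd where
  "scan_arc = fetch_arc ;; Cond (LessT 4 17) Nop relax_arc"

text \<open>Union-find pointer, top and replacement value of a vertex get their initial values here,
  so the cost falls on reached vertices only; ranks start as blank memory. Clearing variable 12 ends
  the main loop.\<close>

definition settle_next :: cmd where
  "settle_next =
     Act (Get 10 8 5) ;;
     Cond (LessT 4 10)
      (update_tournament 8 0 7 10 4 ;; Act (Arith Plus 13 13 5) ;; Act (Put 4 10 13) ;;
       Act (Put 5 10 10) ;; Act (Put 7 10 10) ;; Act (LPut 2 10 2) ;; Act (Get 11 2 10))
      (Act (Copy 12 4))"

definition dijkstra_prog :: cmd where
  "dijkstra_prog =
     Act (LInf 2) ;; Act (LPut 0 4 2) ;; Act (LZero 3) ;; Act (LPut 0 2 3) ;; Act (Put 0 2 2) ;;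
     update_tournament 8 0 7 2 2 ;;
     Act (Const 10 0) ;; Act (Const 11 0) ;; Act (Const 12 1) ;; Act (Const 13 0) ;;
     Loop (LessT 4 12) (Cond (LessT 4 11) scan_arc settle_next)"

definition queue :: "nat \<Rightarrow> (nat \<Rightarrow> nat) \<Rightarrow> nat set" where
  "queue N W = {x. 0 < x \<and> x < N \<and> W (N + x) = x}"

lemma queue_remove:
  assumes "\<And>y. y < N \<Longrightarrow> W' (N + y) = (if y = x then 0 else W (N + y))" "x < N"
  shows "queue N W' = queue N W - {x}"
  using assms by (auto simp: queue_def split: if_splits)

lemma queue_insert:
  assumes "\<And>y. y < N \<Longrightarrow> W' (N + y) = (if y = x then x else W (N + y))" "0 < x" "x < N"
  shows "queue N W' = insert x (queue N W)"
  using assms by (auto simp: queue_def)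

lemma leaf_value:
  assumes "tournament N W \<kappa>" "x < N"
  shows "W (N + x) = (if x \<in> queue N W then x else 0)"
  using assms by (auto simp: queue_def tournament_def placed_def)

text \<open>Item 0 has key infinity and queued items do not, so an empty cell wins only if nothing
  is queued.\<close>

lemma tournament_root:
  assumes "tournament N W \<kappa>" "\<kappa> 0 = \<infinity>" "\<And>x. x \<in> queue N W \<Longrightarrow> \<kappa> x \<noteq> \<infinity>" "0 < N"
  shows "W 1 < N" "W 1 = 0 \<longleftrightarrow> queue N W = {}"
    "W 1 \<noteq> 0 \<Longrightarrow> W 1 \<in> queue N W" "\<And>x. x \<in> queue N W \<Longrightarrow> \<kappa> (W 1) \<le> \<kappa> x"
proof -
  show "W 1 < N" using assms(1,4) by (auto simp: tournament_def placed_def)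
  show min: "\<kappa> (W 1) \<le> \<kappa> x" if "x \<in> queue N W" for x
    using tournament_min[OF assms(1), of "N + x"] that by (auto simp: queue_def)
  show mem: "W 1 \<in> queue N W" if "W 1 \<noteq> 0"
    using tournament_leaf[OF assms(1), of 1] that assms(4) by (auto simp: queue_def)
  show "W 1 = 0 \<longleftrightarrow> queue N W = {}"
    using mem min assms(2,3) by (metis empty_iff equals0I ereal_infty_less_eq(1) gr0I queue_def mem_Collect_eq)
qed

context instance_run
begin

abbreviation endpoints :: "nat set" where
  "endpoints \<equiv> insert r (e ` {..<2 * m})"

definition rest :: "(nat \<Rightarrow> nat) \<Rightarrow> nat set" where
  "rest ord = {x \<in> endpoints. ord x = 0}"

definition unscanned :: "(nat \<Rightarrow> nat) \<Rightarrow> nat \<Rightarrow> nat \<Rightarrow> nat set" where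
  "unscanned ord c a = {j. j < 2 * m \<and> (ord (e j) = 0 \<or> e j = c \<and> j < a)}"

lemma finite_rest: "finite (rest ord)" and finite_unscanned: "finite (unscanned ord c a)"
  by (auto simp: rest_def unscanned_def)

lemma card_endpoints: "card endpoints \<le> 2 * m + 1"
  using card_insert_le_m1[of "2 * m + 1" "e ` {..<2 * m}" r] card_image_le[of "{..<2 * m}" e] by simp

lemma card_rest: "card (rest ord) \<le> 2 * m + 1"
proof -
  have "card (rest ord) \<le> card endpoints" by (intro card_mono) (auto simp: rest_def)
  then show ?thesis using card_endpoints by linarith
qed

lemma card_unscanned: "card (unscanned ord c a) \<le> 2 * m"
  using card_mono[of "{..<2 * m}" "unscanned ord c a"] by (auto simp: unscanned_def)

text \<open>Besides the invariant of the algorithm, the data written at settling is recorded for the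
  later phases. The last conjunct keeps the counter in variable 13 small enough for a word.\<close>

definition dijkstra_inv :: "store \<Rightarrow> bool" where
  "dijkstra_inv s \<longleftrightarrow> constants s \<and> adjacency s \<and>
     dijkstra (warr s 0) (larr s 0) (warr s 4) (queue (n + 1) (warr s 8)) (wvar s 10) (wvar s 13) (wvar s 11) \<and>
     tournament (n + 1) (warr s 8) (larr s 0) \<and> larr s 0 0 = \<infinity> \<and> lvar s 2 = \<infinity> \<and>
     warr s 1 = (\<lambda>_. 0) \<and> warr s 6 = (\<lambda>_. 0) \<and>
     (\<forall>x. warr s 4 x \<noteq> 0 \<longrightarrow> warr s 5 x = x \<and> warr s 7 x = x \<and> larr s 2 x = \<infinity>) \<and>
     (wvar s 12 = 0 \<longrightarrow> wvar s 11 = 0 \<and> queue (n + 1) (warr s 8) = {}) \<and> wvar s 12 \<le> 1 \<and>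
     wvar s 13 + card (rest (warr s 4)) \<le> 2 * m + 1"

text \<open>Each round scans an arc, settles a vertex or clears the flag in variable 12. Only the
  root and the endpoints of arcs are counted, which gives at most \<open>4 * m + 2\<close> rounds
  for any \<open>n\<close>.\<close>

definition dijkstra_measure :: "store \<Rightarrow> nat" where
  "dijkstra_measure s = card (rest (warr s 4)) + card (unscanned (warr s 4) (wvar s 10) (wvar s 11)) + wvar s 12"

lemma arc_length:
  assumes "j < 2 * m" "constants s"
  shows "larr s 9 (j div 2) = ereal (l {e j, e (opp j)})" "Suc (warr s 9 (opp j)) = e (opp j)"
proof -
  have "{e j, e (opp j)} = {e (2 * (j div 2)), e (2 * (j div 2) + 1)}"
    by (rule opp_cases[of j]) (auto simp: insert_commute)
  then show "larr s 9 (j div 2) = ereal (l {e j, e (opp j)})"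
    using assms by (auto simp: constants_def)
  show "Suc (warr s 9 (opp j)) = e (opp j)"
    using assms by (auto simp: constants_def)
qed

lemma unscanned_scan:
  assumes "last_arc (e j) j b" "j < 2 * m"
  shows "card (unscanned ord (e j) b) < card (unscanned ord (e j) (Suc j)) \<or> ord (e j) = 0"
proof (cases "ord (e j) = 0")
  case False
  have "j \<in> unscanned ord (e j) (Suc j) - unscanned ord (e j) b"
    using assms False by (auto simp: unscanned_def last_arc_def)
  moreover have "unscanned ord (e j) b \<subseteq> unscanned ord (e j) (Suc j)"
    using assms by (auto simp: unscanned_def last_arc_def)
  ultimately have "unscanned ord (e j) b \<subset> unscanned ord (e j) (Suc j)" by blast
  then show ?thesis using psubset_card_mono[OF finite_unscanned] by blast
qed simp

lemma dijkstra_inv_clock: "dijkstra_inv (s\<lparr>clock := k\<rparr>) = dijkstra_inv s"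
  by (simp add: dijkstra_inv_def constants_def adjacency_def)

lemma dijkstra_measure_clock: "dijkstra_measure (s\<lparr>clock := k\<rparr>) = dijkstra_measure s"
  by (simp add: dijkstra_measure_def)

lemma wp_fetch_arc:
  assumes "constants s" "wvar s 11 = Suc j" "j < 2 * m"
    and Q: "\<And>k. k = clock s + 10 \<Longrightarrow> Q (s\<lparr>wvar := (wvar s)(14 := j, 16 := e (opp j), 15 := j div 2, 11 := warr s 3 j,
    17 := warr s 4 (e (opp j))), clock := k\<rparr>)"
  shows "wp fetch_arc Q s"
proof -
  note cc = assms(1)[unfolded constants_def]
  have o: "Suc (j div 2 + j div 2 + (j div 2 + j div 2)) - j = opp j" by (simp add: opp_def)
  have oj: "opp j < 2 * m" "j div 2 < m" using assms(3) by auto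
  have raw: "Suc (warr s 9 (opp j)) = e (opp j)" using arc_length[OF assms(3,1)] by simp
  have eo: "e (opp j) \<le> n" using e_bounds[OF oj(1)] by simp
  have sz: "j \<le> B" "j < 9 * M" "j < L" "j div 2 \<le> B" "opp j \<le> B" "opp j < 9 * M" "e (opp j) \<le> B" "e (opp j) < L"
      "Suc (j div 2 + j div 2 + (j div 2 + j div 2)) \<le> B" "j div 2 + j div 2 + (j div 2 + j div 2) \<le> B"
      "j div 2 + j div 2 \<le> B"
    using sizes oj assms(3) eo by linarith+
  show ?thesis
    unfolding fetch_arc_def
    by (simp add: wp_simps cc assms(2) cell_ok_def o raw sz fun_upd_twist) (rule Q, simp)
qed

lemma wp_relax_arc:
  assumes "constants s" "j < 2 * m" "wvar s 15 = j div 2" "wvar s 16 = w" "w = e (opp j)" "wvar s 10 = e j"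
    and d: "d = larr s 0 (e j) + ereal (l {e j, w})" and leaf: "warr s 8 (Suc (n + w)) = y" "y < L"
    and less: "\<And>k. \<lbrakk>k = clock s + 9; d < larr s 0 y\<rbrakk> \<Longrightarrow> wp (update_tournament 8 0 7 16 16) Q
      (s\<lparr>wvar := (wvar s)(17 := y), lvar := (lvar s)(3 := d, 4 := larr s 0 y),
         larr := (larr s)(0 := (larr s 0)(w := d)), warr := (warr s)(0 := (warr s 0)(w := e j)), clock := k\<rparr>)"
    and not_less: "\<And>k. \<lbrakk>k = clock s + 7; \<not> d < larr s 0 y\<rbrakk> \<Longrightarrow>
      Q (s\<lparr>wvar := (wvar s)(17 := y), lvar := (lvar s)(3 := d, 4 := larr s 0 y), clock := k\<rparr>)"
  shows "wp relax_arc Q s"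
proof -
  note cc = assms(1)[unfolded constants_def]
  have len: "larr s 9 (j div 2) = ereal (l {e j, w})" using arc_length[OF assms(2,1)] assms(5) by simp
  have "w \<le> n" "e j \<le> n" using e_bounds[of "opp j"] e_bounds[of j] assms(2,5) by auto
  then have sz: "w \<le> B" "w < L" "e j < L" "Suc (n + w) \<le> B" "Suc (n + w) < L" "j div 2 < 9 * M"
    using sizes assms(2) by linarith+
  show ?thesis
    unfolding relax_arc_def
    by (simp add: wp_simps cc assms(3,4,6) len cell_ok_def sz fun_upd_twist d[symmetric] leaf)
      (auto intro: less not_less)
qed

lemma wp_scan_arc:
  assumes inv: "dijkstra_inv s" and a: "wvar s 11 \<noteq> 0" and go: "wvar s 12 \<noteq> 0"
  shows "wp scan_arc (\<lambda>s'. dijkstra_inv s' \<and> dijkstra_measure s' < dijkstra_measure s \<and>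
    clock s' \<le> clock s + 10 * H + 23) s"
proof -
  have c: "constants s" and adj: "adjacency s" using inv by (auto simp: dijkstra_inv_def)
  note ii = inv[unfolded dijkstra_inv_def adjacency_def]
  note cc = c[unfolded constants_def]
  obtain j where j: "wvar s 11 = Suc j" using a by (cases "wvar s 11") auto
  define P where "P = warr s 0"
  define D where "D = larr s 0"
  define ord where "ord = warr s 4"
  define W where "W = warr s 8"
  define Q where "Q = queue (n + 1) W"
  define cu where "cu = wvar s 10"
  define k where "k = wvar s 13"
  note arrays = P_def[symmetric] D_def[symmetric] ord_def[symmetric] W_def[symmetric] cu_def[symmetric] k_def[symmetric]
  have dj: "dijkstra P D ord Q cu k (Suc j)"
    using inv j by (simp add: dijkstra_inv_def P_def D_def ord_def Q_def W_def cu_def k_def)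
  note djD = dijkstraD[OF dj]
  have cu: "cu = e j" "ord cu \<noteq> 0" "j < 2 * m" using djD(10,11) by auto
  define w where "w = e (opp j)"
  define b where "b = warr s 3 j"
  have la: "last_arc (e j) j b" using adj cu(3) by (auto simp: adjacency_def b_def)
  have wb: "1 \<le> w" "w \<le> n" "w \<noteq> cu" "1 \<le> cu" "cu \<le> n"
    using edge_bounds[OF arc_edge[OF cu(3)]] cu by (auto simp: w_def)
  have t: "tournament (n + 1) W D" and D0: "D 0 = \<infinity>"
    using inv by (auto simp: dijkstra_inv_def W_def D_def)
  have leaf: "W (Suc (n + w)) = (if w \<in> Q then w else 0)"
    using leaf_value[OF t, of w] wb by (auto simp: Q_def)
  have meas: "card (unscanned ord cu b) < card (unscanned ord cu (Suc j))"
    using unscanned_scan[OF la cu(3), of ord] cu by auto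
  define d where "d = D cu + ereal (l {cu, w})"
  define dw where "dw = (if w \<in> Q then D w else \<infinity>)"
  have d_fin: "d \<noteq> \<infinity>" using djD(1)[of cu] cu(2) by (auto simp: d_def)
  have dw: "D (if w \<in> Q then w else 0) = dw" by (simp add: dw_def D0)
  have leafL: "W (Suc (n + w)) < L" using leaf wb sizes by auto
  have more: "warr s 1 = (\<lambda>_. 0)" "wvar s 12 \<le> 1" "k + card (rest ord) \<le> 2 * m + 1"
    using inv by (auto simp: dijkstra_inv_def k_def ord_def)
  have Qn: "queue (Suc n) W = Q" by (simp add: Q_def)
  let ?G = "\<lambda>s'. dijkstra_inv s' \<and> dijkstra_measure s' < dijkstra_measure s \<and> clock s' \<le> clock s + 10 * H + 23"
  have skip: "?G t" if dj': "dijkstra P D ord Q cu k b"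
    and t: "warr t = warr s" "larr t = larr s" "lvar t 2 = lvar s 2" "\<forall>i<14. i \<noteq> 11 \<longrightarrow> wvar t i = wvar s i"
      "wvar t 11 = b" "clock t \<le> clock s + 20" for t
    using dj' meas t(6) go more \<open>tournament (n + 1) W D\<close>
    by (simp add: dijkstra_inv_def constants_def adjacency_def dijkstra_measure_def ii cc t(1-5) arrays Qn j D0)
  have relax: "?G t" if dj': "dijkstra (P(w := cu)) (D(w := d)) ord (insert w Q) cu k b"
    and t: "warr t = (warr s)(0 := P(w := cu), 8 := W')" "larr t = (larr s)(0 := D(w := d))"
      "lvar t 2 = lvar s 2" "\<forall>i<14. i \<noteq> 11 \<longrightarrow> wvar t i = wvar s i" "wvar t 11 = b" "clock t \<le> clock s + 10 * H + 23"
      "tournament (n + 1) W' (D(w := d))" "\<And>y. y < n + 1 \<Longrightarrow> W' (n + 1 + y) = (if y = w then w else W (n + 1 + y))"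
    for t W'
  proof -
    have "queue (n + 1) W' = insert w Q" unfolding Q_def using t(8) wb by (intro queue_insert) auto
    then have "queue (Suc n) W' = insert w Q" by simp
    then show ?thesis
      using dj' meas t(6,7) go wb more D0
      by (simp add: dijkstra_inv_def constants_def adjacency_def dijkstra_measure_def ii cc t(1-5) arrays j)
  qed
  show ?thesis
    unfolding scan_arc_def wp_Seq
  proof (rule wp_fetch_arc[OF c j cu(3)], unfold w_def[symmetric] b_def[symmetric] ord_def[symmetric])
    fix k1 assume k1: "k1 = clock s + 10"
    let ?s1 = "s\<lparr>wvar := (wvar s)(14 := j, 16 := w, 15 := j div 2, 11 := b, 17 := ord w), clock := k1\<rparr>"
    have c1: "constants (tick ?s1)" by (simp add: constants_def cc)
    show "wp (Cond (LessT 4 17) Nop relax_arc) ?G ?s1"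
    proof (cases "ord w = 0")
      case False
      then have dj': "dijkstra P D ord Q cu k b"
        by (intro dijkstra_skip[OF dj la]) (auto simp: w_def[symmetric])
      have h: "holds (LessT 4 17) ?s1" using False cc by simp
      show ?thesis
        unfolding wp_Cond wp_Nop if_P[OF h] by (rule skip[OF dj']) (use k1 in simp_all)
    next
      case True
      have "wp relax_arc ?G (tick ?s1)"
      proof (rule wp_relax_arc[where j = j and w = w and d = d and y = "if w \<in> Q then w else 0"])
        show "constants (tick ?s1)" by (rule c1)
      next
        fix k2 assume k2: "k2 = clock (tick ?s1) + 9"
          "d < larr (tick ?s1) 0 (if w \<in> Q then w else 0)"
        then have "dijkstra (P(w := cu)) (D(w := d)) ord (insert w Q) cu k b"
          using True by (intro dijkstra_relax[OF dj la]) (auto simp: w_def d_def D_def)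
        note relax = relax[OF this]
        show "wp (update_tournament 8 0 7 16 16) ?G
          (tick ?s1\<lparr>wvar := (wvar (tick ?s1))(17 := if w \<in> Q then w else 0),
             lvar := (lvar (tick ?s1))(3 := d, 4 := larr (tick ?s1) 0 (if w \<in> Q then w else 0)),
             larr := (larr (tick ?s1))(0 := (larr (tick ?s1) 0)(w := d)),
             warr := (warr (tick ?s1))(0 := (warr (tick ?s1) 0)(w := e j)), clock := k2\<rparr>)"
          (is "wp _ _ ?s2")
        proof (rule wp_update_tournament[where N = "n + 1" and \<kappa> = D and x = w and h = H])
          fix s' :: store and W'
          assume *: "\<And>y. y \<notin> {20, 21, 22, 23} \<Longrightarrow> wvar s' y = wvar ?s2 y"
            "\<And>y. y \<notin> {10, 11} \<Longrightarrow> lvar s' y = lvar ?s2 y" "larr s' = larr ?s2"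
            "warr s' = (warr ?s2)(8 := W')" "clock s' \<le> clock ?s2 + 10 * H + 3"
            "tournament (n + 1) W' (larr ?s2 0)"
            "\<And>y. y < n + 1 \<Longrightarrow> W' (n + 1 + y) = (if y = w then wvar ?s2 16 else warr ?s2 8 (n + 1 + y))"
          show "?G s'"
          proof (rule relax[where W' = W'])
            show "warr s' = (warr s)(0 := P(w := cu), 8 := W')"
              using *(4) cu by (simp add: arrays fun_upd_twist)
            show "larr s' = (larr s)(0 := D(w := d))"
              using *(3) by (simp add: arrays)
            show "lvar s' 2 = lvar s 2" using *(2)[of 2] by simp
            show "\<forall>i<14. i \<noteq> 11 \<longrightarrow> wvar s' i = wvar s i" using *(1) by simp
            show "wvar s' 11 = b" using *(1)[of 11] by simp
            show "clock s' \<le> clock s + 10 * H + 23" using *(5) k1 k2(1) by simp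
            show "tournament (n + 1) W' (D(w := d))" using *(6) by (simp add: arrays)
            show "\<And>y. y < n + 1 \<Longrightarrow> W' (n + 1 + y) = (if y = w then w else W (n + 1 + y))"
              using *(7) by (simp add: arrays)
          qed
        qed (use t wb cc H(1) sizes in \<open>simp_all add: arrays\<close>)
      next
        fix k2 assume k2: "k2 = clock (tick ?s1) + 7"
          "\<not> d < larr (tick ?s1) 0 (if w \<in> Q then w else 0)"
        then have "dijkstra P D ord Q cu k b"
          using d_fin by (intro dijkstra_skip[OF dj la])
            (auto simp: w_def[symmetric] d_def[symmetric] arrays D0 split: if_splits)
        then show "?G (tick ?s1\<lparr>wvar := (wvar (tick ?s1))(17 := if w \<in> Q then w else 0),
             lvar := (lvar (tick ?s1))(3 := d, 4 := larr (tick ?s1) 0 (if w \<in> Q then w else 0)), clock := k2\<rparr>)"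
          by (rule skip) (use k1 k2 in simp_all)
      qed (use True cu leaf leafL in \<open>simp_all add: arrays w_def[symmetric] d_def\<close>)
      moreover have h: "\<not> holds (LessT 4 17) ?s1" using True cc by simp
      ultimately show ?thesis unfolding wp_Cond if_not_P[OF h] by simp
    qed
  qed
qed

lemma dijkstra_idle: "dijkstra P D ord Q c k 0 \<Longrightarrow> dijkstra P D ord Q c' k 0"
  unfolding dijkstra_def pending_def by simp

lemma wp_settle_next:
  assumes inv: "dijkstra_inv s" and a: "wvar s 11 = 0" and go: "wvar s 12 \<noteq> 0"
  shows "wp settle_next (\<lambda>s'. dijkstra_inv s' \<and> dijkstra_measure s' < dijkstra_measure s \<and>
    clock s' \<le> clock s + 10 * H + 23) s"
proof -
  have c: "constants s" and adj: "adjacency s" using inv by (auto simp: dijkstra_inv_def)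
  note ii = inv[unfolded dijkstra_inv_def adjacency_def]
  note cc = c[unfolded constants_def]
  define P where "P = warr s 0"
  define D where "D = larr s 0"
  define ord where "ord = warr s 4"
  define W where "W = warr s 8"
  define Q where "Q = queue (n + 1) W"
  define cu where "cu = wvar s 10"
  define k where "k = wvar s 13"
  note arrays = P_def[symmetric] D_def[symmetric] ord_def[symmetric] W_def[symmetric] cu_def[symmetric] k_def[symmetric]
  have dj: "dijkstra P D ord Q cu k 0"
    using inv a by (simp add: dijkstra_inv_def P_def D_def ord_def Q_def W_def cu_def k_def)
  note djD = dijkstraD[OF dj]
  have t: "tournament (n + 1) W D" and D0: "D 0 = \<infinity>"
    using inv by (auto simp: dijkstra_inv_def W_def D_def)
  define x where "x = W 1"
  have x: "x < n + 1" "x = 0 \<longleftrightarrow> Q = {}" "x \<noteq> 0 \<Longrightarrow> x \<in> Q" "\<And>y. y \<in> Q \<Longrightarrow> D x \<le> D y"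
    using tournament_root[OF t D0] djD(1) by (auto simp: x_def Q_def)
  have xW: "W (Suc 0) = x" by (simp add: x_def)
  have more: "warr s 1 = (\<lambda>_. 0)" "warr s 6 = (\<lambda>_. 0)" "wvar s 12 \<le> 1" "k + card (rest ord) \<le> 2 * m + 1" "lvar s 2 = \<infinity>"
    "\<And>x. ord x \<noteq> 0 \<Longrightarrow> warr s 5 x = x \<and> warr s 7 x = x \<and> larr s 2 x = \<infinity>"
    using inv by (auto simp: dijkstra_inv_def k_def ord_def)
  have Qn: "queue (Suc n) W = Q" by (simp add: Q_def)
  let ?G = "\<lambda>s'. dijkstra_inv s' \<and> dijkstra_measure s' < dijkstra_measure s \<and> clock s' \<le> clock s + 10 * H + 23"
  show ?thesis
  proof (cases "x = 0")
    case True
    have "dijkstra P D ord Q 0 k 0" using dijkstra_idle[OF dj] .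
    moreover have "unscanned ord 0 0 = unscanned ord cu 0" by (simp add: unscanned_def)
    moreover have "Q = {}" using x True by simp
    ultimately show ?thesis
      using True more(1,3,4) D0 t sizes go
      by (simp add: settle_next_def wp_simps cc xW cell_ok_def dijkstra_inv_def constants_def adjacency_def
        dijkstra_measure_def ii arrays a Qn)
  next
    case False
    define b where "b = warr s 2 x"
    have la: "last_arc x (2 * m) b" using adj by (simp add: adjacency_def b_def)
    have xQ: "x \<in> Q" "ord x = 0" "x \<in> endpoints" using x False djD(1,2) by auto
    have dj': "dijkstra P D (ord(x := Suc k)) (Q - {x}) x (Suc k) b"
      using dijkstra_settle[OF dj xQ(1) x(4) la] .
    have rest: "card (rest (ord(x := Suc k))) < card (rest ord)"
      using xQ by (intro psubset_card_mono finite_rest) (auto simp: rest_def)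
    have uns: "card (unscanned (ord(x := Suc k)) x b) \<le> card (unscanned ord cu 0)"
      using xQ by (intro card_mono finite_unscanned) (auto simp: unscanned_def)
    have kB: "Suc k \<le> B" "x < L" "x \<le> B" using more(4) sizes x(1) by linarith+
    have settle: "?G t" if
      t: "warr t = (warr s)(8 := W', 4 := ord(x := Suc k), 5 := (warr s 5)(x := x), 7 := (warr s 7)(x := x))"
        "larr t = (larr s)(2 := (larr s 2)(x := \<infinity>))"
        "lvar t 2 = \<infinity>" "\<forall>i<13. i \<notin> {10, 11} \<longrightarrow> wvar t i = wvar s i" "wvar t 10 = x" "wvar t 11 = b" "wvar t 13 = Suc k"
        "clock t \<le> clock s + 10 * H + 23" "tournament (n + 1) W' D"
        "\<And>y. y < n + 1 \<Longrightarrow> W' (n + 1 + y) = (if y = x then 0 else W (n + 1 + y))" for t W'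
    proof -
      have "queue (n + 1) W' = Q - {x}" unfolding Q_def using t(10) x by (intro queue_remove) auto
      then have "queue (Suc n) W' = Q - {x}" by simp
      then show ?thesis
        using dj' rest uns t(8,9) go more D0
        by (simp add: dijkstra_inv_def constants_def adjacency_def dijkstra_measure_def ii cc t(1-7) arrays a)
    qed
    let ?s1 = "tick (tick (s\<lparr>wvar := (wvar s)(10 := x)\<rparr>))"
    have "wp (update_tournament 8 0 7 10 4)
       (wp (Act (Arith Plus 13 13 5) ;; Act (Put 4 10 13) ;;
       Act (Put 5 10 10) ;; Act (Put 7 10 10) ;; Act (LPut 2 10 2) ;; Act (Get 11 2 10)) ?G) ?s1"
    proof (rule wp_update_tournament[where N = "n + 1" and \<kappa> = D and x = x and h = H])
      fix s' :: store and W'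
      assume *: "\<And>y. y \<notin> {20, 21, 22, 23} \<Longrightarrow> wvar s' y = wvar ?s1 y"
        "\<And>y. y \<notin> {10, 11} \<Longrightarrow> lvar s' y = lvar ?s1 y" "larr s' = larr ?s1"
        "warr s' = (warr ?s1)(8 := W')" "clock s' \<le> clock ?s1 + 10 * H + 3"
        "tournament (n + 1) W' (larr ?s1 0)"
        "\<And>y. y < n + 1 \<Longrightarrow> W' (n + 1 + y) = (if y = x then wvar ?s1 4 else warr ?s1 8 (n + 1 + y))"
      have w: "wvar s' 5 = 1" "wvar s' 13 = k" "wvar s' 10 = x" "\<And>y. y < 10 \<Longrightarrow> wvar s' y = wvar s y" "wvar s' 12 = wvar s 12"
        using *(1) cc by (simp_all add: k_def)
      have l2: "lvar s' 2 = \<infinity>" using *(2)[of 2] more by simp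
      let ?s2 = "s'\<lparr>warr := (warr s)(8 := W', 4 := ord(x := Suc k), 5 := (warr s 5)(x := x), 7 := (warr s 7)(x := x)),
        larr := (larr s)(2 := (larr s 2)(x := \<infinity>)), wvar := (wvar s')(13 := Suc k, 11 := b), clock := clock s' + 6\<rparr>"
      have "?G ?s2"
        by (rule settle[where W' = W']) (use * w l2 cc in \<open>simp_all add: arrays\<close>)
      then show "wp (Act (Arith Plus 13 13 5) ;; Act (Put 4 10 13) ;;
       Act (Put 5 10 10) ;; Act (Put 7 10 10) ;; Act (LPut 2 10 2) ;; Act (Get 11 2 10)) ?G s'"
        using kB by (simp add: wp_simps w l2 *(3,4) cell_ok_def arrays b_def fun_upd_twist
          dijkstra_inv_clock dijkstra_measure_clock)
    qed (use False t x cc H(1) sizes in \<open>simp_all add: arrays\<close>)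
    then show ?thesis
      using False kB sizes by (simp add: settle_next_def wp_simps cc arrays xW cell_ok_def)
  qed
qed

lemma wp_dijkstra_prog:
  assumes c: "constants s" and adj: "adjacency s" and zero: "\<forall>j\<in>{0, 1, 4, 5, 6, 7, 8}. warr s j = (\<lambda>_. 0)"
    "\<forall>j<9. larr s j = (\<lambda>_. 0)"
    and Q: "\<And>s'. \<lbrakk>dijkstra_inv s'; wvar s' 12 = 0; clock s' \<le> clock s + (10 * H + 25) * (4 * m + 3) + 1\<rbrakk> \<Longrightarrow> Q s'"
  shows "wp dijkstra_prog Q s"
proof -
  note cc = c[unfolded constants_def]
  \<comment> \<open>Either branch takes at most \<open>10 * H + 23\<close> ticks; two more go to the
    loop test and the choice of the branch. One extra \<open>?C\<close> in the total pays for the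
    initialisation.\<close>
  let ?C = "10 * H + 25"
  let ?loop = "Loop (LessT 4 12) (Cond (LessT 4 11) scan_arc settle_next)"
  have loop: "wp ?loop Q s0"
    if "dijkstra_inv s0" "dijkstra_measure s0 \<le> 4 * m + 2" "clock s0 \<le> clock s + ?C" for s0
    using that(1)
  proof (rule wp_Loop_timed[where I = dijkstra_inv and \<mu> = dijkstra_measure and k = ?C])
    fix s' assume I: "dijkstra_inv s'" and b: "holds (LessT 4 12) s'"
    have inv: "dijkstra_inv (tick (tick s'))" using I by (simp add: dijkstra_inv_clock)
    have "wvar s' 4 = 0" using I by (simp add: dijkstra_inv_def constants_def)
    then have go: "wvar s' 12 \<noteq> 0" and a: "holds (LessT 4 11) (tick s') \<longleftrightarrow> wvar s' 11 \<noteq> 0" using b by simp_all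
    have "wp (if holds (LessT 4 11) (tick s') then scan_arc else settle_next)
      (\<lambda>t. dijkstra_inv t \<and> dijkstra_measure t < dijkstra_measure (tick (tick s')) \<and>
        clock t \<le> clock (tick (tick s')) + 10 * H + 23) (tick (tick s'))"
      using wp_scan_arc[OF inv] wp_settle_next[OF inv] go a by auto
    then show "wp (Cond (LessT 4 11) scan_arc settle_next)
      (\<lambda>t. dijkstra_inv t \<and> dijkstra_measure t < dijkstra_measure s' \<and> clock t \<le> clock s' + ?C) (tick s')"
      unfolding wp_Cond by (auto simp: dijkstra_measure_clock split: if_splits elim!: wp_mono)
  next
    fix s' assume I: "dijkstra_inv s'" and b: "\<not> holds (LessT 4 12) s'"
      and k: "clock s' \<le> clock s0 + ?C * dijkstra_measure s0"
    have "wvar s' 12 = 0" using I b by (auto simp: dijkstra_inv_def constants_def)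
    moreover have "?C * dijkstra_measure s0 \<le> ?C * (4 * m + 2)"
      using that(2) by (rule mult_left_mono) simp
    then have "clock (tick s') \<le> clock s + ?C * (4 * m + 3) + 1" using k that(3) by (simp add: algebra_simps)
    ultimately show "Q (tick s')"
      using I by (intro Q) (auto simp: dijkstra_inv_clock)
  qed
  have rL: "r < L" "r \<le> n" "0 < r" using root sizes by auto
  have K: "tournament (n + 1) (\<lambda>_. 0) ((\<lambda>_. 0)(0 := \<infinity>))" by (rule tournament_empty) simp
  let ?s1 = "s\<lparr>wvar := wvar s, lvar := (lvar s)(2 := \<infinity>, 3 := 0),
    larr := (larr s)(0 := (\<lambda>_. 0)(0 := \<infinity>, r := 0)), warr := (warr s)(0 := (\<lambda>_. 0)(r := r)), clock := Suc (Suc (Suc (Suc (Suc (clock s)))))\<rparr>"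
  have "wp (update_tournament 8 0 7 2 2) (wp (Act (Const 10 0) ;; Act (Const 11 0) ;; Act (Const 12 1) ;; Act (Const 13 0) ;; ?loop) Q) ?s1"
  proof (rule wp_update_tournament[where N = "n + 1" and \<kappa> = "(\<lambda>_. 0)(0 := \<infinity>)" and x = r and h = H])
    fix s' :: store and W'
    assume *: "\<And>y. y \<notin> {20, 21, 22, 23} \<Longrightarrow> wvar s' y = wvar ?s1 y"
        "\<And>y. y \<notin> {10, 11} \<Longrightarrow> lvar s' y = lvar ?s1 y" "larr s' = larr ?s1"
        "warr s' = (warr ?s1)(8 := W')" "clock s' \<le> clock ?s1 + 10 * H + 3"
        "tournament (n + 1) W' (larr ?s1 0)"
        "\<And>y. y < n + 1 \<Longrightarrow> W' (n + 1 + y) = (if y = r then wvar ?s1 2 else warr ?s1 8 (n + 1 + y))"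
    have q: "queue (n + 1) W' = {r}"
      using *(7) rL zero cc by (auto simp: queue_def split: if_splits)
    then have q': "queue (Suc n) W' = {r}" by simp
    have dj: "dijkstra ((\<lambda>_. 0)(r := r)) ((\<lambda>_. 0)(0 := \<infinity>, r := 0)) (\<lambda>_. 0) {r} 0 0 0"
      by (rule dijkstra_init) auto
    have w: "wvar s' y = wvar s y" if "y \<notin> {20, 21, 22, 23}" for y using *(1)[OF that] by simp
    have l2: "lvar s' 2 = \<infinity>" using *(2)[of 2] by simp
    have la: "\<And>j. j < 9 \<Longrightarrow> j \<noteq> 0 \<Longrightarrow> larr s' j = (\<lambda>_. 0)" "larr s' 9 = larr s 9" "larr s' 0 = (\<lambda>_. 0)(0 := \<infinity>, r := 0)"
      using *(3) zero(2) by auto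
    have wa: "warr s' = (warr s)(0 := (\<lambda>_. 0)(r := r), 8 := W')" using *(4) by simp
    have wz: "warr s 1 = (\<lambda>_. 0)" "warr s 4 = (\<lambda>_. 0)" "warr s 6 = (\<lambda>_. 0)" using zero(1) by auto
    let ?s2 = "s'\<lparr>wvar := (wvar s')(10 := 0, 11 := 0, 12 := 1, 13 := 0), clock := Suc (Suc (Suc (Suc (clock s'))))\<rparr>"
    have "dijkstra_inv ?s2"
      using dj q' *(6) adj card_rest[of "\<lambda>_. 0"] rL wz
      by (simp add: dijkstra_inv_def constants_def adjacency_def w cc wa la l2)
    moreover have "dijkstra_measure ?s2 \<le> 4 * m + 2"
      using card_rest[of "\<lambda>_. 0"] card_unscanned[of "\<lambda>_. 0" 0 0] wa wz(2) by (simp add: dijkstra_measure_def)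
    ultimately have "wp ?loop Q ?s2"
      using *(5) by (intro loop) simp_all
    then show "wp (Act (Const 10 0) ;; Act (Const 11 0) ;; Act (Const 12 1) ;; Act (Const 13 0) ;; ?loop) Q s'"
      using sizes by (simp add: wp_simps)
  qed (use K zero cc H(1) sizes rL in \<open>simp_all add: fun_upd_def\<close>)
  then show ?thesis
    using rL sizes zero by (simp add: dijkstra_prog_def wp_simps cc cell_ok_def)
qed

end

section \<open>The sweep as a program\<close>

definition end1 :: "(nat \<Rightarrow> nat) \<Rightarrow> nat \<Rightarrow> nat" where
  "end1 e k = e (2 * (k - 1))"

definition end2 :: "(nat \<Rightarrow> nat) \<Rightarrow> nat \<Rightarrow> nat" where
  "end2 e k = e (2 * (k - 1) + 1)"

text \<open>Testing one end for being reached is enough, since both ends of an edge are reached or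
  neither is.\<close>

definition candidates :: "nat \<Rightarrow> (nat \<Rightarrow> nat) \<Rightarrow> (nat \<Rightarrow> nat) \<Rightarrow> nat set" where
  "candidates m e par = {k. 1 \<le> k \<and> k \<le> m \<and> par (end1 e k) \<noteq> 0 \<and>
     par (end1 e k) \<noteq> end2 e k \<and> par (end2 e k) \<noteq> end1 e k}"

definition load_edge :: cmd where
  "load_edge =
     Act (Arith Plus 14 10 10) ;; Act (Get 15 9 14) ;; Act (Arith Plus 15 15 5) ;;
     Act (Arith Plus 14 14 5) ;; Act (Get 16 9 14) ;; Act (Arith Plus 16 16 5) ;;
     Act (Get 17 0 15) ;; Act (Get 18 0 16) ;; Act (LGet 3 9 10) ;; Act (Arith Plus 10 10 5)"

definition enter_edge :: cmd where
  "enter_edge =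
     Act (LGet 4 0 15) ;; Act (LAdd 3 4 3) ;; Act (LGet 4 0 16) ;; Act (LAdd 3 3 4) ;;
     Act (LPut 3 10 3) ;; update_tournament 1 3 8 10 10"

definition enter_edges :: cmd where
  "enter_edges =
     Act (LInf 2) ;; Act (LPut 3 4 2) ;; Act (Const 10 0) ;;
     Loop (LessT 10 3)
      (load_edge ;;
       Cond (LessT 4 17) (Cond (NeqT 17 16) (Cond (NeqT 18 15) enter_edge Nop) Nop) Nop)"

definition find_root :: "nat \<Rightarrow> cmd" where
  "find_root v = Act (Get 19 5 v) ;; Loop (NeqT 19 v) (Act (Copy v 19) ;; Act (Get 19 5 v))"

definition order_tops :: cmd where
  "order_tops =
     Act (Get 14 4 10) ;; Act (Get 15 4 11) ;;
     Cond (LessT 14 15) (Act (Copy 14 10) ;; Act (Copy 10 11) ;; Act (Copy 11 14)) Nop"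

definition assign_top :: cmd where
  "assign_top =
     Act (LGet 4 0 10) ;; Act (LSub 4 5 4) ;; Act (LPut 2 10 4) ;;
     Act (Get 14 0 10) ;; Act (Copy 15 10) ;; find_root 15 ;; Act (Copy 16 14) ;; find_root 16"

text \<open>The top of the parent's class is fetched before the two representatives may be
  exchanged. It is stored with the surviving one, and it is also where the climb continues.\<close>

definition merge_classes :: cmd where
  "merge_classes =
     Act (Get 10 7 16) ;; Act (Get 17 6 15) ;; Act (Get 18 6 16) ;;
     Cond (LessT 18 17) (Act (Copy 14 15) ;; Act (Copy 15 16) ;; Act (Copy 16 14)) Nop ;;
     Act (Put 5 15 16) ;; Act (Put 7 16 10) ;;
     Cond (NeqT 17 18) Nop (Act (Arith Plus 18 18 5) ;; Act (Put 6 16 18))"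

definition climb :: cmd where
  "climb = order_tops ;; assign_top ;; merge_classes"

definition next_edge :: cmd where
  "next_edge =
     Act (Get 13 1 5) ;;
     Cond (LessT 4 13)
      (update_tournament 1 3 8 13 4 ;; Act (LGet 5 3 13) ;; Act (Arith Minus 14 13 5) ;; Act (Arith Plus 14 14 14) ;;
       Act (Get 10 9 14) ;; Act (Arith Plus 10 10 5) ;; find_root 10 ;; Act (Get 10 7 10) ;;
       Act (Arith Plus 14 14 5) ;; Act (Get 11 9 14) ;; Act (Arith Plus 11 11 5) ;; find_root 11 ;; Act (Get 11 7 11))
      (Act (Copy 12 4))"

definition sweep_prog :: cmd where
  "sweep_prog =
     Act (Const 10 0) ;; Act (Const 11 0) ;; Act (Const 12 1) ;;
     Loop (LessT 4 12) (Cond (NeqT 10 11) climb next_edge)"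

locale tree_run = instance_run n m r E l e M L B H +
  T: replacement_sweep "{1..n}" E l r R D par ord "candidates m e par" "end1 e" "end2 e"
  for n m r E l e M L B H R D par ord +
  assumes par_R: "\<And>x. par x \<noteq> 0 \<longleftrightarrow> x \<in> R"
begin

lemma R_bounds: "x \<in> R \<Longrightarrow> 1 \<le> x \<and> x \<le> n"
  using T.parent[of x] edge_bounds[of x "par x"] root by (cases "x = r") auto

lemma card_R: "card R \<le> n"
proof -
  have "R \<subseteq> {1..n}" using R_bounds by auto
  then show ?thesis using card_mono[of "{1..n}" R] by simp
qed

definition tree_state :: "store \<Rightarrow> bool" where
  "tree_state s \<longleftrightarrow> constants s \<and> warr s 0 = par \<and> warr s 4 = ord \<and> (\<forall>x\<in>R. larr s 0 x = ereal (D x))"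

definition entered :: "store \<Rightarrow> nat set \<Rightarrow> bool" where
  "entered s Q \<longleftrightarrow> tournament (m + 1) (warr s 1) (larr s 3) \<and> queue (m + 1) (warr s 1) = Q \<and>
     larr s 3 0 = \<infinity> \<and> (\<forall>k\<in>Q. larr s 3 k = ereal (T.weight k))"

lemma tree_state_clock: "tree_state (s\<lparr>clock := k\<rparr>) = tree_state s"
  by (simp add: tree_state_def constants_def)

lemma entered_clock: "entered (s\<lparr>clock := k\<rparr>) Q = entered s Q"
  by (simp add: entered_def)

lemma wp_enter_edges:
  assumes ts: "tree_state s" and zero: "warr s 1 = (\<lambda>_. 0)"
    and Q: "\<And>s'. \<lbrakk>tree_state s'; entered s' (candidates m e par); \<forall>j\<in>{5, 6, 7}. warr s' j = warr s j; larr s' 2 = larr s 2;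
      clock s' \<le> clock s + (10 * H + 30) * (m + 1)\<rbrakk> \<Longrightarrow> Q s'"
  shows "wp enter_edges Q s"
proof -
  let ?C = "10 * H + 30"
  define I where "I s' \<longleftrightarrow> tree_state s' \<and> wvar s' 10 \<le> m \<and> entered s' {k \<in> candidates m e par. k \<le> wvar s' 10} \<and>
    (\<forall>j\<in>{5, 6, 7}. warr s' j = warr s j) \<and> larr s' 2 = larr s 2" for s' :: store
  let ?body = "load_edge ;;
       Cond (LessT 4 17) (Cond (NeqT 17 16) (Cond (NeqT 18 15) enter_edge Nop) Nop) Nop"
  have loop: "wp (Loop (LessT 10 3) ?body) Q s0" if "I s0" "wvar s0 10 = 0" "clock s0 = clock s + 3" for s0
    using that(1)
  proof (rule wp_Loop_timed[where I = I and \<mu> = "\<lambda>s. m - wvar s 10" and k = ?C])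
    fix s' assume I: "I s'" and b: "holds (LessT 10 3) s'"
    have c: "constants s'" using I by (simp add: I_def tree_state_def)
    note cc = c[unfolded constants_def]
    define i where "i = wvar s' 10"
    have w10: "wvar s' 10 = i" by (simp add: i_def)
    have i: "i < m" "2 * i < 2 * m" "2 * i + 1 < 2 * m" using b cc by (auto simp: w10)
    define x where "x = end1 e (Suc i)"
    define y where "y = end2 e (Suc i)"
    have raw: "Suc (warr s' 9 (2 * i)) = x" "Suc (warr s' 9 (Suc (2 * i))) = y"
      using cc i by (auto simp: x_def y_def end1_def end2_def)
    have len: "larr s' 9 i = ereal (l {x, y})"
      using cc i by (auto simp: x_def y_def end1_def end2_def)
    have E: "{x, y} \<in> E" using arc_edge[of "2 * i"] i by (simp add: x_def y_def end1_def end2_def opp_even)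
    have xy: "x \<le> n" "y \<le> n" using edge_bounds[OF E] by auto
    have st: "tree_state s'" "warr s' 0 = par" "\<And>x. x \<in> R \<Longrightarrow> larr s' 0 x = ereal (D x)"
      using I by (auto simp: I_def tree_state_def)
    define Q where "Q = {k \<in> candidates m e par. k \<le> i}"
    have en: "entered s' Q" using I by (simp add: I_def Q_def w10)
    have sz: "i + i \<le> B" "i + i < 9 * M" "Suc (i + i) \<le> B" "Suc (i + i) < 9 * M" "x \<le> B" "y \<le> B" "x < L" "y < L" "i < 9 * M" "Suc i \<le> B" "Suc i < L"
      using i xy sizes by auto
    have ii: "i + i = 2 * i" by simp
    let ?J = "\<lambda>t. I t \<and> m - wvar t 10 < m - wvar s' 10 \<and> clock t \<le> clock s' + ?C"
    have J: "?J t" if "tree_state t" "wvar t 10 = Suc i" "entered t {k \<in> candidates m e par. k \<le> Suc i}"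
      "\<forall>j\<in>{5, 6, 7}. warr t j = warr s' j" "larr t 2 = larr s' 2" "clock t \<le> clock s' + ?C" for t
      using that I i by (auto simp: I_def w10)
    have old: "{k \<in> candidates m e par. k \<le> Suc i} = Q" if "Suc i \<notin> candidates m e par"
      using that by (auto simp: Q_def le_Suc_eq)
    have new: "{k \<in> candidates m e par. k \<le> Suc i} = insert (Suc i) Q" if "Suc i \<in> candidates m e par"
      using that by (auto simp: Q_def le_Suc_eq)
    have cand: "Suc i \<in> candidates m e par \<longleftrightarrow> 0 < par x \<and> par x \<noteq> y \<and> par y \<noteq> x"
      using i by (auto simp: candidates_def x_def y_def)
    let ?w = "(wvar s')(15 := x, 14 := Suc (2 * i), 16 := y, 17 := par x, 18 := par y, 10 := Suc i)"
    have skip: "?J (s'\<lparr>lvar := (lvar s')(3 := ereal (l {x, y})), wvar := ?w, clock := k\<rparr>)"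
      if "Suc i \<notin> candidates m e par" "k \<le> clock s' + ?C" for k
      using st(1) en that
      by (intro J) (simp_all add: tree_state_def constants_def entered_def old)
    have add: "wp enter_edge ?J (s'\<lparr>lvar := (lvar s')(3 := ereal (l {x, y})), wvar := ?w, clock := k\<rparr>)"
      (is "wp enter_edge ?J ?s1") if cd: "Suc i \<in> candidates m e par" and k: "k \<le> clock s' + 14" for k
    proof -
      have R: "x \<in> R" "y \<in> R" using cand cd par_R T.closed[OF _ E] by auto
      define d where "d = T.weight (Suc i)"
      have d: "ereal (D x) + ereal (l {x, y}) + ereal (D y) = ereal d"
        by (simp add: d_def T.weight_def x_def y_def)
      let ?s2 = "s'\<lparr>wvar := ?w, lvar := (lvar s')(4 := ereal (D y), 3 := ereal d),
         larr := (larr s')(3 := (larr s' 3)(Suc i := ereal d)), clock := Suc (Suc (Suc (Suc (Suc k))))\<rparr>"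
      have "wp (update_tournament 1 3 8 10 10) ?J ?s2"
      proof (rule wp_update_tournament[where N = "m + 1" and \<kappa> = "larr s' 3" and x = "Suc i" and h = H])
        fix t :: store and W
        assume *: "\<And>y. y \<notin> {20, 21, 22, 23} \<Longrightarrow> wvar t y = wvar ?s2 y"
          "\<And>y. y \<notin> {10, 11} \<Longrightarrow> lvar t y = lvar ?s2 y" "larr t = larr ?s2"
          "warr t = (warr ?s2)(1 := W)" "clock t \<le> clock ?s2 + 10 * H + 3"
          "tournament (m + 1) W (larr ?s2 3)"
          "\<And>y. y < m + 1 \<Longrightarrow> W (m + 1 + y) = (if y = Suc i then wvar ?s2 10 else warr ?s2 1 (m + 1 + y))"
        have q: "queue (m + 1) W = insert (Suc i) Q"
          using *(7) en i by (subst queue_insert[where x = "Suc i" and W = "warr s' 1"]) (auto simp: entered_def)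
        have "Suc i \<notin> Q" by (simp add: Q_def)
        then have en': "entered t (insert (Suc i) Q)"
          using q *(3,4,6) en by (auto simp: entered_def d_def)
        have "tree_state t"
          using st(1) *(1,3,4) by (simp add: tree_state_def constants_def)
        then show "?J t"
          using en' * k by (intro J) (simp_all add: new[OF cd])
      qed (use i en cc H(2) sizes in \<open>simp_all add: entered_def\<close>)
      then show ?thesis
        using sz R by (simp add: enter_edge_def wp_simps cell_ok_def st add.assoc[symmetric] d[simplified] )
    qed
    let ?s1 = "\<lambda>k. s'\<lparr>lvar := (lvar s')(3 := ereal (l {x, y})), wvar := ?w, clock := k\<rparr>"
    have "wp (Cond (LessT 4 17) (Cond (NeqT 17 16) (Cond (NeqT 18 15) enter_edge Nop) Nop) Nop) ?J (?s1 k)"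
      if k: "k \<le> clock s' + 11" for k
    proof (cases "Suc i \<in> candidates m e par")
      case True
      then have "wp enter_edge ?J (?s1 (Suc (Suc (Suc k))))" using k by (intro add) auto
      then show ?thesis using True cand cc by (simp add: wp_Cond)
    next
      case False
      have "?J (?s1 (Suc k))" "?J (?s1 (Suc (Suc k)))" "?J (?s1 (Suc (Suc (Suc k))))"
        using k by (intro skip[OF False]; simp)+
      then show ?thesis using False cand cc by (auto simp: wp_simps simp del: fun_upd_apply) (auto simp: fun_upd_apply)
    qed
    note rest = this[unfolded w10]
    show "wp ?body ?J (tick s')"
      unfolding wp_Seq[of load_edge]
      unfolding load_edge_def using sz
      by (simp add: wp_simps(2,3) cc w10 cell_ok_def raw ii len st(2)) (rule rest, simp)
  next
    fix s' assume I: "I s'" and b: "\<not> holds (LessT 10 3) s'" and k: "clock s' \<le> clock s0 + ?C * (m - wvar s0 10)"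
    then have w: "wvar s' 10 = m" by (auto simp: I_def tree_state_def constants_def)
    have "{k \<in> candidates m e par. k \<le> m} = candidates m e par" by (auto simp: candidates_def)
    then show "Q (tick s')"
      using I w k that(2,3) by (intro Q) (auto simp: I_def tree_state_clock entered_clock)
  qed
  note cc = ts[unfolded tree_state_def constants_def]
  let ?s1 = "s\<lparr>lvar := (lvar s)(2 := \<infinity>), larr := (larr s)(3 := (larr s 3)(0 := \<infinity>)), wvar := (wvar s)(10 := 0), clock := Suc (Suc (Suc (clock s)))\<rparr>"
  have "{k \<in> candidates m e par. k \<le> 0} = {}" "0 \<notin> candidates m e par" by (auto simp: candidates_def)
  moreover have "queue (m + 1) (\<lambda>_. 0) = {}" by (auto simp: queue_def)
  ultimately have en: "entered ?s1 {k \<in> candidates m e par. k \<le> 0}"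
    using zero tournament_empty[of "m + 1"] by (simp add: entered_def)
  have "I ?s1"
    using ts en by (simp add: I_def tree_state_def constants_def)
  then show ?thesis
    unfolding enter_edges_def using sizes by (simp add: wp_simps cc cell_ok_def loop)
qed

text \<open>\<open>H\<close> bounds the length of searches; the cruder bound by \<open>n\<close>
  lets an incremented rank fit into a word.\<close>

lemma rank_le:
  assumes "T.union_find X up rank tip rt" "v \<in> R"
  shows "rank v \<le> H" "rank v < n"
proof -
  have c: "2 ^ rank v \<le> n"
    using T.union_find_rank[OF assms T.finite_R] card_R by linarith
  also have "\<dots> \<le> 2 ^ H" using H by simp
  finally show "rank v \<le> H" by (rule power_le_imp_le_exp[rotated]) simp
  show "rank v < n" using c less_exp[of "rank v"] by linarith
qed

text \<open>Ranks strictly increase along the pointers and never exceed \<open>H\<close>, so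
  \<open>H\<close> minus the current rank bounds the remaining steps.\<close>

lemma wp_find_root:
  assumes uf: "T.union_find X (warr s 5) (warr s 6) tip rt" and x: "wvar s v = x" "x \<in> R" and v: "v \<noteq> 19"
    and Q: "\<And>k. k \<le> clock s + 3 * H + 2 \<Longrightarrow> Q (s\<lparr>wvar := (wvar s)(19 := rt x, v := rt x), clock := k\<rparr>)"
  shows "wp (find_root v) Q s"
proof -
  note D = T.union_findD[OF uf]
  define I where "I s' \<longleftrightarrow> (\<exists>y k. s' = s\<lparr>wvar := (wvar s)(19 := warr s 5 y, v := y), clock := k\<rparr> \<and>
    y \<in> R \<and> rt y = rt x)" for s' :: store
  have loop: "wp (Loop (NeqT 19 v) (Act (Copy v 19) ;; Act (Get 19 5 v))) Q s0" if "I s0" "clock s0 = Suc (clock s)" for s0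
    using that(1)
  proof (rule wp_Loop_timed[where I = I and \<mu> = "\<lambda>t. H - warr s 6 (wvar t v)" and k = 3])
    fix t assume "I t" and b: "holds (NeqT 19 v) t"
    then obtain y k where t: "t = s\<lparr>wvar := (wvar s)(19 := warr s 5 y, v := y), clock := k\<rparr>"
      and y: "y \<in> R" "rt y = rt x"
      by (auto simp: I_def)
    let ?z = "warr s 5 y"
    have "?z \<noteq> y" using b v by (simp add: t)
    then have z: "?z \<in> R" "rt ?z = rt x" "warr s 6 y < warr s 6 ?z" using D(2,4,6)[OF y(1)] y by auto
    have h: "warr s 6 ?z \<le> H" using rank_le[OF uf z(1)] by simp
    have zL: "?z < L" using R_bounds[OF z(1)] sizes by auto
    have "I (s\<lparr>wvar := (wvar s)(19 := warr s 5 ?z, v := ?z), clock := Suc (Suc (Suc k))\<rparr>)"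
      unfolding I_def using z y by (intro exI[of _ ?z] exI[of _ "Suc (Suc (Suc k))"]) auto
    moreover have "(wvar s)(19 := ?z, v := ?z, 19 := warr s 5 ?z) = (wvar s)(19 := warr s 5 ?z, v := ?z)"
      using v by (auto simp: fun_eq_iff)
    ultimately show "wp (Act (Copy v 19) ;; Act (Get 19 5 v))
      (\<lambda>t'. I t' \<and> H - warr s 6 (wvar t' v) < H - warr s 6 (wvar t v) \<and> clock t' \<le> clock t + 3) (tick t)"
      using v zL z h by (simp add: wp_simps t cell_ok_def)
  next
    fix t assume "I t" and b: "\<not> holds (NeqT 19 v) t" and c: "clock t \<le> clock s0 + 3 * (H - warr s 6 (wvar s0 v))"
    then obtain y k where t: "t = s\<lparr>wvar := (wvar s)(19 := warr s 5 y, v := y), clock := k\<rparr>"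
      and y: "y \<in> R" "rt y = rt x"
      by (auto simp: I_def)
    have e: "warr s 5 y = y" using b v by (simp add: t)
    then have "rt x = y" using D(5)[OF y(1)] y by auto
    then show "Q (tick t)"
      using Q[of "Suc k"] c that(2) by (simp add: t e)
  qed
  have xL: "x < L" using R_bounds[OF x(2)] sizes by auto
  have "I (s\<lparr>wvar := (wvar s)(19 := warr s 5 x), clock := Suc (clock s)\<rparr>)"
    unfolding I_def using x v by (intro exI[of _ x] exI[of _ "Suc (clock s)"]) (auto simp: fun_eq_iff)
  then show ?thesis
    unfolding find_root_def using x xL by (simp add: wp_simps cell_ok_def loop)
qed

definition unassigned :: "store \<Rightarrow> nat set" where
  "unassigned s = {v \<in> R. larr s 2 v = \<infinity>}"

definition sweep_inv :: "store \<Rightarrow> bool" where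
  "sweep_inv s \<longleftrightarrow> tree_state s \<and> wvar s 12 \<le> 1 \<and>
     (\<exists>Q X rt. entered s Q \<and> T.sweep X (larr s 2) Q (wvar s 10) (wvar s 11) (lvar s 5) \<and>
        T.union_find X (warr s 5) (warr s 6) (warr s 7) rt \<and>
        (wvar s 12 = 0 \<longrightarrow> Q = {} \<and> wvar s 10 = wvar s 11) \<and>
        (wvar s 10 \<noteq> wvar s 11 \<longrightarrow> wvar s 10 \<in> R \<and> wvar s 11 \<in> R))"

text \<open>Each round gives a value to a vertex, takes an edge from the queue or clears the flag in
  variable 12. The climbs of all edges are thus paid for together.\<close>

definition sweep_measure :: "store \<Rightarrow> nat" where
  "sweep_measure s = card (unassigned s) + card (queue (m + 1) (warr s 1)) + wvar s 12"

lemma sweep_inv_clock: "sweep_inv (s\<lparr>clock := k\<rparr>) = sweep_inv s"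
  by (simp add: sweep_inv_def tree_state_clock entered_clock)

lemma sweep_measure_clock: "sweep_measure (s\<lparr>clock := k\<rparr>) = sweep_measure s"
  by (simp add: sweep_measure_def unassigned_def)

lemma candidate_ends:
  assumes "k \<in> candidates m e par"
  shows "1 \<le> k" "k \<le> m" "end1 e k \<in> R" "end2 e k \<in> R"
    "constants s \<Longrightarrow> Suc (warr s 9 ((k - 1) + (k - 1))) = end1 e k"
    "constants s \<Longrightarrow> Suc (warr s 9 (Suc ((k - 1) + (k - 1)))) = end2 e k"
proof -
  show k: "1 \<le> k" "k \<le> m" using assms by (auto simp: candidates_def)
  show "end1 e k \<in> R" "end2 e k \<in> R"
    using T.cand_edge[OF assms] T.closed by auto
  have "2 * (k - 1) < 2 * m" "Suc (2 * (k - 1)) < 2 * m" using k by auto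
  then show "constants s \<Longrightarrow> Suc (warr s 9 ((k - 1) + (k - 1))) = end1 e k"
    "constants s \<Longrightarrow> Suc (warr s 9 (Suc ((k - 1) + (k - 1)))) = end2 e k"
    by (auto simp: constants_def end1_def end2_def mult_2[symmetric])
qed

lemma wp_next_edge:
  assumes inv: "sweep_inv s" and xy: "wvar s 10 = wvar s 11" and go: "wvar s 12 \<noteq> 0"
  shows "wp next_edge (\<lambda>s'. sweep_inv s' \<and> sweep_measure s' < sweep_measure s \<and>
    clock s' \<le> clock s + 16 * H + 50) s"
proof -
  obtain Q X rt where ts: "tree_state s" and en: "entered s Q"
    and sw: "T.sweep X (larr s 2) Q (wvar s 11) (wvar s 11) (lvar s 5)"
    and uf: "T.union_find X (warr s 5) (warr s 6) (warr s 7) rt"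
    using inv xy by (auto simp: sweep_inv_def)
  have c: "constants s" using ts by (simp add: tree_state_def)
  note cc = c[unfolded constants_def]
  have ts': "warr s 0 = par" "warr s 4 = ord" "\<And>x. x \<in> R \<Longrightarrow> larr s 0 x = ereal (D x)"
    using ts by (auto simp: tree_state_def)
  define k where "k = warr s 1 1"
  have kW: "warr s (Suc 0) (Suc 0) = k" by (simp add: k_def)
  have t: "tournament (m + 1) (warr s 1) (larr s 3)" "larr s 3 0 = \<infinity>" "queue (m + 1) (warr s 1) = Q"
    "\<And>k. k \<in> Q \<Longrightarrow> larr s 3 k = ereal (T.weight k)"
    using en by (auto simp: entered_def)
  have k: "k < m + 1" "k = 0 \<longleftrightarrow> Q = {}" "k \<noteq> 0 \<Longrightarrow> k \<in> Q" "\<And>j. j \<in> Q \<Longrightarrow> larr s 3 k \<le> larr s 3 j"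
    using tournament_root[OF t(1,2)] t(3,4) by (auto simp: k_def)
  let ?G = "\<lambda>s'. sweep_inv s' \<and> sweep_measure s' < sweep_measure s \<and> clock s' \<le> clock s + 16 * H + 50"
  show ?thesis
  proof (cases "k = 0")
    case True
    then have "?G (s\<lparr>wvar := (wvar s)(13 := 0, 12 := 0), clock := Suc (Suc (Suc (clock s)))\<rparr>)"
      using ts en sw uf go xy k(2)
      by (auto simp: sweep_inv_def sweep_measure_def unassigned_def tree_state_def constants_def entered_def)
    then show ?thesis
      using True sizes by (simp add: next_edge_def wp_simps cc cell_ok_def kW)
  next
    case False
    then have kQ: "k \<in> Q" using k by simp
    have QK: "Q \<subseteq> candidates m e par" using sw by (simp add: T.sweep_def)
    note ce = candidate_ends[OF subsetD[OF QK kQ]]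
    define a where "a = end1 e k"
    define b where "b = end2 e k"
    have ab: "a \<in> R" "b \<in> R" "a \<le> n" "b \<le> n" using ce R_bounds by (auto simp: a_def b_def)
    note D = T.union_findD[OF uf]
    have ra: "rt a \<in> R" "rt b \<in> R" "rt a < L" "rt b < L"
      using D(1)[OF ab(1)] D(1)[OF ab(2)] R_bounds sizes by fastforce+
    define x where "x = warr s 7 (rt a)"
    define y where "y = warr s 7 (rt b)"
    have tops: "T.is_top X a x" "T.is_top X b y"
      using D(8)[OF ab(1)] D(8)[OF ab(2)] by (auto simp: x_def y_def)
    have xyR: "x \<in> R" "y \<in> R" using tops T.subtree_root_R by (auto simp: T.is_top_def)
    have sw': "T.sweep X (larr s 2) (Q - {k}) x y (ereal (T.weight k))"
      using sw kQ t(4) k(4) tops by (intro T.sweep_pop) (auto simp: a_def b_def)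
    have fQ: "finite Q" using t(3) by (auto simp: queue_def)
    define j where "j = k - 1"
    have jk: "k - Suc 0 = j" by (simp add: j_def)
    have raw: "Suc (warr s 9 (j + j)) = a" "Suc (warr s 9 (Suc (j + j))) = b"
      using ce(5,6)[OF c] by (auto simp: a_def b_def j_def)
    have sz: "j + j \<le> B" "j + j < 9 * M" "Suc (j + j) \<le> B" "Suc (j + j) < 9 * M" "a \<le> B" "b \<le> B" "j \<le> B" "k < L"
      using k(1) False ab sizes by (auto simp: j_def)
    let ?s1 = "s\<lparr>wvar := (wvar s)(13 := k), clock := Suc (Suc (clock s))\<rparr>"
    let ?rest = "Act (LGet 5 3 13) ;; Act (Arith Minus 14 13 5) ;; Act (Arith Plus 14 14 14) ;;
       Act (Get 10 9 14) ;; Act (Arith Plus 10 10 5) ;; find_root 10 ;; Act (Get 10 7 10) ;;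
       Act (Arith Plus 14 14 5) ;; Act (Get 11 9 14) ;; Act (Arith Plus 11 11 5) ;; find_root 11 ;; Act (Get 11 7 11)"
    have "wp (update_tournament 1 3 8 13 4) (wp ?rest ?G) ?s1"
    proof (rule wp_update_tournament[where N = "m + 1" and \<kappa> = "larr s 3" and x = k and h = H])
      fix s' :: store and W'
      assume *: "\<And>y. y \<notin> {20, 21, 22, 23} \<Longrightarrow> wvar s' y = wvar ?s1 y"
        "\<And>y. y \<notin> {10, 11} \<Longrightarrow> lvar s' y = lvar ?s1 y" "larr s' = larr ?s1"
        "warr s' = (warr ?s1)(1 := W')" "clock s' \<le> clock ?s1 + 10 * H + 3"
        "tournament (m + 1) W' (larr ?s1 3)"
        "\<And>y. y < m + 1 \<Longrightarrow> W' (m + 1 + y) = (if y = k then wvar ?s1 4 else warr ?s1 1 (m + 1 + y))"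
      have w: "wvar s' 5 = 1" "wvar s' 13 = k" "\<And>y. y < 10 \<Longrightarrow> wvar s' y = wvar s y" "wvar s' 12 = wvar s 12"
        using *(1) cc by (simp_all)
      have la: "larr s' = larr s" using *(3) by simp
      have wa: "warr s' = (warr s)(1 := W')" using *(4) by simp
      have q: "queue (m + 1) W' = Q - {k}"
        using *(7) cc k(1) t(3) by (subst queue_remove[where x = k and W = "warr s 1"]) auto
      have en': "entered u (Q - {k})" if "larr u = larr s" "warr u = (warr s)(1 := W')" for u
        using q *(6) en that by (auto simp: entered_def)
      have fin: "?G u" if "\<forall>i<10. wvar u i = wvar s i" "wvar u 12 = wvar s 12" "wvar u 10 = x" "wvar u 11 = y"
        "lvar u 5 = ereal (T.weight k)" "larr u = larr s" "warr u = (warr s)(1 := W')" "clock u \<le> clock s + 16 * H + 50" for u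
      proof -
        have "tree_state u" using ts that by (simp add: tree_state_def constants_def)
        moreover have "wvar u 12 \<le> 1" using inv that(2) by (simp add: sweep_inv_def)
        moreover have "card (Q - {k}) < card Q" using kQ fQ by (intro psubset_card_mono) auto
        ultimately show ?thesis
          using en'[OF that(6,7)] sw' uf that q t(3) xyR go
          by (auto simp: sweep_inv_def sweep_measure_def unassigned_def)
      qed
      have last: "wp (Act (Get 11 7 11)) ?G (s'\<lparr>lvar := (lvar s')(5 := ereal (T.weight k)),
          wvar := (wvar s')(10 := x, 14 := Suc (j + j), 19 := rt b, 11 := rt b), clock := i\<rparr>)"
        if "i \<le> clock s + 16 * H + 40" for i
      proof -
        have "?G (s'\<lparr>lvar := (lvar s')(5 := ereal (T.weight k)),
          wvar := (wvar s')(10 := x, 14 := Suc (j + j), 19 := rt b, 11 := y), clock := Suc i\<rparr>)"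
          using that by (intro fin) (simp_all add: w la wa)
        then show ?thesis
          using ra by (simp add: wp_Act wa cell_ok_def y_def[symmetric])
      qed
      have second: "wp (Act (Get 10 7 10) ;; Act (Arith Plus 14 14 5) ;; Act (Get 11 9 14) ;;
          Act (Arith Plus 11 11 5) ;; find_root 11 ;; Act (Get 11 7 11)) ?G
          (s'\<lparr>lvar := (lvar s')(5 := ereal (T.weight k)),
            wvar := (wvar s')(14 := j + j, 19 := rt a, 10 := rt a), clock := i\<rparr>)"
        (is "wp _ _ ?u") if i: "i \<le> clock s + 13 * H + 20" for i
      proof -
        let ?v = "s'\<lparr>lvar := (lvar s')(5 := ereal (T.weight k)),
            wvar := (wvar s')(19 := rt a, 10 := x, 14 := Suc (j + j), 11 := b), clock := Suc (Suc (Suc (Suc i)))\<rparr>"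
        have "wp (find_root 11) (wp (Act (Get 11 7 11)) ?G) ?v"
        proof (rule wp_find_root[where X = X and rt = rt and tip = "warr s 7" and x = b])
          fix i' assume "i' \<le> clock ?v + 3 * H + 2"
          then have "wp (Act (Get 11 7 11)) ?G (s'\<lparr>lvar := (lvar s')(5 := ereal (T.weight k)),
            wvar := (wvar s')(10 := x, 14 := Suc (j + j), 19 := rt b, 11 := rt b), clock := i'\<rparr>)"
            using i by (intro last) simp
          then show "wp (Act (Get 11 7 11)) ?G (?v\<lparr>wvar := (wvar ?v)(19 := rt b, 11 := rt b), clock := i'\<rparr>)"
            by (simp add: fun_upd_twist)
        qed (use uf ab wa in simp_all)
        then show ?thesis
          using sz ra by (simp add: wp_simps w wa cell_ok_def raw x_def[symmetric] fun_upd_twist)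
      qed
      let ?u = "s'\<lparr>lvar := (lvar s')(5 := ereal (T.weight k)), wvar := (wvar s')(14 := j + j, 10 := a),
        clock := Suc (Suc (Suc (Suc (Suc (clock s')))))\<rparr>"
      have "wp (find_root 10) (wp (Act (Get 10 7 10) ;; Act (Arith Plus 14 14 5) ;; Act (Get 11 9 14) ;;
          Act (Arith Plus 11 11 5) ;; find_root 11 ;; Act (Get 11 7 11)) ?G) ?u"
      proof (rule wp_find_root[where X = X and rt = rt and tip = "warr s 7" and x = a])
        fix i assume "i \<le> clock ?u + 3 * H + 2"
        then show "wp (Act (Get 10 7 10) ;; Act (Arith Plus 14 14 5) ;; Act (Get 11 9 14) ;;
          Act (Arith Plus 11 11 5) ;; find_root 11 ;; Act (Get 11 7 11)) ?G
          (?u\<lparr>wvar := (wvar ?u)(19 := rt a, 10 := rt a), clock := i\<rparr>)"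
          using second[of i] *(5) by (simp add: fun_upd_twist)
      qed (use uf ab wa in simp_all)
      then show "wp ?rest ?G s'"
        using sz by (simp add: wp_simps w la wa cell_ok_def raw t(4)[OF kQ] jk)
    qed (use False k t(1) cc H(2) sizes in \<open>simp_all\<close>)
    then show ?thesis
      using False sz by (simp add: next_edge_def wp_simps cc kW cell_ok_def)
  qed
qed

lemma wp_order_tops:
  assumes "tree_state s" "wvar s 10 = x" "wvar s 11 = y" "x \<in> R" "y \<in> R"
    and Q: "\<And>s' x' y'. \<lbrakk>x' = x \<and> y' = y \<or> x' = y \<and> y' = x; ord y' \<le> ord x'; wvar s' 10 = x'; wvar s' 11 = y';
      \<forall>i<14. i \<notin> {10, 11} \<longrightarrow> wvar s' i = wvar s i; lvar s' = lvar s; warr s' = warr s; larr s' = larr s;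
      clock s' \<le> clock s + 6\<rbrakk> \<Longrightarrow> Q s'"
  shows "wp order_tops Q s"
proof -
  have "x < L" "y < L" "warr s 4 = ord"
    using R_bounds[OF assms(4)] R_bounds[OF assms(5)] sizes assms(1) by (auto simp: tree_state_def)
  note st = this
  show ?thesis
  proof (cases "ord x < ord y")
    case True
    have "Q (s\<lparr>wvar := (wvar s)(15 := ord y, 14 := x, 10 := y, 11 := x), clock := Suc (Suc (Suc (Suc (Suc (Suc (clock s))))))\<rparr>)"
      by (rule Q[of y x]) (use True in auto)
    then show ?thesis
      unfolding order_tops_def using assms(2,3) st True by (simp add: wp_simps cell_ok_def)
  next
    case False
    have "Q (s\<lparr>wvar := (wvar s)(14 := ord x, 15 := ord y), clock := Suc (Suc (Suc (clock s)))\<rparr>)"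
      by (rule Q[of x y]) (use False assms(2,3) in auto)
    then show ?thesis
      unfolding order_tops_def using assms(2,3) st False by (simp add: wp_simps cell_ok_def)
  qed
qed

lemma wp_assign_top:
  assumes "tree_state s" "wvar s 10 = x" "x \<in> R" "T.union_find X (warr s 5) (warr s 6) tip rt"
    and Q: "\<And>s'. \<lbrakk>wvar s' 15 = rt x; wvar s' 16 = rt (par x); \<forall>i<14. wvar s' i = wvar s i; lvar s' 5 = lvar s 5;
      warr s' = warr s; larr s' = (larr s)(2 := (larr s 2)(x := lvar s 5 - ereal (D x)));
      clock s' \<le> clock s + 6 * H + 10\<rbrakk> \<Longrightarrow> Q s'"
  shows "wp assign_top Q s"
proof -
  have p: "par x \<in> R" using T.par_R[OF assms(3)] .
  have st: "x < L" "warr s 0 = par" "larr s 0 x = ereal (D x)"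
    using R_bounds[OF assms(3)] sizes assms(1,3) by (auto simp: tree_state_def)
  let ?s1 = "s\<lparr>lvar := (lvar s)(4 := lvar s 5 - ereal (D x)),
    larr := (larr s)(2 := (larr s 2)(x := lvar s 5 - ereal (D x))),
    wvar := (wvar s)(14 := par x, 15 := x), clock := Suc (Suc (Suc (Suc (Suc (clock s)))))\<rparr>"
  have "wp (find_root 15) (wp (Act (Copy 16 14) ;; find_root 16) Q) ?s1"
  proof (rule wp_find_root[where X = X and rt = rt and tip = tip and x = x])
    fix i assume i: "i \<le> clock ?s1 + 3 * H + 2"
    let ?s2 = "?s1\<lparr>wvar := (wvar ?s1)(19 := rt x, 15 := rt x, 16 := par x), clock := Suc i\<rparr>"
    have "wp (find_root 16) Q ?s2"
      by (rule wp_find_root[where X = X and rt = rt and tip = tip and x = "par x"])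
        (use assms(2-4) p i in \<open>auto intro!: Q\<close>)
    then show "wp (Act (Copy 16 14) ;; find_root 16) Q (?s1\<lparr>wvar := (wvar ?s1)(19 := rt x, 15 := rt x), clock := i\<rparr>)"
      by (simp add: wp_simps)
  qed (use assms in simp_all)
  then show ?thesis
    unfolding assign_top_def using assms(2) st by (simp add: wp_simps cell_ok_def)
qed

lemma wp_merge_classes:
  assumes "tree_state s" "wvar s 15 = rx" "wvar s 16 = rp" "rx < L" "rp < L" "rx \<noteq> rp" "warr s 6 rp < n"
    and Q: "\<And>s' lo hi. \<lbrakk>lo = rx \<and> hi = rp \<or> lo = rp \<and> hi = rx; warr s 6 lo \<le> warr s 6 hi;
      warr s' 6 = (if warr s 6 lo = warr s 6 hi then (warr s 6)(hi := Suc (warr s 6 hi)) else warr s 6);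
      warr s' 5 = (warr s 5)(lo := hi); warr s' 7 = (warr s 7)(hi := warr s 7 rp);
      \<forall>j. j \<notin> {5, 6, 7} \<longrightarrow> warr s' j = warr s j; wvar s' 10 = warr s 7 rp;
      \<forall>i<14. i \<noteq> 10 \<longrightarrow> wvar s' i = wvar s i; lvar s' = lvar s; larr s' = larr s; clock s' \<le> clock s + 14\<rbrakk> \<Longrightarrow> Q s'"
  shows "wp merge_classes Q s"
proof -
  have c: "wvar s 5 = 1" using assms(1) by (simp add: tree_state_def constants_def)
  have rB: "Suc (warr s 6 rp) \<le> B" using assms(7) sizes by auto
  consider "warr s 6 rp < warr s 6 rx" | "warr s 6 rp = warr s 6 rx" | "warr s 6 rx < warr s 6 rp"
    by linarith
  then show ?thesis
  proof cases
    case 1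
    show ?thesis
      unfolding merge_classes_def using assms(2-6) 1
      by (simp add: wp_simps cell_ok_def) (rule Q[of rp rx]; simp)
  next
    case 2
    show ?thesis
      unfolding merge_classes_def using assms(2-6) 2 c rB
      by (simp add: wp_simps cell_ok_def) (rule Q[of rx rp]; simp)
  next
    case 3
    show ?thesis
      unfolding merge_classes_def using assms(2-6) 3
      by (simp add: wp_simps cell_ok_def) (rule Q[of rx rp]; simp)
  qed
qed

lemma wp_climb:
  assumes inv: "sweep_inv s" and xy: "wvar s 10 \<noteq> wvar s 11"
  shows "wp climb (\<lambda>s'. sweep_inv s' \<and> sweep_measure s' < sweep_measure s \<and>
    clock s' \<le> clock s + 16 * H + 50) s"
proof -
  obtain Q X rt where ts: "tree_state s" and en: "entered s Q"
    and sw: "T.sweep X (larr s 2) Q (wvar s 10) (wvar s 11) (lvar s 5)"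
    and uf: "T.union_find X (warr s 5) (warr s 6) (warr s 7) rt" and go: "wvar s 12 \<noteq> 0" "wvar s 12 \<le> 1"
    and xyR: "wvar s 10 \<in> R" "wvar s 11 \<in> R"
    using inv xy by (auto simp: sweep_inv_def)
  note D = T.union_findD[OF uf]
  let ?G = "\<lambda>s'. sweep_inv s' \<and> sweep_measure s' < sweep_measure s \<and> clock s' \<le> clock s + 16 * H + 50"
  show ?thesis
    unfolding climb_def wp_Seq
  proof (rule wp_order_tops[OF ts refl refl xyR])
    fix s1 :: store and x y
    assume xy': "x = wvar s 10 \<and> y = wvar s 11 \<or> x = wvar s 11 \<and> y = wvar s 10" "ord y \<le> ord x"
      and s1: "wvar s1 10 = x" "wvar s1 11 = y" "\<forall>i<14. i \<notin> {10, 11} \<longrightarrow> wvar s1 i = wvar s i"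
        "lvar s1 = lvar s" "warr s1 = warr s" "larr s1 = larr s" "clock s1 \<le> clock s + 6"
    have xR: "x \<in> R" "y \<in> R" "x \<noteq> y" using xy' xyR xy by auto
    have sw1: "T.sweep X (larr s 2) Q x y (lvar s 5)" using xy'(1) sw T.sweep_commute by auto
    have ts1: "tree_state s1" using ts s1 by (simp add: tree_state_def constants_def)
    have uf1: "T.union_find X (warr s1 5) (warr s1 6) (warr s 7) rt" using uf s1 by simp
    show "wp assign_top (wp merge_classes ?G) s1"
    proof (rule wp_assign_top[OF ts1 s1(1) xR(1) uf1])
      fix s2 :: store
      assume s2: "wvar s2 15 = rt x" "wvar s2 16 = rt (par x)" "\<forall>i<14. wvar s2 i = wvar s1 i" "lvar s2 5 = lvar s1 5"
        "warr s2 = warr s1" "larr s2 = (larr s1)(2 := (larr s1 2)(x := lvar s1 5 - ereal (D x)))"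
        "clock s2 \<le> clock s1 + 6 * H + 10"
      have ts2: "tree_state s2" using ts1 s2 by (simp add: tree_state_def constants_def)
      have pR: "par x \<in> R" using T.par_R[OF xR(1)] .
      note rx = D(1)[OF xR(1)] and rp = D(1)[OF pR]
      note br = R_bounds[OF rx] R_bounds[OF rp]
      have tops: "T.is_top X (par x) (warr s 7 (rt (par x)))" using D(8)[OF pR] .
      have xX: "x \<notin> X" and xt: "x \<noteq> r"
      proof -
        obtain c p q where "T.is_top X p x" "T.is_top X q y"
          using sw1 xR(3) unfolding T.sweep_def T.climbing_def by auto
        then show "x \<notin> X" "x \<noteq> r"
          using T.later_top_crossed[of X p x q y] xR(3) xy'(2) by (auto simp: T.is_top_def)
      qed
      have ord: "ord (par x) < ord x" using T.parent[OF xR(1) xt] by simp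
      \<comment> \<open>Without a value, \<open>x\<close> is its own top; sharing the class would
        put \<open>par x\<close> into the subtree of \<open>x\<close>.\<close>
      have ne: "rt x \<noteq> rt (par x)"
      proof
        assume "rt x = rt (par x)"
        then have "T.is_top X (par x) x" using T.top_self[OF D(8)[OF xR(1)] xX] tops by simp
        then show False using T.subtree_ord[of "par x" x] ord by (auto simp: T.is_top_def)
      qed
      show "wp merge_classes ?G s2"
      proof (rule wp_merge_classes[OF ts2 s2(1,2)])
        fix s3 :: store and lo hi
        assume lohi: "lo = rt x \<and> hi = rt (par x) \<or> lo = rt (par x) \<and> hi = rt x" "warr s2 6 lo \<le> warr s2 6 hi"
          and s3: "warr s3 6 = (if warr s2 6 lo = warr s2 6 hi then (warr s2 6)(hi := Suc (warr s2 6 hi)) else warr s2 6)"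
            "warr s3 5 = (warr s2 5)(lo := hi)" "warr s3 7 = (warr s2 7)(hi := warr s2 7 (rt (par x)))"
            "\<forall>j. j \<notin> {5, 6, 7} \<longrightarrow> warr s3 j = warr s2 j" "wvar s3 10 = warr s2 7 (rt (par x))"
            "\<forall>i<14. i \<noteq> 10 \<longrightarrow> wvar s3 i = wvar s2 i" "lvar s3 = lvar s2" "larr s3 = larr s2" "clock s3 \<le> clock s2 + 14"
        have r3: "warr s3 6 = (if warr s 6 lo = warr s 6 hi then (warr s 6)(hi := Suc (warr s 6 hi)) else warr s 6)"
          using s3(1) unfolding s2(5) s1(5) .
        have uf3: "T.union_find (insert x X) (warr s3 5) (warr s3 6) (warr s3 7) (\<lambda>v. if rt v = lo then hi else rt v)"
          using T.union_find_union[OF uf T.finite_R xR(1) xX xt lohi(1) lohi(2)[unfolded s2(5) s1(5)] r3]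
          unfolding s3(2,3) s2(5) s1(5) .
        define z where "z = warr s 7 (rt (par x))"
        have z: "wvar s3 10 = z" using s3(5) s2(5) s1(5) by (simp add: z_def)
        have "rt (par x) = lo \<or> rt (par x) = hi" using lohi(1) by auto
        then have "warr s3 7 (if rt (par x) = lo then hi else rt (par x)) = z"
          using s3(3) s2(5) s1(5) by (auto simp: z_def)
        then have topz: "T.is_top (insert x X) (par x) z"
          using T.union_findD(8)[OF uf3 pR] by simp
        then have zR: "z \<in> R" using T.subtree_root_R by (auto simp: T.is_top_def)
        have l3: "larr s3 2 = (larr s 2)(x := lvar s 5 - ereal (D x))" "lvar s3 5 = lvar s 5" "larr s3 3 = larr s 3" "warr s3 1 = warr s 1"
          "wvar s3 11 = y" "wvar s3 12 = wvar s 12"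
          using s3 s2 s1 by auto
        have sw3: "T.sweep (insert x X) (larr s3 2) Q (wvar s3 10) (wvar s3 11) (lvar s3 5)"
          unfolding l3 z using T.sweep_climb(1)[OF sw1 xR(3) xy'(2) topz] .
        have ts3: "tree_state s3" using ts2 s3 by (simp add: tree_state_def constants_def)
        have en3: "entered s3 Q" using en l3 by (simp add: entered_def)
        have inv3: "sweep_inv s3"
          unfolding sweep_inv_def using ts3 en3 sw3 uf3 l3 go z zR xR(2) by auto
        have fin: "larr s 2 x = \<infinity>" using sw xX xR(1) by (auto simp: T.sweep_def T.assigned_def)
        \<comment> \<open>While a climb is in progress, variable 5 holds a real weight. So the
          stored value is finite and \<open>x\<close> leaves \<open>unassigned\<close>.\<close>
        have "lvar s 5 - ereal (D x) \<noteq> \<infinity>"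
          using sw1 xR(3) by (auto simp: T.sweep_def T.climbing_def)
        then have "unassigned s3 = unassigned s - {x}" "x \<in> unassigned s"
          using xR fin by (auto simp: unassigned_def l3)
        moreover have "finite (unassigned s)" using T.finite_R by (simp add: unassigned_def)
        ultimately have "card (unassigned s3) < card (unassigned s)"
          by (metis card_Diff1_less)
        then show "?G s3"
          using inv3 l3 s3(9) s2(7) s1(7) by (simp add: sweep_measure_def)
      next
        have "warr s 6 (rt (par x)) < n" using rank_le(2)[OF uf rp] .
        then show "warr s2 6 (rt (par x)) < n" using s2(5) s1(5) by simp
      qed (use br ne sizes in auto)
    qed
  qed
qed

lemma wp_sweep_prog:
  assumes ts: "tree_state s" and en: "entered s (candidates m e par)"
    and init: "\<And>v. v \<in> R \<Longrightarrow> warr s 5 v = v \<and> warr s 6 v = 0 \<and> warr s 7 v = v \<and> larr s 2 v = \<infinity>"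
    and Q: "\<And>s' X w. \<lbrakk>tree_state s'; T.sweep X (larr s' 2) {} 0 0 w;
      clock s' \<le> clock s + (16 * H + 52) * (3 * m + 4)\<rbrakk> \<Longrightarrow> Q s'"
  shows "wp sweep_prog Q s"
proof -
  let ?C = "16 * H + 52"
  have loop: "wp (Loop (LessT 4 12) (Cond (NeqT 10 11) climb next_edge)) Q s0"
    if "sweep_inv s0" "sweep_measure s0 \<le> 3 * m + 2" "clock s0 = clock s + 3" for s0
    using that(1)
  proof (rule wp_Loop_timed[where I = sweep_inv and \<mu> = sweep_measure and k = ?C])
    fix s' assume I: "sweep_inv s'" and b: "holds (LessT 4 12) s'"
    have inv: "sweep_inv (tick (tick s'))" using I by (simp add: sweep_inv_clock)
    have "wvar s' 4 = 0" using I by (simp add: sweep_inv_def tree_state_def constants_def)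
    then have go: "wvar s' 12 \<noteq> 0" and h: "holds (NeqT 10 11) (tick s') \<longleftrightarrow> wvar s' 10 \<noteq> wvar s' 11" using b by simp_all
    have "wp (if holds (NeqT 10 11) (tick s') then climb else next_edge)
      (\<lambda>t. sweep_inv t \<and> sweep_measure t < sweep_measure (tick (tick s')) \<and>
        clock t \<le> clock (tick (tick s')) + 16 * H + 50) (tick (tick s'))"
      using wp_climb[OF inv] wp_next_edge[OF inv] go h by auto
    then show "wp (Cond (NeqT 10 11) climb next_edge)
      (\<lambda>t. sweep_inv t \<and> sweep_measure t < sweep_measure s' \<and> clock t \<le> clock s' + ?C) (tick s')"
      unfolding wp_Cond by (auto simp: sweep_measure_clock split: if_splits elim!: wp_mono)
  next
    fix s' assume I: "sweep_inv s'" and b: "\<not> holds (LessT 4 12) s'"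
      and k: "clock s' \<le> clock s0 + ?C * sweep_measure s0"
    have ts': "tree_state s'" using I by (simp add: sweep_inv_def)
    then have "wvar s' 12 = 0" using b by (simp add: tree_state_def constants_def)
    then obtain X where "T.sweep X (larr s' 2) {} (wvar s' 11) (wvar s' 11) (lvar s' 5)"
      using I by (auto simp: sweep_inv_def)
    then have "T.sweep X (larr (tick s') 2) {} 0 0 (lvar s' 5)" by (simp add: T.sweep_def)
    moreover have "?C * sweep_measure s0 \<le> ?C * (3 * m + 2)" using that(2) by (rule mult_left_mono) simp
    then have "clock (tick s') \<le> clock s + ?C * (3 * m + 4)" using k that(3) by (simp add: algebra_simps)
    ultimately show "Q (tick s')"
      using ts' by (intro Q) (auto simp: tree_state_clock)
  qed
  let ?s1 = "s\<lparr>wvar := (wvar s)(10 := 0, 11 := 0, 12 := 1), clock := Suc (Suc (Suc (clock s)))\<rparr>"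
  have "T.sweep {} (larr s 2) (candidates m e par) 0 0 (lvar s 5)"
    using init by (intro T.sweep_init) auto
  moreover have "T.union_find {} (warr s 5) (warr s 6) (warr s 7) (\<lambda>v. v)"
    using init by (intro T.union_find_init) auto
  moreover have "tree_state ?s1" using ts by (simp add: tree_state_def constants_def)
  moreover have "entered ?s1 (candidates m e par)" using en by (simp add: entered_def)
  ultimately have inv: "sweep_inv ?s1" 
    unfolding sweep_inv_def by (intro conjI exI[of _ "candidates m e par"] exI[of _ "{}"] exI[of _ "\<lambda>v. v"]) simp_all
  \<comment> \<open>Every reached vertex except the root has an edge to its parent; this bounds the
    number of climbs in terms of \<open>m\<close> instead of \<open>n\<close>.\<close>
  have "R \<subseteq> endpoints"
  proof
    fix x assume x: "x \<in> R"
    show "x \<in> endpoints"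
    proof (cases "x = r")
      case False
      then show ?thesis using T.parent[OF x False] edge_arc[of x "par x"] by auto
    qed simp
  qed
  then have "card R \<le> 2 * m + 1" using card_endpoints card_mono[of endpoints R] by auto
  moreover have "card (unassigned ?s1) \<le> card R" using T.finite_R by (intro card_mono) (auto simp: unassigned_def)
  moreover have "card (candidates m e par) \<le> card {1..m}" by (intro card_mono) (auto simp: candidates_def)
  moreover have "queue (m + 1) (warr s 1) = candidates m e par" using en by (simp add: entered_def)
  ultimately have "sweep_measure ?s1 \<le> 3 * m + 2" by (simp add: sweep_measure_def)
  then have "wp (Loop (LessT 4 12) (Cond (NeqT 10 11) climb next_edge)) Q ?s1"
    by (intro loop inv) simp_all
  then show ?thesis
    unfolding sweep_prog_def using sizes by (simp add: wp_simps)
qed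

end

section \<open>The output and the whole run\<close>

text \<open>The value of arc \<open>j\<close> goes to length cell \<open>m + j\<close> of array 9,
  behind the weights. That region still ends below \<open>9 * M\<close>, and the order of the arcs
  is the order required of the output.\<close>

definition emit_value :: cmd where
  "emit_value =
     Act (Arith Divide 15 10 6) ;; Act (Arith Plus 16 15 15) ;; Act (Arith Plus 16 16 16) ;;
     Act (Arith Plus 16 16 5) ;; Act (Arith Minus 16 16 10) ;;
     Act (Get 15 9 10) ;; Act (Arith Plus 15 15 5) ;; Act (Get 16 9 16) ;; Act (Arith Plus 16 16 5) ;;
     Act (Get 17 0 15) ;; Act (Arith Plus 18 10 3) ;;
     Cond (LessT 4 17) (Cond (NeqT 17 16) (Act (LGet 3 0 15)) (Act (LGet 3 2 15))) (Act (LInf 3)) ;;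
     Act (LPut 9 18 3) ;; Act (Arith Plus 10 10 5)"

definition emit_values :: cmd where
  "emit_values = Act (Const 10 0) ;; Loop (LessT 10 9) emit_value"

definition main_prog :: cmd where
  "main_prog = link_arcs ;; dijkstra_prog ;; enter_edges ;; sweep_prog ;; emit_values"

definition lookup_value :: "(nat \<Rightarrow> nat) \<Rightarrow> (nat \<Rightarrow> ereal) \<Rightarrow> (nat \<Rightarrow> ereal) \<Rightarrow> nat \<Rightarrow> nat \<Rightarrow> ereal" where
  "lookup_value par d f x y = (if par x = 0 then \<infinity> else if par x \<noteq> y then d x else f x)"

context instance_run
begin

lemma wp_emit_values:
  assumes c: "constants s"
    and Q: "\<And>s'. \<lbrakk>constants s'; warr s' = warr s; \<forall>j<9. larr s' j = larr s j;
      \<forall>j<2 * m. larr s' 9 (m + j) = lookup_value (warr s 0) (larr s 0) (larr s 2) (e j) (e (opp j));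
      clock s' \<le> clock s + 34 * m + 2\<rbrakk> \<Longrightarrow> Q s'"
  shows "wp emit_values Q s"
proof -
  define V where "V j = lookup_value (warr s 0) (larr s 0) (larr s 2) (e j) (e (opp j))" for j
  define I where "I s' \<longleftrightarrow> constants s' \<and> wvar s' 10 \<le> 2 * m \<and> warr s' = warr s \<and> (\<forall>j<9. larr s' j = larr s j) \<and>
    (\<forall>j<wvar s' 10. larr s' 9 (m + j) = V j)" for s' :: store
  have loop: "wp (Loop (LessT 10 9) emit_value) Q s0" if "I s0" "wvar s0 10 = 0" "clock s0 = Suc (clock s)" for s0
    using that(1)
  proof (rule wp_Loop_timed[where I = I and \<mu> = "\<lambda>s. 2 * m - wvar s 10" and k = 17])
    fix s' assume I: "I s'" and b: "holds (LessT 10 9) s'"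
    define j where "j = wvar s' 10"
    have w: "wvar s' 10 = j" by (simp add: j_def)
    have c: "constants s'" using I by (simp add: I_def)
    note cc = c[unfolded constants_def]
    have j: "j < 2 * m" using b cc by (simp add: w)
    have h: "warr s' = warr s" "\<And>j. j < 9 \<Longrightarrow> larr s' j = larr s j" "\<And>k. k < j \<Longrightarrow> larr s' 9 (m + k) = V k"
      using I by (auto simp: I_def w)
    define x where "x = e j"
    define y where "y = e (opp j)"
    have oj: "opp j < 2 * m" "j div 2 < m" using j by auto
    have raw: "Suc (warr s 9 j) = x" "Suc (warr s 9 (opp j)) = y"
      using cc j oj h(1) by (auto simp: x_def y_def)
    have xy: "x \<le> n" "y \<le> n" using e_bounds[OF j] e_bounds[OF oj(1)] by (auto simp: x_def y_def)
    have o: "Suc (j div 2 + j div 2 + (j div 2 + j div 2)) - j = opp j" by (simp add: opp_def)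
    have sz: "j \<le> B" "j < 9 * M" "j div 2 \<le> B" "opp j \<le> B" "opp j < 9 * M" "x \<le> B" "x < L" "y \<le> B"
      "Suc (j div 2 + j div 2 + (j div 2 + j div 2)) \<le> B" "j div 2 + j div 2 + (j div 2 + j div 2) \<le> B"
      "j div 2 + j div 2 \<le> B" "j + m \<le> B" "j + m < 9 * M" "Suc j \<le> B"
      using sizes oj j xy by linarith+
    let ?w = "(wvar s')(15 := x, 16 := y, 17 := warr s 0 x, 18 := j + m, 10 := Suc j)"
    have fin: "I t"
      if "\<forall>i<10. wvar t i = wvar s' i" "wvar t 10 = Suc j" "warr t = warr s"
        "larr t = (larr s')(9 := (larr s' 9)(j + m := V j))" for t
    proof -
      have "constants t" using that cc h(1) by (simp add: constants_def)
      moreover have "larr t 9 (m + k) = V k" if "k < Suc j" for k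
        using \<open>larr t = _\<close> h(3) that by (auto simp: less_Suc_eq)
      ultimately show ?thesis using that j h(2) by (simp add: I_def)
    qed
    have dec: "2 * m - Suc j < 2 * m - j" using j by simp
    have V: "V j = lookup_value (warr s 0) (larr s 0) (larr s 2) x y" by (simp add: V_def x_def y_def)
    consider "warr s 0 x = 0" | "warr s 0 x \<noteq> 0" "warr s 0 x = y" | "warr s 0 x \<noteq> 0" "warr s 0 x \<noteq> y" by blast
    then show "wp emit_value (\<lambda>t. I t \<and> 2 * m - wvar t 10 < 2 * m - wvar s' 10 \<and> clock t \<le> clock s' + 17) (tick s')"
    proof cases
      case 1
      then have "V j = \<infinity>" by (simp add: V lookup_value_def)
      then show ?thesis
        using sz 1 unfolding w
        by (simp add: emit_value_def wp_simps cc w cell_ok_def o raw h(1) dec) (rule fin; simp add: h)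
    next
      case 2
      then have "V j = larr s 2 x" by (simp add: V lookup_value_def)
      then show ?thesis
        using sz 2 unfolding w
        by (simp add: emit_value_def wp_simps cc w cell_ok_def o raw h(1,2) dec) (rule fin; simp add: h)
    next
      case 3
      then have "V j = larr s 0 x" by (simp add: V lookup_value_def)
      then show ?thesis
        using sz 3 unfolding w
        by (simp add: emit_value_def wp_simps cc w cell_ok_def o raw h(1,2) dec) (rule fin; simp add: h)
    qed
  next
    fix s' assume I: "I s'" and b: "\<not> holds (LessT 10 9) s'" and k: "clock s' \<le> clock s0 + 17 * (2 * m - wvar s0 10)"
    then have w: "wvar s' 10 = 2 * m" by (auto simp: I_def constants_def)
    show "Q (tick s')"
      by (rule Q) (use I w k that(2,3) in \<open>auto simp: I_def constants_def V_def\<close>)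
  qed
  note cc = c[unfolded constants_def]
  have "I (s\<lparr>wvar := (wvar s)(10 := 0), clock := Suc (clock s)\<rparr>)"
    by (simp add: I_def constants_def cc)
  then show ?thesis
    unfolding emit_values_def by (simp add: wp_simps loop)
qed

lemma wp_main_prog:
  assumes init: "initial s"
    and Q: "\<And>s'. \<lbrakk>constants s';
      \<forall>j<2 * m. larr s' 9 (m + j) = repl_distance {1..n} E l r {e j, e (opp j)} (e j);
      \<forall>x y. {x, y} \<in> E \<longrightarrow>
        lookup_value (warr s' 0) (larr s' 0) (larr s' 2) x y = repl_distance {1..n} E l r {x, y} x;
      clock s' \<le> clock s + 900 * (H + 1) * (m + 1)\<rbrakk> \<Longrightarrow> Q s'"
  shows "wp main_prog Q s"
  unfolding main_prog_def wp_Seq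
proof (rule wp_link_arcs[OF init])
  fix s1 :: store
  assume s1: "constants s1" "adjacency s1" "\<forall>j\<in>{0, 1, 4, 5, 6, 7, 8}. warr s1 j = (\<lambda>_. 0)"
    "\<forall>j<9. larr s1 j = (\<lambda>_. 0)" "clock s1 \<le> clock s + 14 * m + 9"
  show "wp dijkstra_prog (wp enter_edges (wp sweep_prog (wp emit_values Q))) s1"
  proof (rule wp_dijkstra_prog[OF s1(1-4)])
    fix s2 :: store
    assume inv: "dijkstra_inv s2" and fin: "wvar s2 12 = 0"
      and t2: "clock s2 \<le> clock s1 + (10 * H + 25) * (4 * m + 3) + 1"
    define P where "P = warr s2 0"
    define ord where "ord = warr s2 4"
    define D where "D x = real_of_ereal (larr s2 0 x)" for x
    define R where "R = {x. ord x \<noteq> 0}"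
    have dj: "dijkstra P (larr s2 0) ord {} (wvar s2 10) (wvar s2 13) 0"
      using inv fin by (auto simp: dijkstra_inv_def P_def ord_def)
    have PR: "P x \<noteq> 0 \<longleftrightarrow> x \<in> R" for x using dijkstra_reached[OF dj] by (simp add: R_def)
    interpret S: shortest_path_tree "{1..n}" E l r R D P ord
      using dijkstra_final(1)[OF dj] by (simp add: R_def D_def[abs_def])
    interpret tree_run n m r E l e M L B H R D P ord
    proof
      have "R \<subseteq> {1..n}" using dijkstra_bounds[OF dj] by (auto simp: R_def)
      then show "finite R" by (rule finite_subset) simp
      fix k assume k: "k \<in> candidates m e P"
      then have "2 * (k - 1) < 2 * m" by (auto simp: candidates_def)
      then show "{end1 e k, end2 e k} \<in> E \<and> end1 e k \<in> R \<and> P (end1 e k) \<noteq> end2 e k \<and> P (end2 e k) \<noteq> end1 e k"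
        using k arc_edge[of "2 * (k - 1)"] PR by (auto simp: candidates_def end1_def end2_def opp_even)
    next
      fix x y assume xy: "{x, y} \<in> E" "x \<in> R" "P x \<noteq> y" "P y \<noteq> x"
      obtain j where j: "j < 2 * m" "e j = x" "e (opp j) = y" using edge_arc[OF xy(1)] by auto
      define k where "k = Suc (j div 2)"
      have ends: "end1 e k = x \<and> end2 e k = y \<or> end1 e k = y \<and> end2 e k = x"
        using j by (cases rule: opp_cases[of j]) (auto simp: k_def end1_def end2_def)
      have "k \<in> candidates m e P"
        using ends xy PR S.closed[OF xy(2,1)] j(1) by (auto simp: candidates_def k_def)
      then show "\<exists>k\<in>candidates m e P. {end1 e k, end2 e k} = {x, y}" using ends by auto
    qed (rule PR)
    have ts: "tree_state s2"
      unfolding tree_state_def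
      using inv dijkstra_final(2)[OF dj] by (auto simp: dijkstra_inv_def P_def ord_def D_def R_def)
    show "wp enter_edges (wp sweep_prog (wp emit_values Q)) s2"
    proof (rule wp_enter_edges[OF ts])
      show "warr s2 1 = (\<lambda>_. 0)" using inv by (simp add: dijkstra_inv_def)
      fix s3 :: store
      assume s3: "tree_state s3" "entered s3 (candidates m e P)" "\<forall>j\<in>{5, 6, 7}. warr s3 j = warr s2 j" "larr s3 2 = larr s2 2"
        "clock s3 \<le> clock s2 + (10 * H + 30) * (m + 1)"
      show "wp sweep_prog (wp emit_values Q) s3"
      proof (rule wp_sweep_prog[OF s3(1,2)])
        fix v assume "v \<in> R"
        then show "warr s3 5 v = v \<and> warr s3 6 v = 0 \<and> warr s3 7 v = v \<and> larr s3 2 v = \<infinity>"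
          using inv s3(3,4) by (auto simp: dijkstra_inv_def R_def ord_def)
      next
        fix s4 :: store and X w
        assume s4: "tree_state s4" "T.sweep X (larr s4 2) {} 0 0 w" "clock s4 \<le> clock s3 + (16 * H + 52) * (3 * m + 4)"
        have val: "lookup_value (warr s4 0) (larr s4 0) (larr s4 2) x y = repl_distance {1..n} E l r {x, y} x"
          if xy: "{x, y} \<in> E" for x y
        proof -
          have st: "warr s4 0 = P" "\<And>x. x \<in> R \<Longrightarrow> larr s4 0 x = ereal (D x)"
            using s4(1) by (auto simp: tree_state_def)
          show ?thesis
          proof (cases "x \<in> R")
            case False
            then show ?thesis using PR S.unreached by (auto simp: lookup_value_def st)
          next
            case True
            then have "P x \<noteq> 0" using PR by auto
            then show ?thesis
              using True st edge_bounds[OF xy] S.dist_without_nonparent[OF True]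
                T.sweep_final[OF s4(2) xy True] by (auto simp: lookup_value_def)
          qed
        qed
        have c4: "constants s4" using s4(1) by (simp add: tree_state_def)
        show "wp emit_values Q s4"
        proof (rule wp_emit_values[OF c4])
          fix s5 :: store
          assume s5: "constants s5" "warr s5 = warr s4" "\<forall>j<9. larr s5 j = larr s4 j"
            "\<forall>j<2 * m. larr s5 9 (m + j) = lookup_value (warr s4 0) (larr s4 0) (larr s4 2) (e j) (e (opp j))"
            "clock s5 \<le> clock s4 + 34 * m + 2"
          show "Q s5"
          proof (rule Q)
            show "\<forall>j<2 * m. larr s5 9 (m + j) = repl_distance {1..n} E l r {e j, e (opp j)} (e j)"
              using s5(4) val arc_edge by simp
            show "\<forall>x y. {x, y} \<in> E \<longrightarrow>
              lookup_value (warr s5 0) (larr s5 0) (larr s5 2) x y = repl_distance {1..n} E l r {x, y} x"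
              using val s5(2,3) by simp
            \<comment> \<open>The costs of the five phases; 900 is a generous common bound on the
              coefficients.\<close>
            have "clock s5 \<le> clock s + (14 * m + 9) + ((10 * H + 25) * (4 * m + 3) + 1) + (10 * H + 30) * (m + 1) +
              (16 * H + 52) * (3 * m + 4) + (34 * m + 2)"
              using s1(5) t2 s3(5) s4(3) s5(5) by linarith
            also have "\<dots> \<le> clock s + 900 * (H + 1) * (m + 1)"
              by (simp add: algebra_simps)
            finally show "clock s5 \<le> clock s + 900 * (H + 1) * (m + 1)" .
          qed (rule s5(1))
        qed
      qed
    qed
  qed
qed

end

section \<open>Machine programs\<close>

text \<open>
  The data structure starts at address \<open>9 * (2 * m + 1)\<close>, with the record of the first vertex.
\<close>

definition build_prog :: program where
  "build_prog =
     (let main = compile 6 main_prog in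
      [JumpLessW 3 1 2, Jump (13 + length main), MoveW 3 0, MoveW 5 2, MoveW 6 1, OpW Plus 0 1 1] @ main @
      [SetW 1 9, OpW Times 2 1 3, OpW Times 3 1 0, OpW Plus 3 3 1, MoveW 1 3, MoveW 4 2, MoveW 0 6])"

text \<open>After relocation the record of vertex \<open>u\<close> starts at \<open>9 * u\<close>;
  its length cells 0 and 2 are distance and replacement value. Parents are stored with the shift by
  one, hence the comparison with \<open>u' + 1\<close>, made by two strict tests. Address 15 is the
  end of the program.\<close>

definition query_prog :: program where
  "query_prog =
     [SetW 2 9, OpW Times 2 2 0, LoadW 3 2, LoadL 0 2, SetW 4 0, JumpLessW 4 3 8,
      InfL 0, Jump 15,
      SetW 4 1, OpW Plus 4 1 4, JumpLessW 3 4 15, JumpLessW 4 3 15,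
      SetW 4 2, OpW Plus 2 2 4, LoadL 0 2]"

lemma code_at_query:
  "code_at query_prog 0 [SetW 2 9, OpW Times 2 2 0, LoadW 3 2, LoadL 0 2, SetW 4 0]"
  "code_at query_prog 5 [JumpLessW 4 3 8, InfL 0, Jump 15]"
  "code_at query_prog 6 [InfL 0]"
  "code_at query_prog 7 [Jump 15]"
  "code_at query_prog 8 [SetW 4 1, OpW Plus 4 1 4]"
  "code_at query_prog 10 [JumpLessW 3 4 15, JumpLessW 4 3 15]"
  "code_at query_prog 11 [JumpLessW 4 3 15]"
  "code_at query_prog 12 [SetW 4 2, OpW Plus 2 2 4, LoadL 0 2]"
  by (auto simp: query_prog_def code_at_def less_Suc_eq)

lemma reach_jump_less:
  assumes "code_at P (pc r) (JumpLessW i j a # is)" "fits S r"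
  shows "reach P S r 1 (r\<lparr>pc := if wreg r i < wreg r j then a else Suc (pc r)\<rparr>)"
  using assms by (intro reach_step) (auto simp: code_at_Cons fits_def)

lemma query_correct:
  assumes u: "u < n" "u' < n" and len: "length ws = 9 * n" "length ls = 9 * n"
    and S: "\<And>w. w \<in> set ws \<Longrightarrow> w \<le> S" "9 * n \<le> S"
  shows "\<exists>k q. k \<le> 20 \<and> reach query_prog S (query_input ws ls u u') k q \<and> halted query_prog q \<and>
    lreg q 0 = (if ws ! (9 * u) = 0 then \<infinity> else if ws ! (9 * u) \<noteq> Suc u' then ls ! (9 * u) else ls ! (9 * u + 2))"
proof -
  let ?r0 = "query_input ws ls u u'"
  let ?p = "ws ! (9 * u)"
  have lt: "9 * u < length ws" "9 * u < length ls" "9 * u + 2 < length ls" using u len by auto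
  have p: "?p \<le> S" using S(1) lt by simp
  have b: "9 \<le> S" "9 * u + 2 \<le> S" "Suc u' \<le> S" using u S(2) by auto
  have reg: "wreg ?r0 i \<le> S" for i
    using u S(2) by (auto simp: query_input_def start_def cells_def nth_Cons split: nat.split)
  have f0: "fits S ?r0"
    using S reg len by (auto simp: fits_def query_input_def start_def cells_def)
  have w0: "wreg ?r0 0 = u" "wreg ?r0 1 = u'" "wmem ?r0 (9 * u) = ?p" "lmem ?r0 (9 * u) = ls ! (9 * u)"
    "lmem ?r0 (9 * u + 2) = ls ! (9 * u + 2)" "pc ?r0 = 0"
    using lt by (auto simp: query_input_def start_def cells_def)
  let ?is = "[SetW 2 9, OpW Times 2 2 0, LoadW 3 2, LoadL 0 2, SetW 4 0]"
  define r1 where "r1 = fold exec ?is ?r0"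
  have st: "straight S ?is ?r0"
    using f0 b p w0 by (auto simp: fits_def)
  have r1: "reach query_prog S ?r0 5 r1" "pc r1 = 5" "fits S r1"
    using reach_straight[OF _ f0 st, of query_prog, folded r1_def] code_at_query(1) w0(6)
    by (simp_all add: numeral_eq_Suc)
  have w1: "wreg r1 1 = u'" "wreg r1 2 = 9 * u" "wreg r1 3 = ?p" "wreg r1 4 = 0" "lreg r1 0 = ls ! (9 * u)"
    "lmem r1 = lmem ?r0"
    using w0 by (auto simp: r1_def)
  have halt: "halted query_prog (r\<lparr>pc := 15\<rparr>)" for r by (simp add: halted_def query_prog_def)
  have j1: "reach query_prog S r1 1 (r1\<lparr>pc := if 0 < ?p then 8 else 6\<rparr>)"
    using reach_jump_less[of query_prog r1 4 3 8] code_at_query(2) r1 w1 by auto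
  show ?thesis
  proof (cases "?p = 0")
    case True
    let ?r2 = "r1\<lparr>pc := 6\<rparr>"
    let ?r3 = "r1\<lparr>lreg := (lreg r1)(0 := \<infinity>), pc := 7\<rparr>"
    have f: "fits S ?r2" "fits S ?r3" using r1(3) by (auto simp: fits_def)
    have "reach query_prog S ?r2 1 ?r3"
      using code_at_query(3) f by (intro reach_step) (auto simp: code_at_Cons)
    moreover have "reach query_prog S ?r3 1 (?r3\<lparr>pc := 15\<rparr>)"
      using code_at_query(4) f by (intro reach_jump) auto
    ultimately have "reach query_prog S ?r0 (5 + 1 + 1 + 1) (?r3\<lparr>pc := 15\<rparr>)"
      using r1(1) j1 True by (intro reach_trans) auto
    then show ?thesis
      using True halt by (intro exI[of _ 8] exI[of _ "?r3\<lparr>pc := 15\<rparr>"]) auto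
  next
    case False
    let ?r2 = "r1\<lparr>pc := 8\<rparr>"
    let ?js = "[SetW 4 1, OpW Plus 4 1 4]"
    define r3 where "r3 = fold exec ?js ?r2"
    have st3: "straight S ?js ?r2" using r1(3) b w1 by (auto simp: fits_def)
    have f2: "fits S ?r2" using r1(3) by (auto simp: fits_def)
    have r3: "reach query_prog S ?r2 2 r3" "pc r3 = 10" "fits S r3"
      using reach_straight[OF _ f2 st3, of query_prog, folded r3_def] code_at_query(5)
      by (simp_all add: numeral_eq_Suc)
    have w3: "wreg r3 2 = 9 * u" "wreg r3 3 = ?p" "wreg r3 4 = Suc u'" "lreg r3 0 = ls ! (9 * u)" "lmem r3 = lmem ?r0"
      using w1 by (auto simp: r3_def)
    have to3: "reach query_prog S ?r0 (5 + 1 + 2) r3"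
      using r1(1) j1 False r3(1) by (intro reach_trans) auto
    have j3: "reach query_prog S r3 1 (r3\<lparr>pc := if ?p < Suc u' then 15 else 11\<rparr>)"
      using reach_jump_less[of query_prog r3 3 4 15] code_at_query(6) r3 w3 by auto
    show ?thesis
    proof (cases "?p < Suc u'")
      case True
      then have "reach query_prog S ?r0 (5 + 1 + 2 + 1) (r3\<lparr>pc := 15\<rparr>)"
        using to3 j3 by (intro reach_trans[OF to3]) auto
      then show ?thesis
        using True False halt w3 by (intro exI[of _ 9] exI[of _ "r3\<lparr>pc := 15\<rparr>"]) auto
    next
      case ge: False
      let ?r4 = "r3\<lparr>pc := 11\<rparr>"
      have f4: "fits S ?r4" using r3(3) by (auto simp: fits_def)
      have "reach query_prog S ?r4 1 (?r4\<lparr>pc := if Suc u' < ?p then 15 else 12\<rparr>)"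
        using reach_jump_less[of query_prog ?r4 4 3 15] code_at_query(7) f4 w3 by auto
      then have to4: "reach query_prog S ?r0 (5 + 1 + 2 + 1 + 1) (?r4\<lparr>pc := if Suc u' < ?p then 15 else 12\<rparr>)"
        using j3 ge by (intro reach_trans[OF reach_trans[OF to3]]) auto
      show ?thesis
      proof (cases "Suc u' < ?p")
        case True
        then show ?thesis
          using to4 False halt w3 by (intro exI[of _ 10] exI[of _ "r3\<lparr>pc := 15\<rparr>"]) auto
      next
        case eq: False
        let ?r5 = "r3\<lparr>pc := 12\<rparr>"
        let ?ks = "[SetW 4 2, OpW Plus 2 2 4, LoadL 0 2]"
        have f5: "fits S ?r5" using r3(3) by (auto simp: fits_def)
        have st5: "straight S ?ks ?r5" using r3(3) b w3 by (auto simp: fits_def)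
        define r6 where "r6 = fold exec ?ks ?r5"
        have r6: "reach query_prog S ?r5 3 r6" "pc r6 = 15"
          using reach_straight[OF _ f5 st5, of query_prog, folded r6_def] code_at_query(8)
          by (simp_all add: numeral_eq_Suc)
        have "reach query_prog S ?r0 (5 + 1 + 2 + 1 + 1 + 3) r6"
          using to4 eq r6(1) by (intro reach_trans[OF to4]) auto
        moreover have "halted query_prog r6"
          using r6(2) by (simp add: halted_def query_prog_def)
        moreover have "lreg r6 0 = ls ! (9 * u + 2)"
          using w3 w0(5) by (simp add: r6_def)
        ultimately show ?thesis
          using ge eq False by (intro exI[of _ 13] exI[of _ r6]) auto
      qed
    qed
  qed
qed

section \<open>Renumbering of the vertices and the logarithmic bound\<close>

text \<open>Each of the two distances, transported along \<open>Suc\<close>, is a feasible potential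
  for the other graph, so no correspondence between walks has to be set up.\<close>

lemma distance_Suc:
  assumes G: "simple_graph V E" and t: "t \<in> V"
  shows "distance (Suc ` V) ((`) Suc ` E) (\<lambda>a. l ((\<lambda>x. x - 1) ` a)) (Suc x) (Suc t) = distance V E l x t"
    (is "distance ?V ?E ?l _ _ = _")
proof (rule antisym)
  have edge: "\<exists>a b. x = Suc a \<and> y = Suc b \<and> {a, b} \<in> E" if xy: "{x, y} \<in> ?E" for x y
  proof -
    obtain d where d: "d \<in> E" "{x, y} = Suc ` d" using xy by auto
    then obtain a b where "x = Suc a" "y = Suc b" "a \<in> d" "b \<in> d"
      by (metis imageE insertI1 insert_commute)
    moreover have "d = {a, b}" using d(2) calculation by (auto simp: set_eq_iff image_iff)
    ultimately show ?thesis using d(1) by auto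
  qed
  have edge': "{Suc a, Suc b} \<in> ?E" if "{a, b} \<in> E" for a b
    using imageI[OF that, of "(`) Suc"] by simp
  have G': "simple_graph ?V ?E"
    using G unfolding simple_graph_def by fastforce
  show "distance ?V ?E ?l (Suc x) (Suc t) \<le> distance V E l x t"
  proof (rule potential_le_distance[OF G, where f = "\<lambda>x. distance ?V ?E ?l (Suc x) (Suc t)"])
    show "distance ?V ?E ?l (Suc t) (Suc t) \<le> 0" using t by (intro distance_refl[OF G']) auto
    fix a b assume "{a, b} \<in> E"
    from distance_step[OF G' edge'[OF this], of ?l "Suc t"]
    show "distance ?V ?E ?l (Suc a) (Suc t) \<le> ereal (l {a, b}) + distance ?V ?E ?l (Suc b) (Suc t)"
      by simp
  qed
  have "distance V E l (Suc x - 1) t \<le> distance ?V ?E ?l (Suc x) (Suc t)"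
  proof (rule potential_le_distance[OF G', where f = "\<lambda>x. distance V E l (x - 1) t"])
    show "distance V E l (Suc t - 1) t \<le> 0" using distance_refl[OF G t] by simp
    fix x y assume "{x, y} \<in> ?E"
    then obtain a b where "x = Suc a" "y = Suc b" "{a, b} \<in> E" using edge by blast
    then show "distance V E l (x - 1) t \<le> ereal (?l {x, y}) + distance V E l (y - 1) t"
      using distance_step[OF G, of a b l t] by simp
  qed
  then show "distance V E l x t \<le> distance ?V ?E ?l (Suc x) (Suc t)" by simp
qed

lemma repl_distance_Suc:
  assumes G: "simple_graph {..<n} E" and t: "t < n"
  shows "repl_distance {1..n} ((`) Suc ` E) (\<lambda>a. l ((\<lambda>x. x - 1) ` a)) (Suc t) {Suc u, Suc v} (Suc x) =
    repl_distance {..<n} E l t {u, v} x"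
proof -
  have "(`) Suc ` E - {{Suc u, Suc v}} = (`) Suc ` (E - {{u, v}})"
    using inj_image_eq_iff[of Suc _ "{u, v}"] by (auto simp: image_iff)
  moreover have "{1..n} = Suc ` {..<n}" by (simp add: image_Suc_lessThan)
  moreover have "distance (Suc ` {..<n}) ((`) Suc ` (E - {{u, v}})) (\<lambda>a. l ((\<lambda>x. x - 1) ` a)) (Suc x) (Suc t) =
      distance {..<n} (E - {{u, v}}) l x t"
    by (intro distance_Suc simple_graph_mono[OF G]) (use t in auto)
  ultimately show ?thesis
    unfolding repl_distance_def by simp
qed

lemma edge_words:
  "length (concat (map (\<lambda>(u, v). [u, v]) es)) = 2 * length es"
  "i < length es \<Longrightarrow> concat (map (\<lambda>(u, v). [u, v]) es) ! (2 * i) = fst (es ! i)"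
  "i < length es \<Longrightarrow> concat (map (\<lambda>(u, v). [u, v]) es) ! (2 * i + 1) = snd (es ! i)"
proof -
  show len: "length (concat (map (\<lambda>(u, v). [u, v]) es)) = 2 * length es" for es :: "('a \<times> 'a) list"
    by (induction es) auto
  show "i < length es \<Longrightarrow> concat (map (\<lambda>(u, v). [u, v]) es) ! (2 * i) = fst (es ! i)"
    "i < length es \<Longrightarrow> concat (map (\<lambda>(u, v). [u, v]) es) ! (2 * i + 1) = snd (es ! i)"
  proof (induction es arbitrary: i)
    case (Cons p es)
    {
      case 1
      then show ?case using Cons.IH(1)[of "i - 1"] by (cases i; cases p) auto
    next
      case 2
      then show ?case using Cons.IH(2)[of "i - 1"] by (cases i; cases p) auto
    }
  qed auto
qed

text \<open>Because \<open>m \<le> n * n\<close>, a multiple of the logarithm of \<open>n\<close>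
  also covers the tournament of the edges. The witness is \<open>2 * h + 2\<close> with
  \<open>n \<le> 2 ^ h\<close>; the logarithm is at least 1, so the factor 6 absorbs the
  constants.\<close>

lemma log_bound:
  assumes "2 \<le> n" "m \<le> n * n"
  obtains H :: nat where "2 * (n + 1) \<le> 2 ^ H" "2 * (m + 1) \<le> 2 ^ H" "1 \<le> H" "real H \<le> 6 * log 2 (real n)"
proof -
  define h where "h = nat \<lceil>log 2 (real n)\<rceil>"
  have l1: "1 \<le> log 2 (real n)" using assms(1) by (simp add: le_log_iff)
  have h: "log 2 (real n) \<le> real h" "real h \<le> log 2 (real n) + 1"
    using l1 unfolding h_def by linarith+
  have "real n = 2 powr log 2 (real n)" using assms(1) by simp
  also have "\<dots> \<le> 2 powr real h" using h(1) by simp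
  also have "\<dots> = real (2 ^ h)" by (simp add: powr_realpow)
  finally have n: "n \<le> 2 ^ h" by (simp only: of_nat_le_iff)
  have "n * n \<le> 2 ^ h * 2 ^ h" using n by (intro mult_mono) auto
  moreover define X :: nat where "X = 2 ^ (2 * h + 2)"
  ultimately have nn: "4 * (n * n) \<le> X" by (simp add: power_add mult_2)
  define q where "q = n * n"
  have q: "2 * n \<le> q" "4 * q \<le> X" "m \<le> q" using assms nn by (simp_all add: q_def)
  show thesis
  proof
    show "2 * (n + 1) \<le> 2 ^ (2 * h + 2)" unfolding X_def[symmetric] using q assms(1) by (simp add: distrib_left)
    show "2 * (m + 1) \<le> 2 ^ (2 * h + 2)" unfolding X_def[symmetric] using q assms(1) by (simp add: distrib_left)
    show "1 \<le> 2 * h + 2" by simp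
    show "real (2 * h + 2) \<le> 6 * log 2 (real n)" using h(2) l1 by simp
  qed
qed

lemma code_at_build:
  "code_at build_prog 2 [MoveW 3 0, MoveW 5 2, MoveW 6 1, OpW Plus 0 1 1]"
  "code_at build_prog 6 (compile 6 main_prog)"
  "code_at build_prog (6 + length (compile 6 main_prog))
     [SetW 1 9, OpW Times 2 1 3, OpW Times 3 1 0, OpW Plus 3 3 1, MoveW 1 3, MoveW 4 2, MoveW 0 6]"
proof -
  have "code_at build_prog 0 ([JumpLessW 3 1 2, Jump (13 + length (compile 6 main_prog))] @
      [MoveW 3 0, MoveW 5 2, MoveW 6 1, OpW Plus 0 1 1] @ compile 6 main_prog @
      [SetW 1 9, OpW Times 2 1 3, OpW Times 3 1 0, OpW Plus 3 3 1, MoveW 1 3, MoveW 4 2, MoveW 0 6])"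
    by (simp add: code_at_def build_prog_def Let_def)
  then show "code_at build_prog 2 [MoveW 3 0, MoveW 5 2, MoveW 6 1, OpW Plus 0 1 1]"
    "code_at build_prog 6 (compile 6 main_prog)"
    "code_at build_prog (6 + length (compile 6 main_prog))
     [SetW 1 9, OpW Times 2 1 3, OpW Times 3 1 0, OpW Plus 3 3 1, MoveW 1 3, MoveW 4 2, MoveW 0 6]"
    unfolding code_at_append by (simp_all add: numeral_eq_Suc)
qed

lemma runs_iff_reach: "runs P s T S s' \<longleftrightarrow> (\<exists>k. real k \<le> T \<and> reach P S s k s' \<and> halted P s')"
  by (auto simp: runs_def reach_def)

text \<open>Without edges only constant time is allowed, whereas even entering the root into the
  queue takes about \<open>log n\<close> rounds; so the program halts at once. Registers keep the
  input: register 2 still holds \<open>t\<close>, which makes the word part \<open>t\<close> cells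
  long, and the length part is empty.\<close>

lemma build_without_edges:
  assumes "t < n" "n \<le> S"
  shows "\<exists>s. reach build_prog S (graph_input n [] l t) 2 s \<and> halted build_prog s \<and>
    length (ds_words s) + length (ds_lengths s) \<le> n"
proof -
  let ?r = "graph_input n [] l t"
  have w: "wreg ?r i = (if i = 0 then n else if i = 2 then t else 0)" for i
    by (auto simp: graph_input_def start_def cells_def nth_Cons split: nat.split)
  have p: "pc ?r = 0" by (simp add: graph_input_def start_def)
  have f: "fits S (?r\<lparr>pc := i\<rparr>)" "fits S ?r" for i
    using assms w by (auto simp: fits_def graph_input_def start_def cells_def)
  let ?q = "?r\<lparr>pc := 13 + length (compile 6 main_prog)\<rparr>"
  have "reach build_prog S ?r 1 (?r\<lparr>pc := 1\<rparr>)"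
    by (rule reach_step) (use f w p in \<open>auto simp: build_prog_def Let_def\<close>)
  moreover have "reach build_prog S (?r\<lparr>pc := 1\<rparr>) 1 ?q"
    by (rule reach_step) (use f in \<open>auto simp: build_prog_def Let_def\<close>)
  ultimately have "reach build_prog S ?r (1 + 1) ?q" by (rule reach_trans)
  moreover have "halted build_prog ?q" by (simp add: halted_def build_prog_def Let_def)
  moreover have "length (ds_words ?q) + length (ds_lengths ?q) \<le> n"
    using w assms by (simp add: ds_words_def ds_lengths_def block_def)
  ultimately show ?thesis by (intro exI[of _ ?q]) (simp add: numeral_2_eq_2)
qed

section \<open>The run on a given input with at least one edge\<close>

locale input_graph =
  fixes n :: nat and E :: "nat set set" and l :: "nat set \<Rightarrow> real" and t :: nat and es :: "(nat \<times> nat) list"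
  assumes input_simple: "simple_graph {..<n} E" and nonneg: "\<forall>a\<in>E. 0 \<le> l a" and t: "t < n"
    and edges: "lists_edges es E" and some_edge: "es \<noteq> []"
begin

abbreviation "m \<equiv> length es"

definition tail :: "nat \<Rightarrow> nat" where
  "tail j = concat (map (\<lambda>(u, v). [u, v]) es) ! j"

lemma tail_even: "i < m \<Longrightarrow> tail (2 * i) = fst (es ! i)"
  and tail_odd: "i < m \<Longrightarrow> tail (2 * i + 1) = snd (es ! i)"
  using edge_words(2,3)[of i es] by (auto simp: tail_def)

lemma nth_edge: "i < m \<Longrightarrow> {fst (es ! i), snd (es ! i)} \<in> E"
  using edges by (force simp: lists_edges_def case_prod_unfold)

lemma card_E: "card E = m"
  using edges distinct_card[of "map (\<lambda>(u, v). {u, v}) es"] by (auto simp: lists_edges_def)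

lemma n_ge_2: "2 \<le> n"
proof -
  have "{fst (es ! 0), snd (es ! 0)} \<in> E" using some_edge by (intro nth_edge) simp
  then show ?thesis using simple_graph_edgeD[OF input_simple] by fastforce
qed

lemma m_le: "m \<le> n * n"
proof -
  have "set es \<subseteq> {..<n} \<times> {..<n}"
  proof
    fix p assume "p \<in> set es"
    then obtain i where "i < m" "p = es ! i" by (auto simp: in_set_conv_nth)
    then have "{fst p, snd p} \<in> E" using nth_edge by auto
    then show "p \<in> {..<n} \<times> {..<n}"
      using simple_graph_edgeD[OF input_simple] by (cases p) auto
  qed
  moreover have "distinct es" using edges by (simp add: lists_edges_def distinct_map)
  ultimately have "m \<le> card ({..<n} \<times> {..<n})"
    by (metis card_mono distinct_card finite_SigmaI finite_lessThan)
  then show ?thesis by simp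
qed

lemma arc_ends: "j < 2 * m \<Longrightarrow> {tail j, tail (opp j)} = {fst (es ! (j div 2)), snd (es ! (j div 2))}"
proof (rule opp_cases[of j])
  fix i assume "j < 2 * m" "j = 2 * i" "opp j = 2 * i + 1"
  then show ?thesis using tail_even[of i] tail_odd[of i] by auto
next
  fix i assume "j < 2 * m" "j = 2 * i + 1" "opp j = 2 * i"
  then show ?thesis using tail_even[of i] tail_odd[of i] by auto
qed

abbreviation "E' \<equiv> (`) Suc ` E"
abbreviation "l' \<equiv> \<lambda>a. l ((\<lambda>x. x - 1) ` a)"

sublocale graph_arcs n m "Suc t" E' l' "\<lambda>j. Suc (tail j)"
proof
  show "simple_graph {1..n} E'"
    unfolding simple_graph_def
  proof (intro conjI ballI)
    fix a assume "a \<in> E'"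
    then obtain d where "d \<in> E" "a = Suc ` d" by auto
    then obtain u v where "u < n" "v < n" "u \<noteq> v" "a = {Suc u, Suc v}"
      using input_simple by (auto simp: simple_graph_def)
    then show "\<exists>u\<in>{1..n}. \<exists>v\<in>{1..n}. u \<noteq> v \<and> a = {u, v}"
      by (intro bexI[of _ "Suc u"] bexI[of _ "Suc v"]) auto
  qed simp
  show "0 \<le> l' a" if "a \<in> E'" for a
    using that nonneg by (auto simp: image_image)
  show "1 \<le> Suc t" "Suc t \<le> n" using t by auto
  show "{Suc (tail j), Suc (tail (opp j))} \<in> E'" if "j < 2 * m" for j
  proof -
    have "{tail j, tail (opp j)} \<in> E" using arc_ends[OF that] nth_edge that by simp
    then have "Suc ` {tail j, tail (opp j)} \<in> E'" by (rule imageI)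
    then show ?thesis by simp
  qed
  show "\<exists>j<2 * m. Suc (tail j) = x \<and> Suc (tail (opp j)) = y" if xy: "{x, y} \<in> E'" for x y
  proof -
    obtain d where d: "d \<in> E" "{x, y} = Suc ` d" using xy by auto
    then obtain i where i: "i < m" "d = {fst (es ! i), snd (es ! i)}"
      using edges by (auto simp: lists_edges_def case_prod_unfold in_set_conv_nth)
    then have "x = Suc (tail (2 * i)) \<and> y = Suc (tail (2 * i + 1)) \<or> x = Suc (tail (2 * i + 1)) \<and> y = Suc (tail (2 * i))"
      using d(2) tail_even tail_odd by (auto simp: doubleton_eq_iff)
    moreover have "2 * i < 2 * m" "2 * i + 1 < 2 * m" using i by auto
    ultimately show ?thesis using opp_even opp_odd by metis
  qed
qed

lemma build_correct:
  "\<exists>k s. real k \<le> 200000 * (1 + real m * log 2 (real n)) \<and>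
     reach build_prog (100 * (n + m)) (graph_input n es l t) k s \<and> halted build_prog s \<and>
     outputs_values {..<n} E es l t s \<and> length (ds_words s) = 9 * n \<and> length (ds_lengths s) = 9 * n \<and>
     (\<forall>u v. {u, v} \<in> E \<longrightarrow>
       (let p = ds_words s ! (9 * u) in
        (if p = 0 then \<infinity> else if p \<noteq> Suc v then ds_lengths s ! (9 * u) else ds_lengths s ! (9 * u + 2))
          = repl_distance {..<n} E l t {u, v} u))"
proof -
  obtain H :: nat where HH: "2 * (n + 1) \<le> 2 ^ H" "2 * (m + 1) \<le> 2 ^ H" "1 \<le> H" "real H \<le> 6 * log 2 (real n)"
    using log_bound[OF n_ge_2 m_le] .
  define S where "S = 100 * (n + m)"
  \<comment> \<open>\<open>M\<close> is the length of the word part of the input. \<open>L\<close>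
    makes room for tournaments over \<open>n + 1\<close> and \<open>m + 1\<close> items with two
    cells per item, and \<open>B\<close> for index computations such as
    \<open>4 * (j div 2) + 1\<close>. \<open>S\<close> suffices for all of this because
    \<open>n\<close> is at least 2.\<close>
  define M where "M = 2 * m"
  define L where "L = 2 * n + 2 * m + 2"
  define B where "B = 8 * n + 8 * m + 8"
  interpret instance_run n m "Suc t" E' l' "\<lambda>j. Suc (tail j)" M L B H
    using HH(1,2) by unfold_locales (auto simp: M_def L_def B_def)
  interpret bounded_machine M L B S
    using n_ge_2 by unfold_locales (auto simp: M_def L_def B_def S_def)
  define words where "words = concat (map (\<lambda>(u, v). [u, v]) es)"
  define lens where "lens = map (\<lambda>(u, v). ereal (l {u, v})) es"
  have len: "length words = 2 * m" "length lens = m" by (simp_all add: words_def lens_def edge_words)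
  define r0 where "r0 = graph_input n es l t"
  have r0: "pc r0 = 0" "wreg r0 i = (if i = 0 then n else if i = 1 then m else if i = 2 then t else 0)"
    "wmem r0 = cells words" "lmem r0 = cells lens" for i
    by (auto simp: r0_def graph_input_def start_def words_def lens_def cells_def nth_Cons split: nat.split)
  have words: "cells words a \<le> n" for a
  proof (cases "a < 2 * m")
    case True
    then have "Suc (tail a) \<le> n" using e_bounds by auto
    then show ?thesis using True len by (simp add: cells_def tail_def words_def)
  qed (use len in \<open>simp add: cells_def\<close>)
  have S: "n \<le> S" "m + m \<le> S" "m \<le> S" "t \<le> S" "2 * m \<le> S" using t by (auto simp: S_def)
  have words_S: "cells words a \<le> S" for a using words[of a] S(1) by (rule order_trans)
  have mem0: "cells words a = 0" "cells lens a = 0" if "a \<ge> 2 * m" for a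
    using that len by (auto simp: cells_def)
  have f0: "fits S r0" "fits S (r0\<lparr>pc := 2\<rparr>)"
    using S words_S mem0 by (auto simp: fits_def r0)
  let ?main = "compile 6 main_prog"
  let ?is = "[MoveW 3 0, MoveW 5 2, MoveW 6 1, OpW Plus 0 1 1]"
  have m_pos: "0 < m" using some_edge by simp
  have j0: "reach build_prog S r0 1 (r0\<lparr>pc := 2\<rparr>)"
    by (rule reach_step) (use f0 r0 m_pos in \<open>auto simp: build_prog_def Let_def\<close>)
  define r1 where "r1 = fold exec ?is (r0\<lparr>pc := 2\<rparr>)"
  have "straight S ?is (r0\<lparr>pc := 2\<rparr>)"
    using f0(1) S by (auto simp: fits_def r0)
  from reach_straight[OF _ f0(2) this, of build_prog, folded r1_def] code_at_build(1)
  have r1: "reach build_prog S (r0\<lparr>pc := 2\<rparr>) 4 r1" "pc r1 = 6" "fits S r1"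
    by (simp_all add: numeral_eq_Suc)
  have w1: "wreg r1 0 = M" "wreg r1 3 = n" "wreg r1 5 = t" "wreg r1 6 = m" "wmem r1 = cells words" "lmem r1 = cells lens"
    by (simp_all add: r1_def r0 M_def)
  define s0 where "s0 = \<lparr>wvar = \<lambda>x. wreg r1 (x + 3), lvar = lreg r1, warr = \<lambda>j i. wmem r1 (address M j i),
    larr = \<lambda>j i. lmem r1 (address M j i), clock = 0\<rparr>"
  have rel: "rel s0 r1" unfolding rel_def using r1(3) w1 by (simp add: s0_def)
  have "initial s0"
    unfolding initial_def
  proof (intro conjI allI impI)
    show "wvar s0 0 = n" "Suc (wvar s0 2) = Suc t" "wvar s0 3 = m" by (simp_all add: s0_def w1)
    show "Suc (warr s0 9 j) = Suc (tail j)" if "j < 2 * m" for j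
      using that len by (simp add: s0_def address_def w1 cells_def tail_def words_def)
    show "larr s0 9 i = ereal (l' {Suc (tail (2 * i)), Suc (tail (2 * i + 1))})" if i: "i < m" for i
      using i tail_even[OF i] tail_odd[OF i] len
      by (simp add: s0_def address_def w1 cells_def lens_def case_prod_unfold)
    show "warr s0 j = (\<lambda>_. 0)" "larr s0 j = (\<lambda>_. 0)" if "j < 9" for j
      using that mem0 by (auto simp: s0_def address_def w1 M_def)
  qed
  then have "wp main_prog (\<lambda>s'. constants s' \<and>
      (\<forall>j<2 * m. larr s' 9 (m + j) = repl_distance {1..n} E' l' (Suc t) {Suc (tail j), Suc (tail (opp j))} (Suc (tail j))) \<and>
      (\<forall>x y. {x, y} \<in> E' \<longrightarrow>
        lookup_value (warr s' 0) (larr s' 0) (larr s' 2) x y = repl_distance {1..n} E' l' (Suc t) {x, y} x) \<and>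
      clock s' \<le> clock s0 + 900 * (H + 1) * (m + 1)) s0"
    by (rule wp_main_prog) blast
  moreover have "clock s0 = 0" by (simp add: s0_def)
  ultimately obtain s' where s': "big main_prog s0 s'" "constants s'"
    "\<And>j. j < 2 * m \<Longrightarrow> larr s' 9 (m + j) =
      repl_distance {1..n} E' l' (Suc t) {Suc (tail j), Suc (tail (opp j))} (Suc (tail j))"
    "\<And>x y. {x, y} \<in> E' \<Longrightarrow>
      lookup_value (warr s' 0) (larr s' 0) (larr s' 2) x y = repl_distance {1..n} E' l' (Suc t) {x, y} x"
    "clock s' \<le> 900 * (H + 1) * (m + 1)"
    unfolding wp_def by (metis add_0)
  obtain k r2 where r2: "reach build_prog S r1 k r2" "k \<le> 6 * clock s'" "pc r2 = 6 + length ?main" "rel s' r2"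
    using compile_correct[OF s'(1) rel, of build_prog] code_at_build(2) r1(2) by (auto simp: s0_def)
  have reg2: "wreg r2 0 = M" "wreg r2 3 = n" "wreg r2 6 = m"
  proof -
    have r: "wreg r2 (x + 3) = wvar s' x" "wreg r2 0 = M" for x using r2(4) by (auto simp: rel_def)
    show "wreg r2 0 = M" "wreg r2 3 = n" "wreg r2 6 = m"
      using r(2) r(1)[of 0] r(1)[of 3] s'(2)[unfolded constants_def] by simp_all
  qed
  let ?ks = "[SetW 1 9, OpW Times 2 1 3, OpW Times 3 1 0, OpW Plus 3 3 1, MoveW 1 3, MoveW 4 2, MoveW 0 6]"
  define r3 where "r3 = fold exec ?ks r2"
  have f2: "fits S r2" using r2(4) by (rule rel_fits)
  have st: "straight S ?ks r2"
    using f2 n_ge_2 by (auto simp: fits_def reg2 M_def S_def)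
  from reach_straight[OF _ f2 st, of build_prog, folded r3_def] code_at_build(3) r2(3)
  have r3: "reach build_prog S r2 7 r3" "pc r3 = 13 + length ?main" "fits S r3"
    by (simp_all add: numeral_eq_Suc)
  have w3: "wreg r3 0 = m" "wreg r3 1 = 18 * m + 9" "wreg r3 2 = 9 * n" "wreg r3 3 = 18 * m + 9" "wreg r3 4 = 9 * n"
    "wmem r3 = wmem r2" "lmem r3 = lmem r2"
    by (simp_all add: r3_def reg2 M_def)
  have mem: "wmem r2 (9 * (M + i) + j) = warr s' j i" "lmem r2 (9 * (M + i) + j) = larr s' j i" if "j < 9" for i j
    using r2(4) that unfolding rel_def address_def by metis+
  have out: "lmem r2 i = larr s' 9 i" if "i < 18 * m" for i
    using r2(4) that unfolding rel_def address_def by (auto simp: M_def)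
  \<comment> \<open>The window starts at \<open>9 * (M + 1)\<close>, so vertex \<open>Suc u\<close>
    of the run has its record at offset \<open>9 * u\<close>; the further offsets 0 and 2 select
    arrays 0 and 2.\<close>
  have ds: "ds_words r3 ! (9 * u) = warr s' 0 (Suc u)" "ds_lengths r3 ! (9 * u) = larr s' 0 (Suc u)"
    "ds_lengths r3 ! (9 * u + 2) = larr s' 2 (Suc u)" if "u < n" for u
    using that mem(1)[of 0 "Suc u"] mem(2)[of 0 "Suc u"] mem(2)[of 2 "Suc u"] w3(2)
    by (simp_all add: ds_words_def ds_lengths_def block_def w3 M_def algebra_simps)
  have "reach build_prog S r0 (1 + 4 + k + 7) r3"
    using j0 r1(1) r2(1) r3(1) by (blast intro: reach_trans)
  moreover have "real (1 + 4 + k + 7) \<le> 200000 * (1 + real m * log 2 (real n))"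
  proof -
    have "k \<le> 6 * (900 * (H + 1) * (m + 1))" using r2(2) s'(5) by linarith
    \<comment> \<open>As \<open>H\<close> and \<open>m\<close> are positive, doubling absorbs the
      lower-order terms and leaves a pure multiple of \<open>m * H\<close>, with
      \<open>6 * 900 * 4 = 21600\<close>; replacing \<open>H\<close> by \<open>6 * log 2 n\<close>
      then gives 129600.\<close>
    also have "\<dots> \<le> 6 * (900 * (2 * H) * (2 * m))"
    proof (intro mult_left_mono mult_mono)
      show "H + 1 \<le> 2 * H" "m + 1 \<le> 2 * m" using HH(3) m_pos by linarith+
    qed auto
    finally have "k \<le> 21600 * (m * H)" by (simp add: mult.commute)
    then have "real k \<le> 21600 * (real m * real H)" by (metis of_nat_le_iff of_nat_mult of_nat_numeral)
    also have "\<dots> \<le> 21600 * (real m * (6 * log 2 (real n)))"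
      using HH(4) by (intro mult_left_mono) auto
    finally have "real k \<le> 129600 * (real m * log 2 (real n))" by simp
    moreover have "0 \<le> real m * log 2 (real n)" using n_ge_2 by simp
    ultimately show ?thesis by (simp add: distrib_left)
  qed
  moreover have "halted build_prog r3"
    using r3(2) by (simp add: halted_def build_prog_def Let_def)
  moreover have "outputs_values {..<n} E es l t r3"
    unfolding outputs_values_def
  proof (intro allI impI)
    fix i assume i: "i < m"
    have val: "lmem r3 (m + j) = repl_distance {..<n} E l t {tail j, tail (opp j)} (tail j)" if "j < 2 * m" for j
      using s'(3)[OF that] out[of "m + j"] that repl_distance_Suc[OF input_simple t] by (simp add: w3)
    show "case es ! i of (u, v) \<Rightarrow>
        lmem r3 (wreg r3 0 + 2 * i) = repl_distance {..<n} E l t {u, v} u \<and>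
        lmem r3 (wreg r3 0 + 2 * i + 1) = repl_distance {..<n} E l t {u, v} v"
      using val[of "2 * i"] val[of "2 * i + 1"] i tail_even[OF i] tail_odd[OF i] opp_even[of i] opp_odd[of i]
      by (auto simp: w3 case_prod_unfold insert_commute)
  qed
  moreover have "length (ds_words r3) = 9 * n" "length (ds_lengths r3) = 9 * n"
    by (simp_all add: ds_words_def ds_lengths_def block_def w3)
  moreover have "(let p = ds_words r3 ! (9 * u) in
        (if p = 0 then \<infinity> else if p \<noteq> Suc v then ds_lengths r3 ! (9 * u) else ds_lengths r3 ! (9 * u + 2))
          = repl_distance {..<n} E l t {u, v} u)" if uv: "{u, v} \<in> E" for u v
  proof -
    have u: "u < n" using simple_graph_edgeD[OF input_simple uv] by auto
    have "Suc ` {u, v} \<in> E'" using uv by (rule imageI)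
    then have "{Suc u, Suc v} \<in> E'" by simp
    from s'(4)[OF this] show ?thesis
      unfolding Let_def ds[OF u] lookup_value_def repl_distance_Suc[OF input_simple t] .
  qed
  ultimately show ?thesis unfolding r0_def S_def by blast
qed

end

theorem theorem1:
  shows "\<exists>(build :: program) (query :: program) (C :: nat).
    \<forall>(n :: nat) (E :: nat set set) (l :: nat set \<Rightarrow> real) (t :: nat) (es :: (nat \<times> nat) list).
      simple_graph {..<n} E \<longrightarrow> (\<forall>e\<in>E. 0 \<le> l e) \<longrightarrow> t \<in> {..<n} \<longrightarrow> lists_edges es E \<longrightarrow>
      (\<exists>s. runs build (graph_input n es l t)
              (real C * (1 + real (card E) * log 2 (real n))) (C * (n + card E)) s \<and>
           outputs_values {..<n} E es l t s \<and>
           length (ds_words s) + length (ds_lengths s) \<le> C * n \<and>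
           (\<forall>u u'. {u, u'} \<in> E \<longrightarrow>
              (\<exists>q. runs query (query_input (ds_words s) (ds_lengths s) u u')
                      (real C) (C * (n + card E)) q \<and>
                   lreg q 0 = repl_distance {..<n} E l t {u, u'} u)))"
proof (rule exI[of _ build_prog], rule exI[of _ query_prog], rule exI[of _ 200000], intro allI impI)
  fix n :: nat and E :: "nat set set" and l :: "nat set \<Rightarrow> real" and t :: nat and es :: "(nat \<times> nat) list"
  assume *: "simple_graph {..<n} E" "\<forall>e\<in>E. 0 \<le> l e" "t \<in> {..<n}" "lists_edges es E"
  let ?C = "200000 :: nat"
  \<comment> \<open>A configuration that fits into some space fits into any larger one, so the
    sharper space bounds can be relaxed to the common constant.\<close>
  have mono: "reach P (?C * (n + card E)) r k r'" if "reach P S r k r'" "S \<le> ?C * (n + card E)" for P S r k r'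
    using that unfolding reach_def fits_def by (meson order_trans)
  show "\<exists>s. runs build_prog (graph_input n es l t)
              (real ?C * (1 + real (card E) * log 2 (real n))) (?C * (n + card E)) s \<and>
           outputs_values {..<n} E es l t s \<and>
           length (ds_words s) + length (ds_lengths s) \<le> ?C * n \<and>
           (\<forall>u u'. {u, u'} \<in> E \<longrightarrow>
              (\<exists>q. runs query_prog (query_input (ds_words s) (ds_lengths s) u u')
                      (real ?C) (?C * (n + card E)) q \<and>
                   lreg q 0 = repl_distance {..<n} E l t {u, u'} u))"
  proof (cases "es = []")
    case True
    then have E: "E = {}" using *(4) by (simp add: lists_edges_def)
    obtain s where s: "reach build_prog (?C * n) (graph_input n [] l t) 2 s" "halted build_prog s"
      "length (ds_words s) + length (ds_lengths s) \<le> n"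
      using build_without_edges[of t n "?C * n" l] *(3) by auto
    have "runs build_prog (graph_input n es l t)
        (real ?C * (1 + real (card E) * log 2 (real n))) (?C * (n + card E)) s"
      unfolding runs_iff_reach using s True E by (intro exI[of _ 2]) simp
    moreover have "outputs_values {..<n} E es l t s" using True by (simp add: outputs_values_def)
    ultimately show ?thesis using s(3) E by (intro exI[of _ s]) simp
  next
    case False
    interpret input_graph n E l t es using * False by unfold_locales auto
    obtain k s where s: "real k \<le> 200000 * (1 + real m * log 2 (real n))"
      "reach build_prog (100 * (n + m)) (graph_input n es l t) k s" "halted build_prog s"
      "outputs_values {..<n} E es l t s" "length (ds_words s) = 9 * n" "length (ds_lengths s) = 9 * n"
      and val: "\<And>u v. {u, v} \<in> E \<Longrightarrow>
       (let p = ds_words s ! (9 * u) in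
        (if p = 0 then \<infinity> else if p \<noteq> Suc v then ds_lengths s ! (9 * u) else ds_lengths s ! (9 * u + 2))
          = repl_distance {..<n} E l t {u, v} u)"
      using build_correct by blast
    have big: "reach build_prog (?C * (n + card E)) (graph_input n es l t) k s"
      using s(2) by (rule mono) (simp add: card_E)
    then have run: "runs build_prog (graph_input n es l t)
        (real ?C * (1 + real (card E) * log 2 (real n))) (?C * (n + card E)) s"
      unfolding runs_iff_reach using s(1,3) by (auto simp: card_E)
    have "fits (?C * (n + card E)) s"
      using big unfolding reach_def by blast
    then have le: "w \<le> ?C * (n + card E)" if "w \<in> set (ds_words s)" for w
      using that by (auto simp: ds_words_def block_def fits_def)
    have "\<exists>q. runs query_prog (query_input (ds_words s) (ds_lengths s) u v) (real ?C) (?C * (n + card E)) q \<and>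
        lreg q 0 = repl_distance {..<n} E l t {u, v} u" if uv: "{u, v} \<in> E" for u v
    proof -
      have "u < n" "v < n" using simple_graph_edgeD[OF input_simple uv] by auto
      from query_correct[OF this s(5,6) le]
      obtain i q where q: "i \<le> 20" "reach query_prog (?C * (n + card E)) (query_input (ds_words s) (ds_lengths s) u v) i q"
        "halted query_prog q"
        "lreg q 0 = (if ds_words s ! (9 * u) = 0 then \<infinity> else if ds_words s ! (9 * u) \<noteq> Suc v then ds_lengths s ! (9 * u)
           else ds_lengths s ! (9 * u + 2))"
        by auto
      then show ?thesis
        using val[OF uv] unfolding runs_iff_reach Let_def by (intro exI[of _ q] conjI exI[of _ i]) auto
    qed
    then show ?thesis
      using run s(4-6) by (intro exI[of _ s]) auto
  qed
qed

end
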